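(* Let $N\ge 2$ be an integer, $1<p<N$, $p^*=\frac{Np}{N-p}$, and let $V:\mathbb{Z}^N\to\mathbb{R}$ and $f:\mathbb{Z}^N\times\mathbb{R}\to\mathbb{R}$ satisfy the following conditions, where $F(x,t)=\int_0^t f(x,s)\,ds$: (S1) there is a positive integer $T$ such that $V(x)$ and $f(x,t)$ are both $T$-periodic in $x$, and $\inf_{x\in\mathbb{Z}^N}V(x)\ge 0$; (S2) $f(x,t)$ is continuous in $t$ for every $x\in\mathbb{Z}^N$, and $|f(x,t)|\le a(1+|t|^{q-1})$ for all $(x,t)$, for some constants $a>0$ and $q>p^*$; (S3) $f(x,t)=o(|t|^{p^*-1})$ uniformly in $x$ as $|t|\to0$; (S4) $t\mapsto \frac{f(x,t)}{|t|^{p-1}}$ is strictly increasing on $(-\infty,0)\cup(0,\infty)$ for each $x\in\mathbb{Z}^N$; (S5) $\frac{F(x,t)}{|t|^p}\to\infty$ uniformly in $x$ as $|t|\to\infty$. Then the equation $$-\Delta_p u+V(x)|u|^{p-2}u=f(x,u)\ \text{ on }\mathbb{Z}^N,\qquad u\in E,$$ admits a ground state solution, i.e. there is a solution $u\in\mathcal{N}$ of the equation with $\Phi(u)=\inf_{v\in\mathcal{N}}\Phi(v)$. Moreover, if $F(x,t)\le F(x,|t|)$ for all $(x,t)\in\mathbb{Z}^N\times\mathbb{R}$, then every ground state solution $u$ is either positive ($u(x)>0$ for all $x$) or negative ($u(x)<0$ for all $x$).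
   Context: The lattice graph $\mathbb{Z}^N$ has vertex set $\mathbb{Z}^N$, with $x\sim y$ iff $\sum_{i=1}^N|x_i-y_i|=1$. A function $h$ on $\mathbb{Z}^N$ is $T$-periodic if $h(x+Te_i)=h(x)$ for all $x$ and $1\le i\le N$ ($e_i$ the $i$-th unit vector). Convention: $|s|^{p-2}s=0$ for $s=0$. The $p$-Laplacian is $\Delta_p u(x)=\sum_{y\sim x}|u(y)-u(x)|^{p-2}(u(y)-u(x))$, and $\nabla_{xy}u=u(y)-u(x)$. Sums over $x\sim y$ are over ordered pairs. The norm is $\|u\|=\Big(\sum_{x\sim y}\frac12|\nabla_{xy}u|^p+\sum_{x}V(x)|u(x)|^p\Big)^{1/p}$, and $E$ is the completion, with respect to $\|\cdot\|$, of the space $C_c(\mathbb{Z}^N)$ of finitely supported real functions, regarded as a space of functions on $\mathbb{Z}^N$. The energy functional on $E$ is $\Phi(u)=\frac1p\|u\|^p-\sum_{x}F(x,u(x))$, with derivative $\langle\Phi'(u),v\rangle=\sum_{x\sim y}\frac12|\nabla_{xy}u|^{p-2}(\nabla_{xy}u)(\nabla_{xy}v)+\sum_xV(x)|u|^{p-2}uv-\sum_xf(x,u)v$. The Nehari manifold is $\mathcal{N}=\{u\in E\setminus\{0\}:\langle\Phi'(u),u\rangle=0\}$. A function $u\in\mathcal{N}$ is called a ground state solution if $\Phi(u)=\inf_{v\in\mathcal{N}}\Phi(v)$. A solution of the equation is a $u\in E$ satisfying it at every $x\in\mathbb{Z}^N$. *)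

theory Defs
  imports "HOL-Analysis.Analysis"
begin

text \<open>The vertex set of the lattice graph is \<^typ>\<open>int ^ 'n\<close>, so that the dimension is
  the cardinality of the finite index type \<^typ>\<open>'n\<close>.
  The convention \<open>|s| powr (p - 2) * s = 0\<close> at \<open>s = 0\<close> needs no case distinction,
  also for \<open>p < 2\<close>, since \<open>0 powr a = 0\<close>.\<close>

definition adj :: "int ^ 'n::finite \<Rightarrow> int ^ 'n \<Rightarrow> bool" where
  "adj x y \<longleftrightarrow> (\<Sum>i\<in>UNIV. \<bar>x $ i - y $ i\<bar>) = 1"

definition edges :: "((int ^ 'n::finite) \<times> (int ^ 'n)) set" where
  "edges = {(x, y). adj x y}"

definition periodic :: "nat \<Rightarrow> (int ^ 'n::finite \<Rightarrow> 'b) \<Rightarrow> bool" where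
  "periodic T h \<longleftrightarrow> (\<forall>x i. h (x + axis i (int T)) = h x)"

definition grad :: "(int ^ 'n::finite \<Rightarrow> real) \<Rightarrow> int ^ 'n \<Rightarrow> int ^ 'n \<Rightarrow> real" where
  "grad u x y = u y - u x"

definition p_laplacian :: "real \<Rightarrow> (int ^ 'n::finite \<Rightarrow> real) \<Rightarrow> int ^ 'n \<Rightarrow> real" where
  "p_laplacian p u x = (\<Sum>y | adj x y. \<bar>u y - u x\<bar> powr (p - 2) * (u y - u x))"

definition crit_exp :: "nat \<Rightarrow> real \<Rightarrow> real" where
  "crit_exp N p = real N * p / (real N - p)"

definition energy_norm ::
    "real \<Rightarrow> (int ^ 'n::finite \<Rightarrow> real) \<Rightarrow> (int ^ 'n \<Rightarrow> real) \<Rightarrow> real" where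
  "energy_norm p V u =
     ((\<Sum>\<^sub>\<infinity>(x, y)\<in>edges. 1 / 2 * \<bar>grad u x y\<bar> powr p)
      + (\<Sum>\<^sub>\<infinity>x. V x * \<bar>u x\<bar> powr p)) powr (1 / p)"

text \<open>The completion of the finitely supported functions, realised as a space of functions:
  a Cauchy sequence is identified with its pointwise limit. For \<open>V \<ge> 0\<close> and
  \<open>1 < p < N\<close> the discrete Sobolev inequality makes this identification well defined and
  injective modulo null sequences, and the norm of the completion is then given by
  the formula in \<^const>\<open>energy_norm\<close>, with summable families. Merely asking for
  \<open>\<parallel>\<phi>\<^sub>k - u\<parallel> \<longlongrightarrow> 0\<close> would be wrong: for \<open>V = 0\<close> it admits all constants.\<close>

definition energy_space ::
    "real \<Rightarrow> (int ^ 'n::finite \<Rightarrow> real) \<Rightarrow> (int ^ 'n \<Rightarrow> real) set" where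
  "energy_space p V =
     {u. \<exists>\<phi> :: nat \<Rightarrow> int ^ 'n \<Rightarrow> real.
           (\<forall>k. finite {x. \<phi> k x \<noteq> 0}) \<and>
           (\<forall>\<epsilon>>0. \<exists>K. \<forall>m\<ge>K. \<forall>k\<ge>K. energy_norm p V (\<lambda>x. \<phi> m x - \<phi> k x) < \<epsilon>) \<and>
           (\<forall>x. (\<lambda>k. \<phi> k x) \<longlonglongrightarrow> u x)}"

text \<open>The interval integral is oriented, so that this is correct for \<open>t < 0\<close> as well.\<close>

definition primitive :: "(int ^ 'n::finite \<Rightarrow> real \<Rightarrow> real) \<Rightarrow> int ^ 'n \<Rightarrow> real \<Rightarrow> real" where
  "primitive f x t = (LBINT s=ereal 0..ereal t. f x s)"

definition energy ::
    "real \<Rightarrow> (int ^ 'n::finite \<Rightarrow> real) \<Rightarrow> (int ^ 'n \<Rightarrow> real \<Rightarrow> real) \<Rightarrow>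
     (int ^ 'n \<Rightarrow> real) \<Rightarrow> real" where
  "energy p V f u = 1 / p * energy_norm p V u powr p - (\<Sum>\<^sub>\<infinity>x. primitive f x (u x))"

definition energy_deriv ::
    "real \<Rightarrow> (int ^ 'n::finite \<Rightarrow> real) \<Rightarrow> (int ^ 'n \<Rightarrow> real \<Rightarrow> real) \<Rightarrow>
     (int ^ 'n \<Rightarrow> real) \<Rightarrow> (int ^ 'n \<Rightarrow> real) \<Rightarrow> real" where
  "energy_deriv p V f u v =
     (\<Sum>\<^sub>\<infinity>(x, y)\<in>edges. 1 / 2 * \<bar>grad u x y\<bar> powr (p - 2) * grad u x y * grad v x y)
     + (\<Sum>\<^sub>\<infinity>x. V x * \<bar>u x\<bar> powr (p - 2) * u x * v x)
     - (\<Sum>\<^sub>\<infinity>x. f x (u x) * v x)"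

definition nehari ::
    "real \<Rightarrow> (int ^ 'n::finite \<Rightarrow> real) \<Rightarrow> (int ^ 'n \<Rightarrow> real \<Rightarrow> real) \<Rightarrow>
     (int ^ 'n \<Rightarrow> real) set" where
  "nehari p V f = {u \<in> energy_space p V - {\<lambda>_. 0}. energy_deriv p V f u u = 0}"

definition is_solution ::
    "real \<Rightarrow> (int ^ 'n::finite \<Rightarrow> real) \<Rightarrow> (int ^ 'n \<Rightarrow> real \<Rightarrow> real) \<Rightarrow>
     (int ^ 'n \<Rightarrow> real) \<Rightarrow> bool" where
  "is_solution p V f u \<longleftrightarrow> u \<in> energy_space p V \<and>
     (\<forall>x. - p_laplacian p u x + V x * \<bar>u x\<bar> powr (p - 2) * u x = f x (u x))"

text \<open>Under the assumptions of the theorem the energy is nonnegative on the Nehari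
  manifold, so that the real infimum is the true one. Solving the equation is not part of
  this definition.\<close>

definition is_ground_state ::
    "real \<Rightarrow> (int ^ 'n::finite \<Rightarrow> real) \<Rightarrow> (int ^ 'n \<Rightarrow> real \<Rightarrow> real) \<Rightarrow>
     (int ^ 'n \<Rightarrow> real) \<Rightarrow> bool" where
  "is_ground_state p V f u \<longleftrightarrow>
     u \<in> nehari p V f \<and> energy p V f u = (INF v\<in>nehari p V f. energy p V f v)"

end

theory Submission
  imports Defs "HOL-Complex_Analysis.Great_Picard"
begin

text \<open>Write \<open>Q u\<close> for the \<open>p\<close>-th power of the norm, \<open>p\<^sup>*\<close> for the critical exponent,
\<open>G x t = f x t * t\<close>, \<open>H = G / p - F\<close> and \<open>J u = Q u - \<Sum>G x (u x)\<close>, which is the derivative of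
the energy \<open>\<Phi>\<close> at \<open>u\<close> in the direction \<open>u\<close>. The ground state is found by minimising \<open>\<Phi>\<close> on the
Nehari manifold \<open>J = 0\<close>, and compactness, which fails because of translations, is replaced by
splitting off the weak limit of a minimising sequence.

The analytic input is the discrete Sobolev inequality (\<open>discrete_Sobolev\<close>): functions of finite
energy lie in \<open>\<ell>\<^sup>q\<close> for \<open>q = p\<^sup>*\<close>, and on a lattice this makes them bounded. It is proved by
cutting \<open>\<bar>u\<bar>\<close> into dyadic slices. On one slice, comparing \<open>u\<close> with its translates over a box whose
volume is about twice that of the support bounds the measure of the top level; the resulting recursion
between consecutive levels closes up exactly at the exponent \<open>p\<^sup>*\<close>. It follows that the energy
space consists of the functions of finite energy in this \<open>\<ell>\<^sup>q\<close>
(\<open>mem_energy_space\<close>), and that the behaviour of \<open>f\<close> near zero controls all sums over \<open>F\<close> and \<open>G\<close>.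

Strict monotonicity of \<open>f x t / \<bar>t\<bar> powr (p - 1)\<close> gives the pointwise inequality
\<open>F x (s t) - F x t \<ge> (s\<^sup>p - 1) / p * G x t\<close> (\<open>F_scale_ge\<close>). Summed over the lattice it says
that \<open>\<Phi> (s u) \<le> \<Phi> u + (s\<^sup>p - 1) / p * J u\<close>, so a point of the Nehari manifold maximises \<open>\<Phi>\<close> along
its ray, and pointwise it makes \<open>H\<close> nonnegative and monotone along rays. On the Nehari manifold
\<open>\<Phi> u = \<Sum>H x (u x)\<close>.

A minimising sequence is bounded by the superlinearity of \<open>F\<close>, does not vanish uniformly, and can
be translated by periods so that a subsequence converges pointwise to some \<open>w \<noteq> 0\<close>. With
\<open>y\<^sub>n = v\<^sub>n - w\<close>, a Brezis-Lieb splitting shows that \<open>J\<close> of \<open>y\<^sub>n\<close> tends to \<open>- J w\<close> and that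
\<open>\<Sum>H\<close> of \<open>y\<^sub>n\<close> tends to the infimum minus \<open>\<Sum>H x (w x)\<close>. If \<open>J w > 0\<close>, then shrinking \<open>y\<^sub>n\<close>
to the Nehari manifold gives points of energy below the infimum; hence \<open>J w \<le> 0\<close>, and shrinking
\<open>w\<close> gives a minimiser (\<open>ground_level_attained\<close>).

As \<open>f\<close> is merely continuous, the Nehari manifold need not be smooth, and Lagrange multipliers are
not available. Instead, if a minimiser \<open>u\<close> violates the equation at a vertex \<open>y\<close>, then changing the
value at \<open>y\<close> slightly and rescaling back to the Nehari manifold, by a factor near 1, lowers the
energy (\<open>ground_state_critical\<close>); only finitely many terms are affected by such a change.

For the sign, \<open>F x t \<le> F x \<bar>t\<bar>\<close> makes a multiple of \<open>\<bar>u\<bar>\<close> a ground state too. It solves the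
equation, so by the strong maximum principle it has no zeros, and a bond on which \<open>u\<close> changes sign
would make \<open>Q \<bar>u\<bar>\<close> strictly smaller than \<open>Q u\<close>, against minimality (\<open>ground_state_signed\<close>).\<close>

section \<open>Infinite sums\<close>

lemma infsum_diff_real:
  fixes f g :: "'a \<Rightarrow> real"
  assumes "f summable_on A" "g summable_on A"
  shows "(\<lambda>i. f i - g i) summable_on A" "infsum (\<lambda>i. f i - g i) A = infsum f A - infsum g A"
  using summable_on_add[OF assms(1) summable_on_uminus[THEN iffD2, OF assms(2)]]
    infsum_add[OF assms(1) summable_on_uminus[THEN iffD2, OF assms(2)]]
  by (simp_all add: infsum_uminus)

lemma infsum_strict_mono_real:
  fixes g h :: "'a \<Rightarrow> real"
  assumes "g summable_on UNIV" "h summable_on UNIV" "\<And>i. g i \<le> h i" "g j < h j"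
  shows "infsum g UNIV < infsum h UNIV"
proof -
  have "0 < (\<Sum>i\<in>{j}. h i - g i)" using assms(4) by simp
  also have "\<dots> \<le> infsum (\<lambda>i. h i - g i) UNIV"
    using assms by (intro finite_sum_le_infsum infsum_diff_real) auto
  also have "\<dots> = infsum h UNIV - infsum g UNIV" using assms by (intro infsum_diff_real)
  finally show ?thesis by simp
qed

lemma infsum_Fatou:
  fixes f :: "'b \<Rightarrow> 'a \<Rightarrow> real"
  assumes "F \<noteq> bot" and nonneg: "\<And>b i. 0 \<le> f b i"
    and sm: "\<And>b. f b summable_on UNIV" and bd: "\<And>b. infsum (f b) UNIV \<le> B"
    and lim: "\<And>i. ((\<lambda>b. f b i) \<longlongrightarrow> g i) F"
  shows "g summable_on UNIV" "infsum g UNIV \<le> B"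
proof -
  have *: "sum g K \<le> B" if "finite K" for K
  proof (rule tendsto_upperbound)
    show "((\<lambda>b. \<Sum>i\<in>K. f b i) \<longlongrightarrow> sum g K) F"
      using lim by (intro tendsto_sum) auto
    show "\<forall>\<^sub>F b in F. (\<Sum>i\<in>K. f b i) \<le> B"
      using finite_sum_le_infsum[OF sm that] nonneg bd by (intro always_eventually) (meson order.trans subset_UNIV)
  qed fact
  have nn: "0 \<le> g i" for i
    by (rule tendsto_lowerbound[OF lim]) (use assms in auto)
  show sg: "g summable_on UNIV"
    by (rule nonneg_bdd_above_summable_on) (use nn * in \<open>auto intro!: bdd_aboveI\<close>)
  show "infsum g UNIV \<le> B"
    by (rule infsum_le_finite_sums[OF sg]) (use * in auto)
qed

text \<open>Common source of dominated convergence (\<open>e = 0\<close>) and of the Brezis-Lieb splittings. Outside a finite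
set the fixed majorant \<open>C * h\<close> is negligible, on it the terms tend to zero, and the moving majorant
\<open>e b\<close> costs at most \<open>\<epsilon> * B\<close>.\<close>

lemma infsum_almost_dominated:
  fixes d e :: "'b \<Rightarrow> 'a \<Rightarrow> real" and h :: "'a \<Rightarrow> real"
  assumes lim: "\<And>i. ((\<lambda>b. d b i) \<longlongrightarrow> 0) F"
    and dom: "\<And>\<epsilon>. \<epsilon> > 0 \<Longrightarrow> \<exists>C. \<forall>\<^sub>F b in F. \<forall>i. \<bar>d b i\<bar> \<le> \<epsilon> * e b i + C * h i"
    and h: "h summable_on UNIV" "\<And>i. 0 \<le> h i"
    and e: "\<And>b. e b summable_on UNIV" "\<And>b i. 0 \<le> e b i" "\<And>b. infsum (e b) UNIV \<le> B"
  shows "((\<lambda>b. infsum (d b) UNIV) \<longlongrightarrow> 0) F"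
proof (rule tendstoI)
  fix \<delta> :: real assume \<delta>: "0 < \<delta>"
  define \<epsilon> where "\<epsilon> = \<delta> / (4 * (\<bar>B\<bar> + 1))"
  have \<epsilon>: "\<epsilon> > 0" using \<delta> by (simp add: \<epsilon>_def)
  then obtain C0 where C0: "\<forall>\<^sub>F b in F. \<forall>i. \<bar>d b i\<bar> \<le> \<epsilon> * e b i + C0 * h i"
    using dom by blast
  define C where "C = max C0 1"
  have C: "\<forall>\<^sub>F b in F. \<forall>i. \<bar>d b i\<bar> \<le> \<epsilon> * e b i + C * h i"
    using C0
  proof eventually_elim
    case (elim b)
    have "C0 * h i \<le> C * h i" for i using h(2) by (simp add: C_def mult_right_mono)
    then show ?case using elim by (meson add_left_mono order_trans)
  qed
  have "C > 0" by (simp add: C_def)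
  then obtain K where K: "finite K" "dist (sum h K) (infsum h UNIV) \<le> \<delta> / (4 * C)"
    using infsum_finite_approximation[OF h(1), of "\<delta> / (4 * C)"] \<delta> by auto
  have hK: "h summable_on (UNIV - K)" by (rule summable_on_subset_banach[OF h(1)]) auto
  have tail: "C * infsum h (UNIV - K) \<le> \<delta> / 4"
  proof -
    have "infsum h UNIV = sum h K + infsum h (UNIV - K)"
      using infsum_Un_disjoint[of h K "UNIV - K"] K hK by simp
    then have "infsum h (UNIV - K) \<le> \<delta> / (4 * C)" using K(2) by (simp add: dist_real_def)
    then show ?thesis using \<open>C > 0\<close> by (simp add: field_simps)
  qed
  have "((\<lambda>b. \<Sum>i\<in>K. \<bar>d b i\<bar>) \<longlongrightarrow> (\<Sum>i\<in>K. \<bar>0\<bar>)) F"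
    using lim by (intro tendsto_sum tendsto_rabs) auto
  then have "\<forall>\<^sub>F b in F. dist (\<Sum>i\<in>K. \<bar>d b i\<bar>) 0 < \<delta> / 4"
    using \<delta> by (intro tendstoD) auto
  with C show "\<forall>\<^sub>F b in F. dist (infsum (d b) UNIV) 0 < \<delta>"
  proof eventually_elim
    case (elim b)
    have s1: "(\<lambda>i. \<epsilon> * e b i + C * h i) summable_on A" for A
      by (intro summable_on_add summable_on_cmult_right summable_on_subset_banach[OF e(1)]
          summable_on_subset_banach[OF h(1)]) auto
    have s2: "(\<lambda>i. \<bar>d b i\<bar>) summable_on A" for A
      by (rule summable_on_comparison_test[OF s1]) (use elim in auto)
    have "infsum (\<lambda>i. \<bar>d b i\<bar>) (UNIV - K) \<le> infsum (\<lambda>i. \<epsilon> * e b i + C * h i) (UNIV - K)"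
      using s1 s2 elim by (intro infsum_mono) auto
    also have "\<dots> = \<epsilon> * infsum (e b) (UNIV - K) + C * infsum h (UNIV - K)"
      using summable_on_subset_banach[OF e(1)] hK
      by (subst infsum_add) (auto intro!: summable_on_cmult_right simp: infsum_cmult_right')
    also have "infsum (e b) (UNIV - K) \<le> infsum (e b) UNIV"
      using e summable_on_subset_banach[OF e(1)] by (intro infsum_mono_neutral) auto
    also have "infsum (e b) UNIV \<le> \<bar>B\<bar> + 1" using e(3)[of b] by linarith
    also have "\<epsilon> * (\<bar>B\<bar> + 1) = \<delta> / 4" by (simp add: \<epsilon>_def field_simps)
    finally have "infsum (\<lambda>i. \<bar>d b i\<bar>) (UNIV - K) \<le> \<delta> / 4 + \<delta> / 4" using tail \<epsilon> by simp
    moreover have "infsum (\<lambda>i. \<bar>d b i\<bar>) UNIV = (\<Sum>i\<in>K. \<bar>d b i\<bar>) + infsum (\<lambda>i. \<bar>d b i\<bar>) (UNIV - K)"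
      using infsum_Un_disjoint[of "\<lambda>i. \<bar>d b i\<bar>" K "UNIV - K"] K s2 by simp
    ultimately have "infsum (\<lambda>i. \<bar>d b i\<bar>) UNIV < \<delta>" using elim(2) \<delta> by (auto simp: dist_real_def)
    moreover have "norm (infsum (d b) UNIV) \<le> infsum (\<lambda>i. norm (d b i)) UNIV"
      by (rule norm_infsum_bound) (use s2 in simp)
    ultimately show ?case by (simp add: dist_real_def)
  qed
qed

lemma infsum_dominated:
  fixes f :: "'b \<Rightarrow> 'a \<Rightarrow> real" and h :: "'a \<Rightarrow> real"
  assumes lim: "\<And>i. ((\<lambda>b. f b i) \<longlongrightarrow> g i) F"
    and dom: "\<forall>\<^sub>F b in F. \<forall>i. \<bar>f b i\<bar> \<le> h i" "\<And>i. \<bar>g i\<bar> \<le> h i"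
    and h: "h summable_on UNIV"
  shows "((\<lambda>b. infsum (f b) UNIV) \<longlongrightarrow> infsum g UNIV) F"
proof -
  have hn: "0 \<le> h i" for i using dom(2)[of i] by linarith
  have sg: "g summable_on UNIV"
    by (rule abs_summable_summable, rule summable_on_comparison_test[OF h]) (use dom in auto)
  have "((\<lambda>b. infsum (\<lambda>i. f b i - g i) UNIV) \<longlongrightarrow> 0) F"
  proof (rule infsum_almost_dominated[where e = "\<lambda>_ _. 0" and B = 0 and h = h])
    show "((\<lambda>b. f b i - g i) \<longlongrightarrow> 0) F" for i using lim[of i] by (simp add: LIM_zero_iff)
    show "\<exists>C. \<forall>\<^sub>F b in F. \<forall>i. \<bar>f b i - g i\<bar> \<le> \<epsilon> * 0 + C * h i" for \<epsilon> :: real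
    proof (rule exI[of _ 2], use dom(1) in eventually_elim)
      case (elim b)
      show ?case
      proof
        fix i show "\<bar>f b i - g i\<bar> \<le> \<epsilon> * 0 + 2 * h i" using elim[rule_format, of i] dom(2)[of i] by linarith
      qed
    qed
  qed (use h hn in auto)
  moreover have "\<forall>\<^sub>F b in F. infsum (\<lambda>i. f b i - g i) UNIV = infsum (f b) UNIV - infsum g UNIV"
    using dom(1)
  proof eventually_elim
    case (elim b)
    have "f b summable_on UNIV"
      by (rule abs_summable_summable, rule summable_on_comparison_test[OF h]) (use elim in auto)
    then show ?case using sg
      by (simp add: infsum_diff_real)
  qed
  ultimately have "((\<lambda>b. infsum (f b) UNIV - infsum g UNIV) \<longlongrightarrow> 0) F"
    using tendsto_cong by force
  then show ?thesis by (simp add: LIM_zero_iff)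
qed

section \<open>Powers\<close>

lemma abs_add_powr_le:
  fixes p :: real assumes "0 \<le> p"
  shows "\<bar>a + b\<bar> powr p \<le> 2 powr p * (\<bar>a\<bar> powr p + \<bar>b\<bar> powr p)"
proof -
  have "\<bar>a + b\<bar> powr p \<le> (2 * max \<bar>a\<bar> \<bar>b\<bar>) powr p" using assms by (intro powr_mono2) auto
  also have "\<dots> = 2 powr p * (max \<bar>a\<bar> \<bar>b\<bar>) powr p" by (simp add: powr_mult)
  also have "(max \<bar>a\<bar> \<bar>b\<bar>) powr p \<le> \<bar>a\<bar> powr p + \<bar>b\<bar> powr p" by (auto simp: max_def)
  finally show ?thesis by simp
qed

text \<open>By homogeneity the case of small \<open>b / a\<close> is continuity of \<open>\<bar>1 + t\<bar> powr p\<close> at \<open>0\<close>; otherwise \<open>a\<close>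
is bounded by a multiple of \<open>b\<close>, and everything is absorbed in \<open>C\<close>.\<close>

lemma powr_add_diff_le:
  fixes p \<epsilon> :: real assumes p: "0 < p" and \<epsilon>: "0 < \<epsilon>"
  obtains C where "C > 0"
    "\<And>a b. \<bar>\<bar>a + b\<bar> powr p - \<bar>a\<bar> powr p\<bar> \<le> \<epsilon> * \<bar>a\<bar> powr p + C * \<bar>b\<bar> powr p"
proof -
  have "isCont (\<lambda>t::real. \<bar>1 + t\<bar> powr p) 0" using p by (auto intro!: continuous_intros)
  then obtain \<delta> where \<delta>: "\<delta> > 0" "\<And>t::real. \<bar>t\<bar> < \<delta> \<Longrightarrow> \<bar>\<bar>1 + t\<bar> powr p - 1\<bar> < \<epsilon>"
    using \<epsilon> unfolding continuous_at_eps_delta by (auto simp: dist_real_def)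
  define C where "C = (1 / \<delta> + 1) powr p"
  show ?thesis
  proof
    have "1 / \<delta> + 1 > 0" using \<delta>(1) by (simp add: add_pos_pos)
    then show "C > 0" by (simp add: C_def)
    fix a b :: real
    show "\<bar>\<bar>a + b\<bar> powr p - \<bar>a\<bar> powr p\<bar> \<le> \<epsilon> * \<bar>a\<bar> powr p + C * \<bar>b\<bar> powr p"
    proof (cases "\<bar>b\<bar> < \<delta> * \<bar>a\<bar>")
      case True
      then have a: "a \<noteq> 0" by auto
      have eq: "\<bar>a + b\<bar> powr p = \<bar>a\<bar> powr p * \<bar>1 + b / a\<bar> powr p"
      proof -
        have "\<bar>a + b\<bar> = \<bar>a\<bar> * \<bar>1 + b / a\<bar>" using a by (simp add: abs_mult[symmetric] field_simps)
        then show ?thesis by (simp add: powr_mult)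
      qed
      have "\<bar>b / a\<bar> < \<delta>" using True a by (simp add: field_simps)
      from \<delta>(2)[OF this] have *: "\<bar>a\<bar> powr p * \<bar>\<bar>1 + b / a\<bar> powr p - 1\<bar> \<le> \<bar>a\<bar> powr p * \<epsilon>"
        by (intro mult_left_mono) auto
      have "\<bar>\<bar>a + b\<bar> powr p - \<bar>a\<bar> powr p\<bar> \<le> \<epsilon> * \<bar>a\<bar> powr p"
      proof -
        have "\<bar>a + b\<bar> powr p - \<bar>a\<bar> powr p = \<bar>a\<bar> powr p * (\<bar>1 + b / a\<bar> powr p - 1)"
          unfolding eq by (simp add: algebra_simps)
        then show ?thesis using * by (simp add: abs_mult mult.commute)
      qed
      moreover have "0 \<le> C * \<bar>b\<bar> powr p" by (simp add: C_def)
      ultimately show ?thesis by linarith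
    next
      case False
      then have ab: "\<bar>a\<bar> \<le> \<bar>b\<bar> / \<delta>" using \<delta> by (simp add: field_simps)
      have le: "s powr p \<le> C * \<bar>b\<bar> powr p" if "0 \<le> s" "s \<le> \<bar>a\<bar> + \<bar>b\<bar>" for s
      proof -
        have "s powr p \<le> ((1 / \<delta> + 1) * \<bar>b\<bar>) powr p"
          using that ab p by (intro powr_mono2) (auto simp: algebra_simps)
        also have "\<dots> = C * \<bar>b\<bar> powr p" using \<delta> by (simp add: C_def powr_mult)
        finally show ?thesis .
      qed
      have "\<bar>a + b\<bar> powr p \<le> C * \<bar>b\<bar> powr p" "\<bar>a\<bar> powr p \<le> C * \<bar>b\<bar> powr p"
        by (auto intro!: le)
      moreover have "0 \<le> \<epsilon> * \<bar>a\<bar> powr p" "0 \<le> \<bar>a + b\<bar> powr p" "0 \<le> \<bar>a\<bar> powr p" using \<epsilon> by auto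
      ultimately show ?thesis by linarith
    qed
  qed
qed

text \<open>Convexity with weights \<open>m / (m + 1)\<close> and \<open>1 / (m + 1)\<close>. The weights are chosen such that an induction
along a path of \<open>m\<close> steps yields the sharp factor \<open>m powr p\<close>.\<close>

lemma powr_add_le_weighted:
  fixes p a b :: real and m :: nat
  assumes p: "1 \<le> p" and m: "0 < m"
  shows "\<bar>a + b\<bar> powr p \<le> (real m + 1) powr (p - 1) * (\<bar>a\<bar> powr p / real m powr (p - 1) + \<bar>b\<bar> powr p)"
proof -
  define M where "M = real m"
  have M: "M > 0" using m by (simp add: M_def)
  have main: "(x + y) powr p \<le> (M + 1) powr (p - 1) * (x powr p / M powr (p - 1) + y powr p)"
    if xy: "x > 0" "y > 0" for x y :: real
  proof -
    have conv: "convex_on {0<..} (\<lambda>x. x powr p)" by (rule powr_convex) (use p in auto)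
    have w: "1 - 1 / (M + 1) = M / (M + 1)" using M by (simp add: field_simps)
    have "((1 - 1 / (M + 1)) *\<^sub>R (x * (M + 1) / M) + (1 / (M + 1)) *\<^sub>R (y * (M + 1))) powr p
        \<le> (1 - 1 / (M + 1)) * (x * (M + 1) / M) powr p + (1 / (M + 1)) * (y * (M + 1)) powr p"
      by (rule convex_onD[OF conv]) (use M xy in auto)
    also have "(1 - 1 / (M + 1)) *\<^sub>R (x * (M + 1) / M) + (1 / (M + 1)) *\<^sub>R (y * (M + 1)) = x + y"
      using M unfolding w by simp
    also have "(1 - 1 / (M + 1)) * (x * (M + 1) / M) powr p + (1 / (M + 1)) * (y * (M + 1)) powr p
        = (M + 1) powr (p - 1) * (x powr p / M powr (p - 1) + y powr p)"
    proof -
      have "c / K * (x * K / M) powr p + 1 / K * (y * K) powr p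
          = K powr (p - 1) * (x powr p / (M powr p / c) + y powr p)" if "K > 0" "c > 0" for K c
        using M xy that by (simp add: powr_mult powr_divide powr_diff field_simps)
      from this[of "M + 1" M] show ?thesis using M unfolding w by (simp add: powr_diff)
    qed
    finally show ?thesis .
  qed
  have "\<bar>a + b\<bar> powr p \<le> (\<bar>a\<bar> + \<bar>b\<bar>) powr p" using p by (intro powr_mono2) auto
  also have "\<dots> \<le> (M + 1) powr (p - 1) * (\<bar>a\<bar> powr p / M powr (p - 1) + \<bar>b\<bar> powr p)"
  proof (cases "a = 0 \<or> b = 0")
    case True
    have 1: "1 \<le> (M + 1) powr (p - 1)" using M p by (simp add: ge_one_powr_ge_zero)
    have 2: "1 \<le> (M + 1) powr (p - 1) / M powr (p - 1)"
      using M p by (simp add: powr_mono2 field_simps)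
    show ?thesis using True mult_right_mono[OF 1, of "\<bar>b\<bar> powr p"] mult_right_mono[OF 2, of "\<bar>a\<bar> powr p"] p
      by auto
  next
    case False then show ?thesis using main by simp
  qed
  finally show ?thesis by (simp add: M_def)
qed

lemma sum_powr_le_powr_sum:
  fixes d :: "'a \<Rightarrow> real"
  assumes "finite A" "\<And>i. i \<in> A \<Longrightarrow> 0 \<le> d i" "1 \<le> p"
  shows "(\<Sum>i\<in>A. d i powr p) \<le> (\<Sum>i\<in>A. d i) powr p"
proof -
  let ?S = "\<Sum>i\<in>A. d i"
  have eq: "t powr p = t * t powr (p - 1)" if "0 \<le> t" for t
    using that by (cases "t = 0") (auto simp: powr_diff)
  have "(\<Sum>i\<in>A. d i powr p) = (\<Sum>i\<in>A. d i * d i powr (p - 1))"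
    using assms eq by (intro sum.cong) auto
  also have "\<dots> \<le> (\<Sum>i\<in>A. d i * ?S powr (p - 1))"
    using assms by (intro sum_mono mult_left_mono powr_mono2 member_le_sum) auto
  also have "\<dots> = ?S powr p"
    using eq[of ?S] assms by (simp add: sum_distrib_right sum_nonneg)
  finally show ?thesis .
qed

lemma abs_powr_minus2: "c * \<bar>t\<bar> powr (p - 2) * t * t = c * \<bar>t :: real\<bar> powr p"
proof (cases "t = 0")
  case False
  have "\<bar>t\<bar> powr p = \<bar>t\<bar> powr (p - 2) * \<bar>t\<bar> powr 2" by (subst powr_add[symmetric]) simp
  also have "\<bar>t\<bar> powr 2 = t * t" using False by (simp add: power2_eq_square)
  finally show ?thesis by (simp only: mult.assoc)
qed simp

lemma has_real_derivative_abs_powr: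
  fixes p :: real assumes p: "1 < p"
  shows "((\<lambda>t. \<bar>t\<bar> powr p) has_real_derivative p * (\<bar>t\<bar> powr (p - 2) * t)) (at t)"
proof -
  have pos: "((\<lambda>t. \<bar>t\<bar> powr p) has_real_derivative p * (\<bar>t\<bar> powr (p - 2) * t)) (at t)" if "t > 0" for t
  proof -
    have "((\<lambda>t. t powr p) has_real_derivative p * t powr (p - 1)) (at t)"
      using that by (rule has_real_derivative_powr)
    moreover have "t powr (p - 1) = \<bar>t\<bar> powr (p - 2) * t"
      using that powr_add[of t "p - 2" 1] by simp
    moreover have "\<forall>\<^sub>F r in nhds t. r powr p = \<bar>r\<bar> powr p"
      using eventually_nhds_in_open[of "{0<..}" t] that by (auto elim!: eventually_mono)
    ultimately show ?thesis using DERIV_cong_ev[OF refl, of "\<lambda>r. r powr p" "\<lambda>r. \<bar>r\<bar> powr p" t] by simp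
  qed
  consider "t > 0" | "t < 0" | "t = 0" by linarith
  then show ?thesis
  proof cases
    case 1 then show ?thesis by (rule pos)
  next
    case 2
    then show ?thesis using DERIV_chain2[OF pos[of "- t"] DERIV_minus[OF DERIV_ident]] by simp
  next
    case 3
    have "((\<lambda>h. \<bar>h\<bar> powr (p - 1)) \<longlongrightarrow> \<bar>0\<bar> powr (p - 1)) (at (0::real))"
      using p by (intro tendsto_powr' tendsto_intros) auto
    then have "((\<lambda>h. \<bar>h\<bar> powr p / h) \<longlongrightarrow> 0) (at (0::real))"
    proof (intro Lim_null_comparison[of "\<lambda>h. \<bar>h\<bar> powr p / h" "\<lambda>h. \<bar>h\<bar> powr (p - 1)"])
      show "\<forall>\<^sub>F h in at 0. norm (\<bar>h\<bar> powr p / h) \<le> \<bar>h\<bar> powr (p - 1)"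
        unfolding eventually_at by (rule exI[of _ 1]) (auto simp: powr_diff abs_divide)
    qed simp
    then show ?thesis using 3 p by (simp add: DERIV_def)
  qed
qed

lemma isCont_abs_powr_minus2:
  fixes p :: real assumes p: "1 < p"
  shows "isCont (\<lambda>t. \<bar>t\<bar> powr (p - 2) * t) t"
proof (cases "t = 0")
  case True
  have "((\<lambda>h. \<bar>h\<bar> powr (p - 1)) \<longlongrightarrow> \<bar>0\<bar> powr (p - 1)) (at (0::real))"
    using p by (intro tendsto_powr' tendsto_intros) auto
  then have "((\<lambda>h. \<bar>h\<bar> powr (p - 2) * h) \<longlongrightarrow> 0) (at (0::real))"
  proof (intro Lim_null_comparison[of "\<lambda>h. \<bar>h\<bar> powr (p - 2) * h" "\<lambda>h. \<bar>h\<bar> powr (p - 1)"])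
    have "\<bar>\<bar>h\<bar> powr (p - 2) * h\<bar> \<le> \<bar>h\<bar> powr (p - 1)" if "h \<noteq> 0" for h :: real
      using powr_add[of "\<bar>h\<bar>" "p - 2" 1] that by (simp add: abs_mult)
    then show "\<forall>\<^sub>F h in at 0. norm (\<bar>h\<bar> powr (p - 2) * h) \<le> \<bar>h\<bar> powr (p - 1)"
      unfolding eventually_at by (intro exI[of _ 1]) auto
  qed simp
  then show ?thesis using True by (simp add: isCont_def)
next
  case False
  then show ?thesis by (intro continuous_intros) auto
qed

section \<open>The lattice\<close>

text \<open>Used with step \<open>c = 1\<close> for connectedness and with the period as step for periodicity.\<close>

lemma lattice_walk:
  fixes x k :: "int ^ 'n::finite" and c :: int
  assumes fwd: "\<And>y i. P y \<Longrightarrow> P (y + axis i c)" and bwd: "\<And>y i. P y \<Longrightarrow> P (y - axis i c)"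
    and x: "P x"
  shows "P (x + (\<chi> i. c * k $ i))"
proof -
  have dir: "P (y + axis i (c * m))" if "P y" for y i m
  proof (induction m rule: int_induct[where k = 0])
    case base
    have "axis i 0 = (0 :: int ^ 'n)" by (simp add: vec_eq_iff axis_def)
    show ?case unfolding mult_zero_right \<open>axis i 0 = 0\<close> using that by simp
  next
    case (step1 m)
    have eq: "y + axis i (c * (m + 1)) = y + axis i (c * m) + axis i c"
      by (simp add: vec_eq_iff axis_def algebra_simps)
    show ?case unfolding eq by (rule fwd[OF step1(2)])
  next
    case (step2 m)
    have eq: "y + axis i (c * (m - 1)) = y + axis i (c * m) - axis i c"
      by (simp add: vec_eq_iff axis_def algebra_simps)
    show ?case unfolding eq by (rule bwd[OF step2(2)])
  qed
  have "P (x + (\<chi> i. if i \<in> S then c * k $ i else 0))" if "finite S" for S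
    using that
  proof (induction S)
    case empty
    have "(\<chi> i. 0) = (0 :: int ^ 'n)" by (simp add: vec_eq_iff)
    then show ?case using x by simp
  next
    case (insert j S)
    have eq: "x + (\<chi> i. if i \<in> insert j S then c * k $ i else 0)
        = x + (\<chi> i. if i \<in> S then c * k $ i else 0) + axis j (c * k $ j)"
      using insert(2) by (auto simp: vec_eq_iff axis_def)
    show ?case unfolding eq by (rule dir[OF insert(3)])
  qed
  from this[of UNIV] show ?thesis by simp
qed

lemma adj_sym: "adj x y \<longleftrightarrow> adj y x"
  unfolding adj_def by (simp add: abs_minus_commute)

lemma adj_irrefl: "\<not> adj x x"
  by (simp add: adj_def)

lemma adj_axis: "adj x (x + axis i 1)" "adj x (x - axis i 1)"
proof -
  have "(\<Sum>j\<in>UNIV. \<bar>axis i 1 $ j\<bar>) = (1 :: int)"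
    by (simp add: axis_def if_distrib[of abs] cong: if_cong)
  then show "adj x (x + axis i 1)" "adj x (x - axis i 1)" by (simp_all add: adj_def)
qed

lemma adj_connected:
  assumes "\<And>y z. P y \<Longrightarrow> adj y z \<Longrightarrow> P z" "P x"
  shows "P (y :: int ^ 'n::finite)"
proof -
  have "P (x + (\<chi> i. 1 * (y - x) $ i))"
    by (rule lattice_walk) (use assms adj_axis in blast)+
  moreover have "x + (\<chi> i. 1 * (y - x) $ i) = y" by (simp add: vec_eq_iff)
  ultimately show ?thesis by simp
qed

lemma adj_translate: "adj (x + z) (y + z) \<longleftrightarrow> adj x y"
  by (simp add: adj_def)

lemma card_lattice_box:
  fixes S :: "int set"
  assumes "finite S"
  shows "finite {z :: int ^ 'n::finite. \<forall>i. z $ i \<in> S}"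
    "card {z :: int ^ 'n. \<forall>i. z $ i \<in> S} = card S ^ CARD('n)"
proof -
  have bij: "bij_betw vec_nth {z :: int ^ 'n. \<forall>i. z $ i \<in> S} (PiE UNIV (\<lambda>_. S))"
    by (rule bij_betwI[where g = vec_lambda]) (auto simp: PiE_def)
  show "finite {z :: int ^ 'n. \<forall>i. z $ i \<in> S}"
    using bij_betw_finite[OF bij] finite_PiE[of "UNIV :: 'n set" "\<lambda>_. S"] assms by simp
  show "card {z :: int ^ 'n. \<forall>i. z $ i \<in> S} = card S ^ CARD('n)"
    using bij_betw_same_card[OF bij] by (simp add: card_PiE)
qed

lemma finite_adj: "finite {y :: int ^ 'n::finite. adj x y}"
proof -
  have "{y. adj x y} \<subseteq> (\<lambda>z. x + z) ` {z. \<forall>i. z $ i \<in> {-1..1}}"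
  proof
    fix y assume "y \<in> {y. adj x y}"
    then have 1: "(\<Sum>i\<in>UNIV. \<bar>x $ i - y $ i\<bar>) = 1" by (simp add: adj_def)
    have "\<bar>x $ i - y $ i\<bar> \<le> 1" for i
      using member_le_sum[of i UNIV "\<lambda>i. \<bar>x $ i - y $ i\<bar>"] 1 by simp
    then have "\<forall>i. (y - x) $ i \<in> {-1..1}" by (simp add: abs_le_iff algebra_simps)
    then show "y \<in> (\<lambda>z. x + z) ` {z. \<forall>i. z $ i \<in> {-1..1}}"
      by (intro image_eqI[of _ _ "y - x"]) auto
  qed
  then show ?thesis using card_lattice_box(1)[of "{-1..1}"] finite_subset by blast
qed

section \<open>The discrete Sobolev inequality\<close>

definition dirichlet :: "real \<Rightarrow> (int ^ 'n::finite \<Rightarrow> real) \<Rightarrow> real" where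
  "dirichlet p u = (\<Sum>\<^sub>\<infinity>(x, y)\<in>edges. 1 / 2 * \<bar>grad u x y\<bar> powr p)"

lemma summable_on_finite_nonzero:
  fixes f :: "'a \<Rightarrow> real"
  assumes "finite {x \<in> A. f x \<noteq> 0}" shows "f summable_on A"
proof -
  have "f summable_on A \<longleftrightarrow> f summable_on {x \<in> A. f x \<noteq> 0}"
    by (rule summable_on_cong_neutral) auto
  then show ?thesis using assms by simp
qed

lemma dirichlet_summable:
  fixes u :: "int ^ 'n::finite \<Rightarrow> real"
  assumes "finite {x. u x \<noteq> 0}"
  shows "(\<lambda>(x, y). 1 / 2 * \<bar>grad u x y\<bar> powr p) summable_on edges"
proof (rule summable_on_finite_nonzero, rule finite_subset)
  let ?S = "{x. u x \<noteq> 0}"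
  let ?A = "Sigma ?S (\<lambda>x. {y. adj x y})"
  show "{e \<in> edges. (case e of (x, y) \<Rightarrow> 1 / 2 * \<bar>grad u x y\<bar> powr p) \<noteq> 0} \<subseteq> ?A \<union> prod.swap ` ?A"
  proof
    fix e assume "e \<in> {e \<in> edges. (case e of (x, y) \<Rightarrow> 1 / 2 * \<bar>grad u x y\<bar> powr p) \<noteq> 0}"
    then obtain x y where e: "e = (x, y)" "adj x y" "u x \<noteq> u y"
      by (cases e) (auto simp: edges_def grad_def)
    then have "u x \<noteq> 0 \<or> u y \<noteq> 0" by auto
    then show "e \<in> ?A \<union> prod.swap ` ?A"
    proof
      assume "u y \<noteq> 0"
      then have "(y, x) \<in> ?A" using e adj_sym[of x y] by simp
      then show ?thesis using e by force
    qed (use e in simp)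
  qed
  show "finite (?A \<union> prod.swap ` ?A)" 
    by (intro finite_UnI finite_imageI finite_SigmaI) (use assms finite_adj in auto)
qed

lemma dirichlet_nonneg: "0 \<le> dirichlet p u"
  unfolding dirichlet_def by (intro infsum_nonneg) auto

text \<open>The translate by \<open>z\<close> is reached by \<open>m\<close> unit steps. Each step costs one Dirichlet energy, and the
weighted convexity inequality adds up \<open>m\<close> of them to \<open>m powr p\<close>. The factor 2 is there because
\<open>dirichlet\<close> weights each ordered pair by \<open>1 / 2\<close>. Restricting to finite sets \<open>K\<close> avoids summability
questions in the induction.\<close>

lemma sum_translate_diff_powr_le:
  fixes u :: "int ^ 'n::finite \<Rightarrow> real" and z :: "int ^ 'n"
  assumes u: "finite {x. u x \<noteq> 0}" and p: "1 \<le> p" and K: "finite K"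
    and z: "\<And>i. 0 \<le> z $ i" "(\<Sum>i\<in>UNIV. z $ i) = int m"
  shows "(\<Sum>x\<in>K. \<bar>u (x + z) - u x\<bar> powr p) \<le> real m powr p * (2 * dirichlet p u)"
  using K z
proof (induction m arbitrary: z K)
  case 0
  then have "z $ i = 0" for i using sum_nonneg_eq_0_iff[of UNIV "\<lambda>i. z $ i"] by auto
  then have "z = 0" by (simp add: vec_eq_iff)
  then show ?case by simp
next
  case (Suc m)
  let ?D = "2 * dirichlet p u"
  have "\<exists>i. z $ i > 0"
  proof (rule ccontr)
    assume "\<not> ?thesis"
    then have "(\<Sum>i\<in>UNIV. z $ i) \<le> 0" by (intro sum_nonpos) (auto simp: not_less)
    with Suc.prems(3) show False by simp
  qed
  then obtain i where i: "z $ i > 0" by blast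
  define z' where "z' = z - axis i 1"
  have z: "z = z' + axis i 1" by (simp add: z'_def)
  have z'nn: "0 \<le> z' $ j" for j using Suc.prems(2)[of j] i by (auto simp: z'_def axis_def)
  have "(\<Sum>j\<in>UNIV. z' $ j) = (\<Sum>j\<in>UNIV. z $ j) - (\<Sum>j\<in>UNIV. axis i 1 $ j)"
    by (simp add: z'_def sum_subtractf)
  also have "(\<Sum>j\<in>UNIV. axis i (1 :: int) $ j) = 1" by (simp add: axis_def)
  finally have z's: "(\<Sum>j\<in>UNIV. z' $ j) = int m" using Suc.prems(3) by simp
  have step: "(\<Sum>x\<in>K. \<bar>u (x + axis i 1) - u x\<bar> powr p) \<le> ?D" if "finite K" for K
  proof -
    have "(\<Sum>x\<in>K. 1 / 2 * \<bar>u (x + axis i 1) - u x\<bar> powr p)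
        = (\<Sum>(x, y)\<in>(\<lambda>x. (x, x + axis i 1)) ` K. 1 / 2 * \<bar>grad u x y\<bar> powr p)"
      by (subst sum.reindex) (auto simp: inj_on_def grad_def)
    also have "\<dots> \<le> dirichlet p u"
      unfolding dirichlet_def
      by (rule finite_sum_le_infsum[OF dirichlet_summable[OF u]])
        (use that adj_axis in \<open>auto simp: edges_def\<close>)
    finally show ?thesis by (simp add: sum_divide_distrib[symmetric])
  qed
  have step': "(\<Sum>x\<in>K. \<bar>u (x + z) - u (x + z')\<bar> powr p) \<le> ?D"
  proof -
    have "(\<Sum>x\<in>K. \<bar>u (x + z) - u (x + z')\<bar> powr p)
       = (\<Sum>x\<in>(\<lambda>x. x + z') ` K. \<bar>u (x + axis i 1) - u x\<bar> powr p)"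
      by (subst sum.reindex) (auto simp: inj_on_def z add.assoc)
    then show ?thesis using step[of "(\<lambda>x. x + z') ` K"] Suc.prems(1) by simp
  qed
  show ?case
  proof (cases "m = 0")
    case True
    then have "z' $ j = 0" for j using sum_nonneg_eq_0_iff[of UNIV "\<lambda>i. z' $ i"] z'nn z's by auto
    then have "z' = 0" by (simp add: vec_eq_iff)
    then show ?thesis using step' True by simp
  next
    case False
    let ?c = "(real m + 1) powr (p - 1)"
    have IH: "(\<Sum>x\<in>K. \<bar>u (x + z') - u x\<bar> powr p) \<le> real m powr p * ?D"
      using Suc.IH[OF Suc.prems(1) z'nn z's] .
    have "(\<Sum>x\<in>K. \<bar>u (x + z) - u x\<bar> powr p)
        \<le> (\<Sum>x\<in>K. ?c * (\<bar>u (x + z') - u x\<bar> powr p / real m powr (p - 1)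
              + \<bar>u (x + z) - u (x + z')\<bar> powr p))"
    proof (rule sum_mono)
      fix x
      show "\<bar>u (x + z) - u x\<bar> powr p \<le> ?c * (\<bar>u (x + z') - u x\<bar> powr p / real m powr (p - 1)
              + \<bar>u (x + z) - u (x + z')\<bar> powr p)"
        using powr_add_le_weighted[OF p, of m "u (x + z') - u x" "u (x + z) - u (x + z')"] False by simp
    qed
    also have "\<dots> = ?c * ((\<Sum>x\<in>K. \<bar>u (x + z') - u x\<bar> powr p) / real m powr (p - 1)
              + (\<Sum>x\<in>K. \<bar>u (x + z) - u (x + z')\<bar> powr p))"
      by (simp add: sum_distrib_left[symmetric] sum.distrib sum_divide_distrib)
    also have "\<dots> \<le> ?c * (real m powr p * ?D / real m powr (p - 1) + ?D)"
      using IH step' by (intro mult_left_mono add_mono divide_right_mono) auto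
    also have "\<dots> = ?c * ((real m + 1) * ?D)"
      using False by (simp add: powr_diff field_simps)
    also have "\<dots> = real (Suc m) powr p * ?D" by (simp add: powr_diff add.commute)
    finally show ?thesis .
  qed
qed

text \<open>The box of side \<open>R\<close> has at least twice as many points as the support, so that from every point at
level \<open>l\<close> at least half of the translations in the box lead to a zero of \<open>v\<close>. Each of these
contributes \<open>l powr p\<close> to the translation differences, which are bounded by the Dirichlet energy.\<close>

lemma level_set_bound:
  fixes v :: "int ^ 'n::finite \<Rightarrow> real"
  assumes v: "finite {x. v x \<noteq> 0}" and p: "1 \<le> p" and l: "0 < l"
    and S: "\<And>x. x \<in> S \<Longrightarrow> v x = l" and R: "2 * card {x. v x \<noteq> 0} \<le> R ^ CARD('n)" "0 < R"
  shows "l powr p * real (card S) \<le> 4 * (real CARD('n) * real R) powr p * dirichlet p v"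
proof -
  let ?D = "{x. v x \<noteq> 0}" and ?N = "CARD('n)"
  let ?Q = "{z :: int ^ 'n. \<forall>i. z $ i \<in> {0..<int R}}"
  have Q: "finite ?Q" "card ?Q = R ^ ?N" using card_lattice_box[of "{0..<int R}", where 'n = 'n] by auto
  have S': "finite S" using finite_subset[OF _ v, of S] S l by force
  have low: "l powr p * (real (R ^ ?N) / 2) \<le> (\<Sum>z\<in>?Q. \<bar>v (x + z) - v x\<bar> powr p)" if x: "x \<in> S" for x
  proof -
    have "card {z \<in> ?Q. v (x + z) \<noteq> 0} \<le> card ?D"
      using v by (intro card_inj_on_le[where f = "\<lambda>z. x + z"]) (auto simp: inj_on_def)
    moreover have "card ?Q = card {z \<in> ?Q. v (x + z) = 0} + card {z \<in> ?Q. v (x + z) \<noteq> 0}"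
      using Q(1) by (subst card_Un_disjoint[symmetric]) (auto intro!: arg_cong[of _ _ card])
    ultimately have "R ^ ?N \<le> 2 * card {z \<in> ?Q. v (x + z) = 0}" using R Q(2) by linarith
    then have "real (R ^ ?N) / 2 \<le> real (card {z \<in> ?Q. v (x + z) = 0})" by linarith
    then have "l powr p * (real (R ^ ?N) / 2) \<le> l powr p * real (card {z \<in> ?Q. v (x + z) = 0})"
      by (rule mult_left_mono) simp
    also have "\<dots> = (\<Sum>z\<in>{z \<in> ?Q. v (x + z) = 0}. l powr p)" by simp
    also have "\<dots> = (\<Sum>z\<in>{z \<in> ?Q. v (x + z) = 0}. \<bar>v (x + z) - v x\<bar> powr p)"
      using S[OF x] l by (intro sum.cong) auto
    also have "\<dots> \<le> (\<Sum>z\<in>?Q. \<bar>v (x + z) - v x\<bar> powr p)"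
      using Q(1) by (intro sum_mono2) auto
    finally show ?thesis .
  qed
  have up: "(\<Sum>x\<in>S. \<bar>v (x + z) - v x\<bar> powr p) \<le> (real ?N * real R) powr p * (2 * dirichlet p v)"
    if z: "z \<in> ?Q" for z
  proof -
    define m where "m = nat (\<Sum>i\<in>UNIV. z $ i)"
    have nn: "0 \<le> z $ i" for i using z by simp
    then have m: "(\<Sum>i\<in>UNIV. z $ i) = int m" by (simp add: m_def sum_nonneg)
    have "int m \<le> (\<Sum>i\<in>(UNIV :: 'n set). int R)" unfolding m[symmetric]
      using z by (intro sum_mono) (auto intro: less_imp_le)
    then have "real m \<le> real ?N * real R" by (simp flip: of_nat_mult)
    then have "real m powr p * (2 * dirichlet p v) \<le> (real ?N * real R) powr p * (2 * dirichlet p v)"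
      using p dirichlet_nonneg by (intro mult_right_mono powr_mono2) auto
    then show ?thesis using sum_translate_diff_powr_le[OF v p S' nn m] by linarith
  qed
  have "real (card S) * (l powr p * (real (R ^ ?N) / 2)) = (\<Sum>x\<in>S. l powr p * (real (R ^ ?N) / 2))" by simp
  also have "\<dots> \<le> (\<Sum>x\<in>S. \<Sum>z\<in>?Q. \<bar>v (x + z) - v x\<bar> powr p)" by (intro sum_mono low)
  also have "\<dots> = (\<Sum>z\<in>?Q. \<Sum>x\<in>S. \<bar>v (x + z) - v x\<bar> powr p)" by (rule sum.swap)
  also have "\<dots> \<le> (\<Sum>z\<in>?Q. (real ?N * real R) powr p * (2 * dirichlet p v))" by (intro sum_mono up)
  also have "\<dots> = real (R ^ ?N) * ((real ?N * real R) powr p * (2 * dirichlet p v))" using Q(2) by simp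
  finally have "real (R ^ ?N) * (real (card S) * l powr p)
      \<le> real (R ^ ?N) * ((real ?N * real R) powr p * (4 * dirichlet p v))"
    by (simp add: field_simps del: of_nat_power)
  then have "real (card S) * l powr p \<le> (real ?N * real R) powr p * (4 * dirichlet p v)"
    using R(2) by (subst (asm) mult_le_cancel_left_pos) auto
  then show ?thesis by (simp add: algebra_simps)
qed

text \<open>Takes the side \<open>R\<close> of the box to be the \<open>CARD('n)\<close>-th root of twice the size of the support, rounded up.\<close>

lemma level_set_bound_card:
  fixes v :: "int ^ 'n::finite \<Rightarrow> real"
  assumes v: "finite {x. v x \<noteq> 0}" and p: "1 \<le> p" and l: "0 < l"
    and S: "\<And>x. x \<in> S \<Longrightarrow> v x = l"
  shows "l powr p * real (card S) \<le> 4 * (4 * real CARD('n)) powr p *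
    real (card {x. v x \<noteq> 0}) powr (p / real CARD('n)) * dirichlet p v"
proof (cases "{x. v x \<noteq> 0} = {}")
  case True
  then have "S = {}" using S l by force
  then show ?thesis using True by simp
next
  case False
  let ?N = "real CARD('n)" and ?d = "real (card {x. v x \<noteq> 0})"
  have N: "?N \<ge> 1" by (simp add: Suc_le_eq)
  have d: "?d \<ge> 1" using False v by (simp add: Suc_le_eq card_gt_0_iff)
  define r where "r = (2 * ?d) powr (1 / ?N)"
  have r1: "1 \<le> r" unfolding r_def using d N by (intro ge_one_powr_ge_zero) auto
  define R where "R = nat \<lceil>r\<rceil>"
  have R: "r \<le> real R" "real R \<le> 2 * r" using r1 real_nat_ceiling_ge[of r] of_int_ceiling_le_add_one[of r]
    unfolding R_def by (auto intro: order_trans[where y = "r + 1"])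
  have "2 * ?d = r powr ?N" using d N by (simp add: r_def powr_powr)
  also have "\<dots> \<le> real R powr ?N" using R r1 N by (intro powr_mono2) auto
  also have "\<dots> = real (R ^ CARD('n))" using R r1 by (simp add: powr_realpow)
  finally have R2: "2 * card {x. v x \<noteq> 0} \<le> R ^ CARD('n)" by linarith
  have R0: "0 < R" using R r1 by linarith
  have "(?N * real R) powr p \<le> (?N * (2 * r)) powr p" using R N p by (intro powr_mono2 mult_left_mono) auto
  also have "\<dots> = (2 * ?N) powr p * r powr p" using N r1 by (simp add: powr_mult[symmetric] mult_ac)
  also have "r powr p = 2 powr (p / ?N) * ?d powr (p / ?N)" using N by (simp add: r_def powr_powr powr_mult)
  also have "2 powr (p / ?N) \<le> 2 powr p" using N p by (intro powr_mono) (auto simp: field_simps mult_left_le)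
  finally have "(?N * real R) powr p \<le> (2 * ?N) powr p * (2 powr p * ?d powr (p / ?N))"
    by (simp add: mult_left_mono mult_right_mono)
  also have "\<dots> = (4 * ?N) powr p * ?d powr (p / ?N)" using N by (simp add: powr_mult[symmetric] mult_ac)
  finally have "4 * (?N * real R) powr p * dirichlet p v
      \<le> 4 * ((4 * ?N) powr p * ?d powr (p / ?N)) * dirichlet p v"
    using dirichlet_nonneg by (intro mult_right_mono mult_left_mono) auto
  then show ?thesis using level_set_bound[OF v p l _ R2 R0, of S] S by (simp add: mult.assoc)
qed

text \<open>The part of \<open>t\<close> between the levels \<open>l\<close> and \<open>2 * l\<close>.\<close>

definition slice :: "real \<Rightarrow> real \<Rightarrow> real" where
  "slice l t = max 0 (min (t - l) l)"

lemma sum_slice_dyadic: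
  assumes "0 < \<epsilon>"
  shows "(\<Sum>j<n. slice (\<epsilon> * 2 ^ j) t) = max 0 (min (t - \<epsilon>) (\<epsilon> * 2 ^ n - \<epsilon>))"
proof (induction n)
  case 0
  then show ?case by auto
next
  case (Suc n)
  define M where "M = \<epsilon> * 2 ^ n"
  have M: "\<epsilon> \<le> M" "\<epsilon> * 2 ^ Suc n = 2 * M" using assms by (simp_all add: M_def)
  then show ?case unfolding sum.lessThan_Suc Suc M(2) M_def[symmetric]
    using assms by (auto simp: slice_def max_def min_def)
qed

lemma slice_mono: "s \<le> t \<Longrightarrow> slice l s \<le> slice l t"
  by (auto simp: slice_def)

text \<open>All slices are monotone in \<open>t\<close> and add up to a 1-Lipschitz function, and for \<open>p \<ge> 1\<close> the \<open>p\<close>-th powers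
of nonnegative numbers are superadditive. So the slices share the energy of the original function.\<close>

lemma sum_slice_diff_powr_le:
  assumes "0 < \<epsilon>" "1 \<le> p"
  shows "(\<Sum>j<n. \<bar>slice (\<epsilon> * 2 ^ j) t - slice (\<epsilon> * 2 ^ j) s\<bar> powr p) \<le> \<bar>t - s\<bar> powr p"
proof -
  have main: "(\<Sum>j<n. \<bar>slice (\<epsilon> * 2 ^ j) t - slice (\<epsilon> * 2 ^ j) s\<bar> powr p) \<le> \<bar>t - s\<bar> powr p"
    if "s \<le> t" for s t
  proof -
    have "(\<Sum>j<n. \<bar>slice (\<epsilon> * 2 ^ j) t - slice (\<epsilon> * 2 ^ j) s\<bar> powr p)
        = (\<Sum>j<n. (slice (\<epsilon> * 2 ^ j) t - slice (\<epsilon> * 2 ^ j) s) powr p)"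
      using slice_mono[OF that] by simp
    also have "\<dots> \<le> (\<Sum>j<n. slice (\<epsilon> * 2 ^ j) t - slice (\<epsilon> * 2 ^ j) s) powr p"
      using slice_mono[OF that] assms by (intro sum_powr_le_powr_sum) auto
    also have "\<dots> \<le> \<bar>t - s\<bar> powr p"
    proof (rule powr_mono2)
      show "0 \<le> (\<Sum>j<n. slice (\<epsilon> * 2 ^ j) t - slice (\<epsilon> * 2 ^ j) s)"
        using slice_mono[OF that] by (intro sum_nonneg) simp
      show "(\<Sum>j<n. slice (\<epsilon> * 2 ^ j) t - slice (\<epsilon> * 2 ^ j) s) \<le> \<bar>t - s\<bar>"
        unfolding sum_subtractf sum_slice_dyadic[OF assms(1)] using that by (auto simp: max_def min_def)
    qed (use assms in auto)
    finally show ?thesis .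
  qed
  show ?thesis
    using main[of s t] main[of t s] by (cases "s \<le> t") (auto simp: abs_minus_commute)
qed

lemma sum_dirichlet_slice_le:
  fixes u :: "int ^ 'n::finite \<Rightarrow> real"
  assumes u: "finite {x. u x \<noteq> 0}" and \<epsilon>: "0 < \<epsilon>" and p: "1 \<le> p"
  shows "(\<Sum>j<n. dirichlet p (\<lambda>x. slice (\<epsilon> * 2 ^ j) (u x))) \<le> dirichlet p u"
proof -
  let ?v = "\<lambda>j x. slice (\<epsilon> * 2 ^ j) (u x)"
  have v: "finite {x. ?v j x \<noteq> 0}" for j
    by (rule finite_subset[OF _ u]) (use mult_pos_pos[OF \<epsilon>, of "2 ^ j"] in \<open>auto simp: slice_def max_def min_def simp del: zero_less_mult_iff split: if_splits\<close>)
  have hs: "((\<lambda>(x, y). 1 / 2 * \<bar>grad (?v j) x y\<bar> powr p) has_sum dirichlet p (?v j)) edges" for j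
    unfolding dirichlet_def using dirichlet_summable[OF v] by simp
  have "((\<lambda>e. \<Sum>j<n. (\<lambda>(x, y). 1 / 2 * \<bar>grad (?v j) x y\<bar> powr p) e) has_sum
      (\<Sum>j<n. dirichlet p (?v j))) edges"
    using hs by (induction n) (auto intro: has_sum_add)
  moreover have "((\<lambda>(x, y). 1 / 2 * \<bar>grad u x y\<bar> powr p) has_sum dirichlet p u) edges"
    unfolding dirichlet_def using dirichlet_summable[OF u] by simp
  ultimately show ?thesis
  proof (rule has_sum_mono)
    fix e :: "(int ^ 'n) \<times> (int ^ 'n)"
    show "(\<Sum>j<n. (\<lambda>(x, y). 1 / 2 * \<bar>grad (?v j) x y\<bar> powr p) e) \<le> (\<lambda>(x, y). 1 / 2 * \<bar>grad u x y\<bar> powr p) e"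
      using sum_slice_diff_powr_le[OF \<epsilon> p, where n = n and t = "u (snd e)" and s = "u (fst e)"]
      by (simp add: case_prod_beta grad_def sum_divide_distrib[symmetric])
  qed
qed

text \<open>Let \<open>a j\<close> be the number of points above the level \<open>s j = \<epsilon> * 2 ^ j\<close> and \<open>b j = s j powr p\<^sup>* * a j\<close>. The
level set bound for the \<open>j\<close>-th slice reads \<open>b (j + 1) \<le> C2 * b j powr \<theta> * E j\<close> with
\<open>\<theta> = p / N\<close>, the powers of \<open>s j\<close> cancelling exactly for the exponent \<open>p\<^sup>*\<close>. Summing over \<open>j\<close> and using
that the slices share the Dirichlet energy \<open>D\<close> gives \<open>B \<le> 2 * C2 * B powr \<theta> * D\<close> for the sum \<open>B\<close> of
the \<open>b j\<close>, which is comparable to the sum of the \<open>\<bar>u x\<bar> powr p\<^sup>*\<close>.\<close>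

theorem discrete_Sobolev:
  fixes p :: real
  assumes p: "1 \<le> p" "p < real CARD('n::finite)"
  obtains C where "C > 0"
    "\<And>u :: int ^ 'n \<Rightarrow> real. finite {x. u x \<noteq> 0} \<Longrightarrow>
      (\<Sum>x | u x \<noteq> 0. \<bar>u x\<bar> powr crit_exp CARD('n) p) \<le> C * dirichlet p u powr (crit_exp CARD('n) p / p)"
proof -
  let ?N = "real CARD('n)" and ?q = "crit_exp CARD('n) p"
  define \<theta> where "\<theta> = p / ?N"
  have th: "0 < \<theta>" "\<theta> < 1" using p by (auto simp: \<theta>_def)
  have q: "p < ?q" "0 < ?q" and qth: "?q * \<theta> = ?q - p" and qp: "?q / p = 1 / (1 - \<theta>)"
  proof -
    show "p < ?q" using p by (simp add: crit_exp_def field_simps)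
    then show "0 < ?q" using p by simp
    show "?q * \<theta> = ?q - p" "?q / p = 1 / (1 - \<theta>)" using p by (simp_all add: \<theta>_def crit_exp_def field_simps)
  qed
  define C1 where "C1 = 4 * (4 * ?N) powr p"
  define C2 where "C2 = 2 powr ?q * C1"
  define C where "C = 2 powr ?q * (2 * C2) powr (?q / p)"
  have C1: "C1 > 0" and C2: "C2 > 0" using p by (simp_all add: C1_def C2_def)
  have nonneg: "(\<Sum>x | u x \<noteq> 0. \<bar>u x\<bar> powr ?q) \<le> C * dirichlet p u powr (?q / p)"
    if u: "finite {x. u x \<noteq> 0}" and u0: "\<And>x. 0 \<le> u x" for u :: "int ^ 'n \<Rightarrow> real"
  proof (cases "{x. u x \<noteq> 0} = {}")
    case True
    then show ?thesis using C2 by (simp add: C_def)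
  next
    case False
    let ?S = "{x. u x \<noteq> 0}" and ?D = "dirichlet p u"
    define m where "m = Min (u ` ?S)"
    have m: "m > 0" "\<And>x. u x \<noteq> 0 \<Longrightarrow> m \<le> u x"
    proof -
      have "m \<in> u ` ?S" unfolding m_def using u False by (intro Min_in) auto
      then show "m > 0" using u0 by (auto simp: order_less_le)
      show "u x \<noteq> 0 \<Longrightarrow> m \<le> u x" for x unfolding m_def using u by (intro Min_le) auto
    qed
    \<comment> \<open>The two lowest levels lie below all positive values of \<open>u\<close>, so that \<open>b 0 \<le> b 1\<close> and the sum of
      all \<open>b j\<close> is controlled by the terms with \<open>j > 0\<close>.\<close>
    define \<epsilon> where "\<epsilon> = m / 4"
    have \<epsilon>: "0 < \<epsilon>" "\<And>x. u x \<noteq> 0 \<Longrightarrow> 2 * \<epsilon> < u x" using m by (force simp: \<epsilon>_def)+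
    define s where "s j = \<epsilon> * 2 ^ j" for j :: nat
    have s: "0 < s j" "s (Suc j) = 2 * s j" for j using \<epsilon> by (auto simp: s_def)
    define a where "a j = card {x. s j < u x}" for j
    have fin: "finite {x. s j < u x}" for j
      by (rule finite_subset[OF _ u]) (use s(1)[of j] in auto)
    define b where "b j = s j powr ?q * real (a j)" for j
    define E where "E j = dirichlet p (\<lambda>x. slice (s j) (u x))" for j
    have E0: "0 \<le> E j" for j by (simp add: E_def dirichlet_nonneg)
    have b0: "0 \<le> b j" for j by (simp add: b_def)
    have step: "b (Suc j) \<le> C2 * b j powr \<theta> * E j" for j
    proof -
      have supp: "{x. slice (s j) (u x) \<noteq> 0} = {x. s j < u x}"
        using s(1)[of j] by (auto simp: slice_def max_def min_def)
      have "s j powr p * real (card {x. s (Suc j) < u x}) \<le> 4 * (4 * ?N) powr p *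
          real (card {x. slice (s j) (u x) \<noteq> 0}) powr (p / ?N) * dirichlet p (\<lambda>x. slice (s j) (u x))"
      proof (rule level_set_bound_card)
        show "finite {x. slice (s j) (u x) \<noteq> 0}" using fin by (simp add: supp)
        show "slice (s j) (u x) = s j" if "x \<in> {x. s (Suc j) < u x}" for x
          using that s[of j] by (auto simp: slice_def)
      qed (use p s(1) in auto)
      then have 1: "s j powr p * real (a (Suc j)) \<le> C1 * real (a j) powr \<theta> * E j"
        by (simp add: supp a_def C1_def \<theta>_def E_def)
      have "b (Suc j) = 2 powr ?q * s j powr (?q - p) * (s j powr p * real (a (Suc j)))"
        using s(1)[of j] by (simp add: b_def s(2) powr_mult powr_diff)
      also have "\<dots> \<le> 2 powr ?q * s j powr (?q - p) * (C1 * real (a j) powr \<theta> * E j)"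
        using 1 by (intro mult_left_mono) auto
      also have "\<dots> = C2 * b j powr \<theta> * E j"
        using s(1)[of j] by (simp add: b_def C2_def powr_mult powr_powr qth)
      finally show ?thesis .
    qed
    \<comment> \<open>From level \<open>n\<close> on nothing is left of \<open>u\<close>, so finite sums suffice.\<close>
    obtain n0 :: nat where n0: "Max (u ` ?S) / \<epsilon> < 2 ^ n0"
      using real_arch_pow[of 2 "Max (u ` ?S) / \<epsilon>"] by auto
    define n where "n = Suc n0"
    have top: "u x \<le> s n" if "u x \<noteq> 0" for x
    proof -
      have "u x \<le> Max (u ` ?S)" using u that by (intro Max_ge) auto
      also have "\<dots> < \<epsilon> * 2 ^ n0" using n0 \<epsilon> by (simp add: field_simps)
      also have "\<dots> \<le> s n" using \<epsilon> by (simp add: s_def n_def)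
      finally show ?thesis by simp
    qed
    define B where "B = (\<Sum>j<Suc n. b j)"
    have bB: "b j \<le> B" if "j < Suc n" for j
      unfolding B_def using that b0 by (intro member_le_sum) auto
    have "a 0 = card ?S" "a 1 = card ?S"
      unfolding a_def using \<epsilon> by (force intro!: arg_cong[of _ _ card] simp: s_def)+
    moreover have "card ?S > 0" using u False by (simp add: card_gt_0_iff)
    ultimately have b01: "b 0 \<le> b 1" "0 < b 0"
      using s(1)[of 0] s(2)[of 0] q by (auto simp: b_def intro!: powr_mono2)
    have "(\<Sum>j<n. b (Suc j)) \<le> (\<Sum>j<n. C2 * B powr \<theta> * E j)"
    proof (rule sum_mono)
      fix j assume "j \<in> {..<n}"
      then have "C2 * b j powr \<theta> * E j \<le> C2 * B powr \<theta> * E j"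
        using bB[of j] b0 E0 C2 th by (intro mult_right_mono mult_left_mono powr_mono2) auto
      then show "b (Suc j) \<le> C2 * B powr \<theta> * E j" using step[of j] by linarith
    qed
    also have "\<dots> = C2 * B powr \<theta> * (\<Sum>j<n. E j)" by (simp add: sum_distrib_left)
    also have "\<dots> \<le> C2 * B powr \<theta> * ?D"
      using sum_dirichlet_slice_le[OF u \<epsilon>(1) p(1), of n] C2
      by (intro mult_left_mono) (auto simp: E_def s_def)
    finally have up: "(\<Sum>j<n. b (Suc j)) \<le> C2 * B powr \<theta> * ?D" .
    have Bsplit: "B = b 0 + (\<Sum>j<n. b (Suc j))" unfolding B_def by (rule sum.lessThan_Suc_shift)
    have "b 1 \<le> (\<Sum>j<n. b (Suc j))"
      using member_le_sum[of 0 "{..<n}" "\<lambda>j. b (Suc j)"] b0 by (simp add: n_def)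
    then have B2: "B \<le> 2 * C2 * B powr \<theta> * ?D" using Bsplit up b01 by linarith
    have B0: "B > 0" using bB[of 0] b01 by simp
    have "B powr (1 - \<theta>) = B / B powr \<theta>" using B0 by (simp add: powr_diff)
    also have "\<dots> \<le> 2 * C2 * ?D" using B2 B0 by (simp add: field_simps)
    finally have "(B powr (1 - \<theta>)) powr (?q / p) \<le> (2 * C2 * ?D) powr (?q / p)"
      using q p by (intro powr_mono2) auto
    moreover have "(B powr (1 - \<theta>)) powr (?q / p) = B" using B0 th unfolding qp powr_powr by simp
    ultimately have B: "B \<le> (2 * C2) powr (?q / p) * ?D powr (?q / p)"
      using C2 dirichlet_nonneg[of p u] by (simp add: powr_mult)
    have pt: "u x powr ?q \<le> 2 powr ?q * (\<Sum>j<Suc n. if s j < u x then s j powr ?q else 0)" if x: "u x \<noteq> 0" for x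
    proof -
      have "\<exists>j\<le>n. s j < u x \<and> u x \<le> s (Suc j)"
      proof (rule ccontr)
        assume H: "\<not> ?thesis"
        have "s j < u x" if "j \<le> n" for j
          using that
        proof (induction j)
          case 0 then show ?case using \<epsilon>(2)[OF x] \<epsilon>(1) by (simp add: s_def)
        next
          case (Suc j) then show ?case using H by (meson Suc_leD not_le)
        qed
        from this[of n] top[OF x] show False by simp
      qed
      then obtain j where j: "j \<le> n" "s j < u x" "u x \<le> 2 * s j" using s(2) by auto
      have "u x powr ?q \<le> (2 * s j) powr ?q" using j u0 q by (intro powr_mono2) auto
      also have "\<dots> = 2 powr ?q * (if s j < u x then s j powr ?q else 0)"
        using s(1)[of j] j by (simp add: powr_mult)
      also have "(if s j < u x then s j powr ?q else 0) \<le> (\<Sum>j<Suc n. if s j < u x then s j powr ?q else 0)"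
        using j by (intro member_le_sum) auto
      finally show ?thesis by simp
    qed
    have "(\<Sum>x\<in>?S. \<bar>u x\<bar> powr ?q) \<le> (\<Sum>x\<in>?S. 2 powr ?q * (\<Sum>j<Suc n. if s j < u x then s j powr ?q else 0))"
      using u0 pt by (intro sum_mono) auto
    also have "\<dots> = 2 powr ?q * (\<Sum>j<Suc n. \<Sum>x\<in>?S. if s j < u x then s j powr ?q else 0)"
      unfolding sum_distrib_left[symmetric] by (subst sum.swap) (rule refl)
    also have "(\<Sum>j<Suc n. \<Sum>x\<in>?S. if s j < u x then s j powr ?q else 0) = B"
      unfolding B_def
    proof (rule sum.cong)
      fix j
      have "{x \<in> ?S. s j < u x} = {x. s j < u x}" using s(1)[of j] by auto
      then show "(\<Sum>x\<in>?S. if s j < u x then s j powr ?q else 0) = b j"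
        using u by (simp add: sum.inter_filter[symmetric] b_def a_def)
    qed simp
    finally have "(\<Sum>x\<in>?S. \<bar>u x\<bar> powr ?q) \<le> 2 powr ?q * B" .
    also have "\<dots> \<le> 2 powr ?q * ((2 * C2) powr (?q / p) * ?D powr (?q / p))" using B by simp
    finally show ?thesis by (simp add: C_def)
  qed
  show ?thesis
  proof
    show "C > 0" using C2 by (simp add: C_def)
    fix u :: "int ^ 'n \<Rightarrow> real" assume u: "finite {x. u x \<noteq> 0}"
    have "(\<Sum>x | u x \<noteq> 0. \<bar>u x\<bar> powr ?q) \<le> C * dirichlet p (\<lambda>x. \<bar>u x\<bar>) powr (?q / p)"
      using nonneg[of "\<lambda>x. \<bar>u x\<bar>"] u by simp
    also have "\<dots> \<le> C * dirichlet p u powr (?q / p)"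
    proof -
      have "dirichlet p (\<lambda>x. \<bar>u x\<bar>) \<le> dirichlet p u"
        unfolding dirichlet_def using dirichlet_summable[of u] dirichlet_summable[of "\<lambda>x. \<bar>u x\<bar>"] u p
        by (intro infsum_mono) (auto simp: grad_def intro!: powr_mono2)
      then show ?thesis using C2 q p dirichlet_nonneg by (intro mult_left_mono powr_mono2) (auto simp: C_def)
    qed
    finally show "(\<Sum>x | u x \<noteq> 0. \<bar>u x\<bar> powr ?q) \<le> C * dirichlet p u powr (?q / p)" .
  qed
qed

section \<open>The energy space\<close>

text \<open>The gradient term and the potential term of the norm become a single sum over pairs of vertices:
a pair of neighbours carries the difference of \<open>u\<close> with weight \<open>1 / 2\<close>, a diagonal pair carries the value
of \<open>u\<close> with weight \<open>V\<close>, and other pairs have weight zero. Every estimate is then made only once.\<close>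

definition bond :: "(int ^ 'n::finite \<Rightarrow> real) \<Rightarrow> (int ^ 'n) \<times> (int ^ 'n) \<Rightarrow> real" where
  "bond u e = (if fst e = snd e then u (fst e) else u (snd e) - u (fst e))"

definition conductance :: "(int ^ 'n::finite \<Rightarrow> real) \<Rightarrow> (int ^ 'n) \<times> (int ^ 'n) \<Rightarrow> real" where
  "conductance V e = (if fst e = snd e then V (fst e) else if adj (fst e) (snd e) then 1 / 2 else 0)"

definition bond_energy ::
    "real \<Rightarrow> (int ^ 'n::finite \<Rightarrow> real) \<Rightarrow> (int ^ 'n \<Rightarrow> real) \<Rightarrow> (int ^ 'n) \<times> (int ^ 'n) \<Rightarrow> real" where
  "bond_energy p V u e = conductance V e * \<bar>bond u e\<bar> powr p"

definition total_energy :: "real \<Rightarrow> (int ^ 'n::finite \<Rightarrow> real) \<Rightarrow> (int ^ 'n \<Rightarrow> real) \<Rightarrow> real" where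
  "total_energy p V u = infsum (bond_energy p V u) UNIV"

text \<open>Moves \<open>t\<close> towards zero by \<open>\<epsilon>\<close>. A function tending to zero at infinity becomes finitely supported,
and 1-Lipschitz maps fixing zero do not increase any bond energy, so no spatial cutoff is needed to
approximate elements of the energy space.\<close>

definition soft_threshold :: "real \<Rightarrow> real \<Rightarrow> real" where
  "soft_threshold \<epsilon> t = t - max (- \<epsilon>) (min \<epsilon> t)"

lemma soft_threshold_bounds:
  assumes "0 \<le> \<epsilon>"
  shows "soft_threshold \<epsilon> 0 = 0" "\<bar>soft_threshold \<epsilon> t - t\<bar> \<le> \<epsilon>" "soft_threshold \<epsilon> t \<noteq> 0 \<Longrightarrow> \<epsilon> < \<bar>t\<bar>"
    "\<bar>soft_threshold \<epsilon> s - soft_threshold \<epsilon> t\<bar> \<le> \<bar>s - t\<bar>" "\<bar>(soft_threshold \<epsilon> s - s) - (soft_threshold \<epsilon> t - t)\<bar> \<le> \<bar>s - t\<bar>"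
  using assms by (auto simp: soft_threshold_def max_def min_def split: if_splits)

lemma infsum_pairs:
  fixes h :: "(int ^ 'n::finite) \<times> (int ^ 'n) \<Rightarrow> real"
  assumes h: "h summable_on UNIV" and 0: "\<And>x y. x \<noteq> y \<Longrightarrow> \<not> adj x y \<Longrightarrow> h (x, y) = 0"
  shows "infsum h UNIV = infsum h edges + (\<Sum>\<^sub>\<infinity>x. h (x, x))"
proof -
  let ?D = "range (\<lambda>x :: int ^ 'n. (x, x))"
  have "infsum h UNIV = infsum h (edges \<union> ?D)"
    by (rule infsum_cong_neutral) (use 0 in \<open>auto simp: edges_def\<close>)
  also have "\<dots> = infsum h edges + infsum h ?D"
    by (rule infsum_Un_disjoint) (use h in \<open>auto simp: edges_def adj_irrefl intro: summable_on_subset_banach\<close>)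
  also have "infsum h ?D = (\<Sum>\<^sub>\<infinity>x. h (x, x))"
    by (subst infsum_reindex) (auto simp: inj_on_def o_def)
  finally show ?thesis .
qed

lemma bond_add: "bond (\<lambda>x. u x + v x) e = bond u e + bond v e"
  by (simp add: bond_def)

lemma bond_scale: "bond (\<lambda>x. c * u x) e = c * bond u e"
  by (simp add: bond_def algebra_simps)

lemma bond_tendsto:
  assumes "\<And>x. ((\<lambda>b. u b x) \<longlongrightarrow> v x) F"
  shows "((\<lambda>b. bond (u b) e) \<longlongrightarrow> bond v e) F"
  unfolding bond_def using assms by (auto intro: tendsto_diff)

lemma bond_energy_scale: "bond_energy p V (\<lambda>x. c * u x) e = \<bar>c\<bar> powr p * bond_energy p V u e"
  by (simp add: bond_energy_def bond_scale abs_mult powr_mult)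

lemma total_energy_scale: "total_energy p V (\<lambda>x. c * u x) = \<bar>c\<bar> powr p * total_energy p V u"
  unfolding total_energy_def bond_energy_scale by (rule infsum_cmult_right')

lemma bond_energy_finite_support:
  assumes "finite {x. u x \<noteq> 0}"
  shows "bond_energy p V u summable_on UNIV"
proof (rule summable_on_finite_nonzero, rule finite_subset)
  let ?S = "{x. u x \<noteq> 0}"
  let ?A = "Sigma ?S (\<lambda>x. insert x {y. adj x y})"
  show "{e \<in> UNIV. bond_energy p V u e \<noteq> 0} \<subseteq> ?A \<union> prod.swap ` ?A"
  proof
    fix e assume e: "e \<in> {e \<in> UNIV. bond_energy p V u e \<noteq> 0}"
    obtain x y where xy: "e = (x, y)" by (cases e)
    have "(u x \<noteq> 0 \<or> u y \<noteq> 0) \<and> (x = y \<or> adj x y)"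
      using e by (auto simp: xy bond_energy_def bond_def conductance_def split: if_splits)
    then consider "u x \<noteq> 0" "x = y \<or> adj x y" | "u y \<noteq> 0" "y = x \<or> adj y x"
      using adj_sym[of x y] by auto
    then show "e \<in> ?A \<union> prod.swap ` ?A"
    proof cases
      case 2
      then have "(y, x) \<in> ?A" by auto
      then show ?thesis unfolding xy by force
    qed (auto simp: xy)
  qed
  show "finite (?A \<union> prod.swap ` ?A)"
    by (intro finite_UnI finite_imageI finite_SigmaI) (use assms finite_adj in auto)
qed

lemma energy_deriv_self:
  assumes "bond_energy p V u summable_on UNIV"
  shows "energy_deriv p V f u u = total_energy p V u - (\<Sum>\<^sub>\<infinity>x. f x (u x) * u x)"
proof -
  have "total_energy p V u = infsum (bond_energy p V u) edges + (\<Sum>\<^sub>\<infinity>x. bond_energy p V u (x, x))"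
    unfolding total_energy_def
    by (rule infsum_pairs[OF assms]) (simp add: bond_energy_def conductance_def)
  also have "infsum (bond_energy p V u) edges
      = (\<Sum>\<^sub>\<infinity>(x, y)\<in>edges. 1 / 2 * \<bar>grad u x y\<bar> powr (p - 2) * grad u x y * grad u x y)"
    by (rule infsum_cong)
      (auto simp: edges_def bond_energy_def conductance_def bond_def grad_def adj_irrefl
        abs_powr_minus2 abs_powr_minus2[of 1, simplified])
  also have "(\<Sum>\<^sub>\<infinity>x. bond_energy p V u (x, x)) = (\<Sum>\<^sub>\<infinity>x. V x * \<bar>u x\<bar> powr (p - 2) * u x * u x)"
    by (rule infsum_cong)
      (auto simp: bond_energy_def conductance_def bond_def abs_powr_minus2)
  finally show ?thesis by (simp add: energy_deriv_def)
qed

text \<open>The dimension is a type, which an abbreviation depending only on the number \<open>p\<close> could not mention;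
therefore the critical exponent is a parameter with a defining equation.\<close>

locale lattice_energy =
  fixes p ps :: real and V :: "int ^ 'n::finite \<Rightarrow> real"
  assumes p_gt_1: "1 < p" and p_less: "p < real CARD('n)" and V_nonneg: "\<And>x. 0 \<le> V x"
    and ps_eq: "ps = crit_exp CARD('n) p"
begin

abbreviation "Q \<equiv> total_energy p V"
abbreviation "E \<equiv> energy_space p V"
abbreviation "mass u \<equiv> \<Sum>\<^sub>\<infinity>x :: int ^ 'n. \<bar>u x :: real\<bar> powr ps"

lemma ps_bounds: "p < ps" "0 < ps" "1 < ps" "0 < ps / p"
proof -
  show "p < ps" using p_gt_1 p_less by (simp add: ps_eq crit_exp_def field_simps)
  then show "0 < ps" "1 < ps" "0 < ps / p" using p_gt_1 by simp_all
qed

lemma bond_energy_nonneg: "0 \<le> bond_energy p V u e"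
  using V_nonneg by (auto simp: bond_energy_def conductance_def)

lemma Q_nonneg: "0 \<le> Q u"
  unfolding total_energy_def by (intro infsum_nonneg bond_energy_nonneg)

lemma energy_norm_powr:
  assumes "bond_energy p V u summable_on UNIV"
  shows "energy_norm p V u = Q u powr (1 / p)" "energy_norm p V u powr p = Q u"
proof -
  have "Q u = infsum (bond_energy p V u) edges + (\<Sum>\<^sub>\<infinity>x. bond_energy p V u (x, x))"
    unfolding total_energy_def
    by (rule infsum_pairs[OF assms]) (simp add: bond_energy_def conductance_def)
  also have "infsum (bond_energy p V u) edges = (\<Sum>\<^sub>\<infinity>(x, y)\<in>edges. 1 / 2 * \<bar>grad u x y\<bar> powr p)"
    by (rule infsum_cong)
      (auto simp: edges_def bond_energy_def conductance_def bond_def grad_def adj_irrefl)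
  also have "(\<Sum>\<^sub>\<infinity>x. bond_energy p V u (x, x)) = (\<Sum>\<^sub>\<infinity>x. V x * \<bar>u x\<bar> powr p)"
    by (rule infsum_cong) (simp add: bond_energy_def conductance_def bond_def)
  finally show 1: "energy_norm p V u = Q u powr (1 / p)" by (simp add: energy_norm_def)
  show "energy_norm p V u powr p = Q u"
    using Q_nonneg[of u] p_gt_1 unfolding 1 by (cases "Q u = 0") (auto simp: powr_powr)
qed

lemma dirichlet_le_Q:
  assumes "bond_energy p V u summable_on UNIV"
  shows "dirichlet p u \<le> Q u"
proof -
  have "dirichlet p u = infsum (bond_energy p V u) edges"
    unfolding dirichlet_def
    by (rule infsum_cong)
      (auto simp: edges_def bond_energy_def conductance_def bond_def grad_def adj_irrefl)
  also have "\<dots> \<le> Q u"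
    unfolding total_energy_def using summable_on_subset_banach[OF assms] assms bond_energy_nonneg
    by (intro infsum_mono_neutral) auto
  finally show ?thesis .
qed

lemma bond_energy_lipschitz:
  assumes "\<And>s t. \<bar>\<tau> s - \<tau> t\<bar> \<le> \<bar>s - t\<bar>" "\<tau> 0 = 0"
  shows "bond_energy p V (\<lambda>x. \<tau> (u x)) e \<le> bond_energy p V u e"
proof -
  have "\<bar>bond (\<lambda>x. \<tau> (u x)) e\<bar> \<le> \<bar>bond u e\<bar>"
    using assms(1) assms(1)[of _ 0] assms(2) by (auto simp: bond_def)
  then show ?thesis unfolding bond_energy_def using p_gt_1 V_nonneg
    by (intro mult_left_mono powr_mono2) (auto simp: conductance_def)
qed

lemma bond_energy_add_le:
  "bond_energy p V (\<lambda>x. u x + v x) e \<le> 2 powr p * (bond_energy p V u e + bond_energy p V v e)"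
proof -
  have "conductance V e * \<bar>bond u e + bond v e\<bar> powr p
      \<le> conductance V e * (2 powr p * (\<bar>bond u e\<bar> powr p + \<bar>bond v e\<bar> powr p))"
    using p_gt_1 V_nonneg by (intro mult_left_mono abs_add_powr_le) (auto simp: conductance_def)
  then show ?thesis by (simp add: bond_energy_def bond_add algebra_simps)
qed

lemma bond_energy_tendsto:
  assumes "\<And>x. ((\<lambda>b. u b x) \<longlongrightarrow> v x) F"
  shows "((\<lambda>b. bond_energy p V (u b) e) \<longlongrightarrow> bond_energy p V v e) F"
  unfolding bond_energy_def using p_gt_1
  by (intro tendsto_intros tendsto_powr' bond_tendsto assms) auto

lemma powr_ps_tendsto:
  assumes "((\<lambda>b. u b) \<longlongrightarrow> (v::real)) F"
  shows "((\<lambda>b. \<bar>u b\<bar> powr ps) \<longlongrightarrow> \<bar>v\<bar> powr ps) F"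
  using ps_bounds by (intro tendsto_powr' tendsto_intros assms) auto

lemma Q_add_le:
  assumes "bond_energy p V u summable_on UNIV" "bond_energy p V v summable_on UNIV"
  shows "bond_energy p V (\<lambda>x. u x + v x) summable_on UNIV"
    "Q (\<lambda>x. u x + v x) \<le> 2 powr p * (Q u + Q v)"
proof -
  have s: "(\<lambda>e. 2 powr p * (bond_energy p V u e + bond_energy p V v e)) summable_on UNIV"
    using assms by (intro summable_on_cmult_right summable_on_add)
  show 1: "bond_energy p V (\<lambda>x. u x + v x) summable_on UNIV"
    by (rule summable_on_comparison_test[OF s]) (use bond_energy_add_le bond_energy_nonneg in auto)
  have "Q (\<lambda>x. u x + v x) \<le> infsum (\<lambda>e. 2 powr p * (bond_energy p V u e + bond_energy p V v e)) UNIV"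
    unfolding total_energy_def by (rule infsum_mono[OF 1 s bond_energy_add_le])
  also have "\<dots> = 2 powr p * (Q u + Q v)"
    unfolding total_energy_def infsum_cmult_right' using assms by (simp add: infsum_add)
  finally show "Q (\<lambda>x. u x + v x) \<le> 2 powr p * (Q u + Q v)" .
qed

lemma Q_diff_le:
  assumes "bond_energy p V u summable_on UNIV" "bond_energy p V v summable_on UNIV"
  shows "bond_energy p V (\<lambda>x. u x - v x) summable_on UNIV"
    "Q (\<lambda>x. u x - v x) \<le> 2 powr p * (Q u + Q v)"
proof -
  have eq: "bond_energy p V (\<lambda>x. (-1) * v x) = bond_energy p V v"
    by (auto simp: fun_eq_iff bond_energy_def bond_def abs_minus_commute)
  show "bond_energy p V (\<lambda>x. u x - v x) summable_on UNIV" "Q (\<lambda>x. u x - v x) \<le> 2 powr p * (Q u + Q v)"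
    using Q_add_le[OF assms(1), of "\<lambda>x. (-1) * v x"] assms(2)
    unfolding eq total_energy_def by auto
qed

lemma Sobolev_finite:
  obtains S where "S > 0" "\<And>u. finite {x. u x \<noteq> 0} \<Longrightarrow> (\<lambda>x. \<bar>u x\<bar> powr ps) summable_on UNIV \<and>
      mass u \<le> S * Q u powr (ps / p)"
proof -
  obtain S where S: "S > 0" "\<And>u :: int ^ 'n \<Rightarrow> real. finite {x. u x \<noteq> 0} \<Longrightarrow>
      (\<Sum>x | u x \<noteq> 0. \<bar>u x\<bar> powr ps) \<le> S * dirichlet p u powr (ps / p)"
    using discrete_Sobolev[of p, where 'n = 'n] p_gt_1 p_less unfolding ps_eq by auto
  show ?thesis
  proof (rule that[OF S(1)], rule conjI)
    fix u :: "int ^ 'n \<Rightarrow> real" assume u: "finite {x. u x \<noteq> 0}"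
    show "(\<lambda>x. \<bar>u x\<bar> powr ps) summable_on UNIV"
      by (rule summable_on_finite_nonzero) (use u in auto)
    have "mass u = (\<Sum>\<^sub>\<infinity>x\<in>{x. u x \<noteq> 0}. \<bar>u x\<bar> powr ps)"
      by (rule infsum_cong_neutral) auto
    also have "\<dots> = (\<Sum>x | u x \<noteq> 0. \<bar>u x\<bar> powr ps)" using u by simp
    also have "\<dots> \<le> S * dirichlet p u powr (ps / p)" using S(2)[OF u] .
    also have "\<dots> \<le> S * Q u powr (ps / p)"
      using dirichlet_le_Q[OF bond_energy_finite_support[OF u]] S(1) dirichlet_nonneg ps_bounds
      by (intro mult_left_mono powr_mono2) (auto intro: less_imp_le)
    finally show "mass u \<le> S * Q u powr (ps / p)" .
  qed
qed

lemma finite_superlevel: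
  fixes u :: "int ^ 'n \<Rightarrow> real"
  assumes "(\<lambda>x. \<bar>u x\<bar> powr ps) summable_on UNIV" "0 < \<epsilon>"
  shows "finite {x. \<epsilon> < \<bar>u x\<bar>}"
proof (rule ccontr)
  assume inf: "infinite {x. \<epsilon> < \<bar>u x\<bar>}"
  let ?B = "mass u"
  obtain k :: nat where k: "?B / \<epsilon> powr ps < real k" using reals_Archimedean2 by blast
  obtain K where K: "K \<subseteq> {x. \<epsilon> < \<bar>u x\<bar>}" "finite K" "card K = k"
    using infinite_arbitrarily_large[OF inf] by blast
  have "real k * \<epsilon> powr ps = (\<Sum>x\<in>K. \<epsilon> powr ps)" using K by simp
  also have "\<dots> \<le> (\<Sum>x\<in>K. \<bar>u x\<bar> powr ps)"
    using K assms ps_bounds by (intro sum_mono powr_mono2) auto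
  also have "\<dots> \<le> ?B" using K assms by (intro finite_sum_le_infsum) auto
  finally show False using k assms(2) by (simp add: field_simps)
qed

text \<open>Both \<open>soft_threshold \<epsilon>\<close> and its difference to the identity are 1-Lipschitz, so \<open>bond_energy p V u\<close> is an
integrable majorant for the error.\<close>

lemma soft_approximation:
  fixes u :: "int ^ 'n \<Rightarrow> real"
  assumes u: "bond_energy p V u summable_on UNIV" and c0: "(\<lambda>x. \<bar>u x\<bar> powr ps) summable_on UNIV"
  defines "\<phi> \<equiv> \<lambda>k x. soft_threshold (1 / real (Suc k)) (u x)"
  shows "finite {x. \<phi> k x \<noteq> 0}" "(\<lambda>k. \<phi> k x) \<longlonglongrightarrow> u x" "Q (\<phi> k) \<le> Q u"
    "(\<lambda>k. Q (\<lambda>x. \<phi> k x - u x)) \<longlonglongrightarrow> 0"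
proof -
  have e: "0 < 1 / real (Suc k)" "0 \<le> 1 / real (Suc k)" for k by auto
  show fin: "finite {x. \<phi> k x \<noteq> 0}" for k
    by (rule finite_subset[OF _ finite_superlevel[OF c0 e(1)[of k]]])
      (use soft_threshold_bounds(3)[OF e(2)] in \<open>auto simp: \<phi>_def\<close>)
  show lim: "(\<lambda>k. \<phi> k x) \<longlonglongrightarrow> u x" for x
  proof (rule LIM_zero_cancel, rule Lim_null_comparison)
    show "\<forall>\<^sub>F k in sequentially. norm (\<phi> k x - u x) \<le> 1 / real (Suc k)"
      using soft_threshold_bounds(2)[OF e(2)] by (auto simp: \<phi>_def)
    show "(\<lambda>k. 1 / real (Suc k)) \<longlonglongrightarrow> 0" using LIMSEQ_inverse_real_of_nat by (simp add: inverse_eq_divide)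
  qed
  show "Q (\<phi> k) \<le> Q u"
    unfolding total_energy_def
  proof (rule infsum_mono[OF bond_energy_finite_support[OF fin] u])
    show "bond_energy p V (\<phi> k) e \<le> bond_energy p V u e" for e
      unfolding \<phi>_def by (rule bond_energy_lipschitz) (use soft_threshold_bounds[OF e(2)] in auto)
  qed
  have "(\<lambda>k. infsum (bond_energy p V (\<lambda>x. \<phi> k x - u x)) UNIV) \<longlonglongrightarrow> infsum (\<lambda>_ :: (int ^ 'n) \<times> (int ^ 'n). 0) UNIV"
  proof (rule infsum_dominated[where h = "bond_energy p V u"])
    show "(\<lambda>k. bond_energy p V (\<lambda>x. \<phi> k x - u x) e) \<longlonglongrightarrow> 0" for e
    proof -
      have "(\<lambda>k. bond_energy p V (\<lambda>x. \<phi> k x - u x) e) \<longlonglongrightarrow> bond_energy p V (\<lambda>x. 0) e"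
        by (rule bond_energy_tendsto) (use lim in \<open>simp add: LIM_zero_iff\<close>)
      moreover have "bond_energy p V (\<lambda>x. 0) e = 0" by (simp add: bond_energy_def bond_def)
      ultimately show ?thesis by (simp only:)
    qed
    have "bond_energy p V (\<lambda>x. \<phi> k x - u x) e \<le> bond_energy p V u e" for k e
      unfolding \<phi>_def
      by (rule bond_energy_lipschitz[of "\<lambda>t. soft_threshold (1 / real (Suc k)) t - t"]) (use soft_threshold_bounds[OF e(2)] in auto)
    then show "\<forall>\<^sub>F k in sequentially. \<forall>e. \<bar>bond_energy p V (\<lambda>x. \<phi> k x - u x) e\<bar> \<le> bond_energy p V u e"
      using bond_energy_nonneg by auto
  qed (use u bond_energy_nonneg in auto)
  then show "(\<lambda>k. Q (\<lambda>x. \<phi> k x - u x)) \<longlonglongrightarrow> 0" by (simp add: total_energy_def)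
qed

text \<open>From left to right, a Cauchy sequence has bounded energy, hence by Sobolev a bounded \<open>\<ell>\<close>-norm of
exponent \<open>ps\<close>, and both bounds pass to the pointwise limit by Fatou. From right to left, the soft
thresholds of \<open>u\<close> form the required Cauchy sequence.\<close>

lemma mem_energy_space:
  "u \<in> E \<longleftrightarrow> bond_energy p V u summable_on UNIV \<and> (\<lambda>x. \<bar>u x\<bar> powr ps) summable_on UNIV"
proof
  assume "u \<in> E"
  then obtain \<phi> where fin: "\<And>k. finite {x. \<phi> k x \<noteq> 0}"
    and cauchy: "\<And>\<epsilon>. \<epsilon> > 0 \<Longrightarrow> \<exists>K. \<forall>m\<ge>K. \<forall>k\<ge>K. energy_norm p V (\<lambda>x. \<phi> m x - \<phi> k x) < \<epsilon>"
    and lim: "\<And>x. (\<lambda>k. \<phi> k x) \<longlonglongrightarrow> u x"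
    by (auto simp: energy_space_def)
  note sm = bond_energy_finite_support[OF fin]
  obtain K where K: "\<And>m. m \<ge> K \<Longrightarrow> energy_norm p V (\<lambda>x. \<phi> m x - \<phi> K x) < 1"
    using cauchy[of 1] by auto
  define B where "B = 2 powr p * (1 + Q (\<phi> K))"
  have B: "Q (\<phi> (m + K)) \<le> B" for m
  proof -
    have s: "bond_energy p V (\<lambda>x. \<phi> (m + K) x - \<phi> K x) summable_on UNIV"
      by (rule Q_diff_le(1)[OF sm sm])
    have "energy_norm p V (\<lambda>x. \<phi> (m + K) x - \<phi> K x) powr p \<le> 1 powr p"
      using K[of "m + K"] p_gt_1 energy_norm_powr(1)[OF s] by (intro powr_mono2) auto
    then have "Q (\<lambda>x. \<phi> (m + K) x - \<phi> K x) \<le> 1" using energy_norm_powr(2)[OF s] by simp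
    then have "2 powr p * (Q (\<lambda>x. \<phi> (m + K) x - \<phi> K x) + Q (\<phi> K)) \<le> B"
      unfolding B_def by (intro mult_left_mono) auto
    moreover have "Q (\<lambda>x. (\<phi> (m + K) x - \<phi> K x) + \<phi> K x)
        \<le> 2 powr p * (Q (\<lambda>x. \<phi> (m + K) x - \<phi> K x) + Q (\<phi> K))"
      by (rule Q_add_le(2)[OF s sm])
    ultimately show ?thesis by simp
  qed
  have lim': "(\<lambda>m. \<phi> (m + K) x) \<longlonglongrightarrow> u x" for x by (rule LIMSEQ_ignore_initial_segment[OF lim])
  obtain S where S: "S > 0" "\<And>u. finite {x. u x \<noteq> 0} \<Longrightarrow> (\<lambda>x. \<bar>u x\<bar> powr ps) summable_on UNIV \<and>
      mass u \<le> S * Q u powr (ps / p)"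
    using Sobolev_finite by metis
  show "bond_energy p V u summable_on UNIV \<and> (\<lambda>x. \<bar>u x\<bar> powr ps) summable_on UNIV"
  proof
    show "bond_energy p V u summable_on UNIV"
      by (rule infsum_Fatou(1)[of sequentially "\<lambda>m. bond_energy p V (\<phi> (m + K))" B])
        (use bond_energy_nonneg sm B bond_energy_tendsto[OF lim'] in \<open>auto simp: total_energy_def\<close>)
    show "(\<lambda>x. \<bar>u x\<bar> powr ps) summable_on UNIV"
    proof (rule infsum_Fatou(1)[of sequentially "\<lambda>m x. \<bar>\<phi> (m + K) x\<bar> powr ps" "S * B powr (ps / p)"])
      show "mass (\<phi> (m + K)) \<le> S * B powr (ps / p)" for m
      proof -
        have "mass (\<phi> (m + K)) \<le> S * Q (\<phi> (m + K)) powr (ps / p)"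
          using S(2)[OF fin] by blast
        also have "\<dots> \<le> S * B powr (ps / p)"
          using S(1) B Q_nonneg ps_bounds by (intro mult_left_mono powr_mono2) (auto intro: less_imp_le)
        finally show ?thesis .
      qed
    qed (use S(2)[OF fin] powr_ps_tendsto[OF lim'] in auto)
  qed
next
  assume u: "bond_energy p V u summable_on UNIV \<and> (\<lambda>x. \<bar>u x\<bar> powr ps) summable_on UNIV"
  define \<phi> where "\<phi> k x = soft_threshold (1 / real (Suc k)) (u x)" for k :: nat and x
  have fin: "finite {x. \<phi> k x \<noteq> 0}" and lim: "(\<lambda>k. \<phi> k x) \<longlonglongrightarrow> u x"
    and Qlim: "(\<lambda>k. Q (\<lambda>x. \<phi> k x - u x)) \<longlonglongrightarrow> 0" for k x
    using soft_approximation u by (auto simp: \<phi>_def)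
  have su: "bond_energy p V (\<lambda>x. \<phi> k x - u x) summable_on UNIV" for k
    using u Q_diff_le(1) bond_energy_finite_support[OF fin] by blast
  show "u \<in> E"
    unfolding energy_space_def
  proof (intro CollectI exI[of _ \<phi>] conjI allI impI fin lim)
    fix \<epsilon> :: real assume \<epsilon>: "\<epsilon> > 0"
    define \<eta> where "\<eta> = \<epsilon> powr p / (4 * 2 powr p)"
    have "\<eta> > 0" using \<epsilon> by (simp add: \<eta>_def)
    then have "\<forall>\<^sub>F k in sequentially. Q (\<lambda>x. \<phi> k x - u x) < \<eta>"
      using order_tendstoD(2)[OF Qlim] by blast
    then obtain K where K: "\<And>k. k \<ge> K \<Longrightarrow> Q (\<lambda>x. \<phi> k x - u x) < \<eta>"
      by (auto simp: eventually_sequentially)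
    show "\<exists>K. \<forall>m\<ge>K. \<forall>k\<ge>K. energy_norm p V (\<lambda>x. \<phi> m x - \<phi> k x) < \<epsilon>"
    proof (intro exI[of _ K] allI impI)
      fix m k assume mk: "K \<le> m" "K \<le> k"
      have "Q (\<lambda>x. \<phi> m x - \<phi> k x) = Q (\<lambda>x. (\<phi> m x - u x) - (\<phi> k x - u x))" by simp
      also have "\<dots> \<le> 2 powr p * (Q (\<lambda>x. \<phi> m x - u x) + Q (\<lambda>x. \<phi> k x - u x))"
        by (rule Q_diff_le(2)[OF su su])
      also have "\<dots> \<le> 2 powr p * (\<eta> + \<eta>)"
        using K[OF mk(1)] K[OF mk(2)] by (intro mult_left_mono) auto
      also have "\<dots> < \<epsilon> powr p" using \<epsilon> by (simp add: \<eta>_def)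
      finally have lt: "Q (\<lambda>x. \<phi> m x - \<phi> k x) < \<epsilon> powr p" .
      have s: "bond_energy p V (\<lambda>x. \<phi> m x - \<phi> k x) summable_on UNIV"
        by (intro Q_diff_le bond_energy_finite_support fin)
      have "Q (\<lambda>x. \<phi> m x - \<phi> k x) powr (1 / p) < (\<epsilon> powr p) powr (1 / p)"
        using lt Q_nonneg p_gt_1 by (intro powr_less_mono2) auto
      then show "energy_norm p V (\<lambda>x. \<phi> m x - \<phi> k x) < \<epsilon>"
        using energy_norm_powr(1)[OF s] \<epsilon> p_gt_1 by (simp add: powr_powr)
    qed
  qed
qed

lemma energy_spaceD: assumes "u \<in> E" shows "bond_energy p V u summable_on UNIV" "(\<lambda>x. \<bar>u x\<bar> powr ps) summable_on UNIV"
  using assms mem_energy_space by auto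

lemma Sobolev:
  obtains S where "S > 0" "\<And>u. u \<in> E \<Longrightarrow> mass u \<le> S * Q u powr (ps / p)"
proof -
  obtain S where S: "S > 0" "\<And>u. finite {x. u x \<noteq> 0} \<Longrightarrow> (\<lambda>x. \<bar>u x\<bar> powr ps) summable_on UNIV \<and>
      mass u \<le> S * Q u powr (ps / p)"
    using Sobolev_finite by metis
  show ?thesis
  proof (rule that[OF S(1)])
    fix u assume u: "u \<in> E"
    define \<phi> where "\<phi> k x = soft_threshold (1 / real (Suc k)) (u x)" for k :: nat and x
    have fin: "finite {x. \<phi> k x \<noteq> 0}" and lim: "(\<lambda>k. \<phi> k x) \<longlonglongrightarrow> u x"
      and Qle: "Q (\<phi> k) \<le> Q u" for k x
      using soft_approximation[OF energy_spaceD[OF u]] by (auto simp: \<phi>_def[abs_def])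
    show "mass u \<le> S * Q u powr (ps / p)"
    proof (rule infsum_Fatou(2)[of sequentially "\<lambda>m x. \<bar>\<phi> m x\<bar> powr ps"])
      show "mass (\<phi> m) \<le> S * Q u powr (ps / p)" for m
      proof -
        have "mass (\<phi> m) \<le> S * Q (\<phi> m) powr (ps / p)" using S(2)[OF fin] by blast
        also have "\<dots> \<le> S * Q u powr (ps / p)"
          using S(1) Qle Q_nonneg ps_bounds by (intro mult_left_mono powr_mono2) (auto intro: less_imp_le)
        finally show ?thesis .
      qed
    qed (use S(2)[OF fin] powr_ps_tendsto[OF lim] in auto)
  qed
qed

lemma abs_le_lp_norm:
  assumes "(\<lambda>x. \<bar>u x\<bar> powr ps) summable_on UNIV"
  shows "\<bar>u x\<bar> \<le> mass u powr (1 / ps)"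
proof -
  have "\<bar>u x\<bar> = (\<bar>u x\<bar> powr ps) powr (1 / ps)" using ps_bounds by (simp add: powr_powr)
  also have "\<dots> \<le> mass u powr (1 / ps)"
    using finite_sum_le_infsum[OF assms, of "{x}"] ps_bounds by (intro powr_mono2) auto
  finally show ?thesis .
qed

text \<open>On a lattice the \<open>\<ell>\<close>-norm of exponent \<open>ps\<close> dominates the supremum norm, so sets of bounded energy
are uniformly bounded.\<close>

lemma E_bounds:
  fixes B :: real
  obtains M A where "0 < M" "\<And>u x. u \<in> E \<Longrightarrow> Q u \<le> B \<Longrightarrow> \<bar>u x\<bar> \<le> M"
    "\<And>u. u \<in> E \<Longrightarrow> Q u \<le> B \<Longrightarrow> mass u \<le> A"
proof -
  obtain S where S: "S > 0" "\<And>u. u \<in> E \<Longrightarrow> mass u \<le> S * Q u powr (ps / p)"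
    using Sobolev by metis
  define A where "A = S * \<bar>B\<bar> powr (ps / p)"
  have A: "mass u \<le> A" if "u \<in> E" "Q u \<le> B" for u
  proof -
    have "S * Q u powr (ps / p) \<le> A" unfolding A_def
      using that S(1) Q_nonneg ps_bounds by (intro mult_left_mono powr_mono2) (auto intro: less_imp_le)
    then show ?thesis using S(2)[OF that(1)] by linarith
  qed
  show ?thesis
  proof (rule that[of "A powr (1 / ps) + 1" A])
    fix u x assume u: "u \<in> E" "Q u \<le> B"
    have "mass u powr (1 / ps) \<le> A powr (1 / ps)"
      using A[OF u] ps_bounds by (intro powr_mono2 infsum_nonneg) auto
    then show "\<bar>u x\<bar> \<le> A powr (1 / ps) + 1" using abs_le_lp_norm[OF energy_spaceD(2)[OF u(1)], of x] by linarith
  qed (use A in \<open>auto intro: add_nonneg_pos\<close>)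
qed

lemma E_bounded: assumes "u \<in> E" obtains M where "0 < M" "\<And>x. \<bar>u x\<bar> \<le> M"
  using E_bounds[of "Q u"] assms by (metis order_refl)

lemma E_finite_support: "finite {x. u x \<noteq> 0} \<Longrightarrow> u \<in> E"
  unfolding mem_energy_space using Sobolev_finite bond_energy_finite_support by metis

lemma E_lipschitz:
  assumes u: "u \<in> E" and \<tau>: "\<And>s t. \<bar>\<tau> s - \<tau> t\<bar> \<le> \<bar>s - t\<bar>" "\<tau> 0 = 0"
  shows "(\<lambda>x. \<tau> (u x)) \<in> E" "Q (\<lambda>x. \<tau> (u x)) \<le> Q u"
proof -
  have 1: "bond_energy p V (\<lambda>x. \<tau> (u x)) summable_on UNIV"
    by (rule summable_on_comparison_test[OF energy_spaceD(1)[OF u]])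
      (use bond_energy_lipschitz[OF \<tau>] bond_energy_nonneg in auto)
  have "(\<lambda>x. \<bar>\<tau> (u x)\<bar> powr ps) summable_on UNIV"
    by (rule summable_on_comparison_test[OF energy_spaceD(2)[OF u]])
      (use \<tau>(1)[of _ 0] \<tau>(2) ps_bounds in \<open>auto intro!: powr_mono2\<close>)
  with 1 show "(\<lambda>x. \<tau> (u x)) \<in> E" by (simp add: mem_energy_space)
  show "Q (\<lambda>x. \<tau> (u x)) \<le> Q u"
    unfolding total_energy_def by (rule infsum_mono[OF 1 energy_spaceD(1)[OF u] bond_energy_lipschitz[OF \<tau>]])
qed

lemma E_scale: assumes "u \<in> E" shows "(\<lambda>x. c * u x) \<in> E"
  unfolding mem_energy_space bond_energy_scale
  using energy_spaceD[OF assms] by (auto simp: bond_energy_scale[abs_def] abs_mult powr_mult intro!: summable_on_cmult_right)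

lemma E_add: assumes "u \<in> E" "v \<in> E" shows "(\<lambda>x. u x + v x) \<in> E"
  unfolding mem_energy_space
proof
  show "bond_energy p V (\<lambda>x. u x + v x) summable_on UNIV" using Q_add_le(1) energy_spaceD assms by blast
  have s: "(\<lambda>x. 2 powr ps * (\<bar>u x\<bar> powr ps + \<bar>v x\<bar> powr ps)) summable_on UNIV"
    using energy_spaceD assms by (intro summable_on_cmult_right summable_on_add) auto
  show "(\<lambda>x. \<bar>u x + v x\<bar> powr ps) summable_on UNIV"
    by (rule summable_on_comparison_test[OF s]) (use abs_add_powr_le ps_bounds in auto)
qed

lemma E_diff: assumes "u \<in> E" "v \<in> E" shows "(\<lambda>x. u x - v x) \<in> E"
  using E_add[OF assms(1) E_scale[OF assms(2), of "-1"]] by simp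

lemma E_update: assumes "u \<in> E" shows "u(y := r) \<in> E"
proof -
  have "(\<lambda>x. if x = y then r - u y else 0) \<in> E" by (rule E_finite_support) (simp add: if_distrib)
  from E_add[OF assms this] show ?thesis by (rule back_subst[of "\<lambda>u. u \<in> E"]) auto
qed

lemma E_limit:
  assumes "\<And>n::nat. \<phi> n \<in> E" "\<And>n. Q (\<phi> n) \<le> B" "\<And>x. (\<lambda>n. \<phi> n x) \<longlonglongrightarrow> u x"
  shows "u \<in> E"
proof -
  obtain A where A: "\<And>u. u \<in> E \<Longrightarrow> Q u \<le> B \<Longrightarrow> mass u \<le> A" using E_bounds by metis
  show ?thesis unfolding mem_energy_space
  proof
    show "bond_energy p V u summable_on UNIV"
      by (rule infsum_Fatou(1)[of sequentially "\<lambda>m. bond_energy p V (\<phi> m)" B])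
        (use bond_energy_nonneg energy_spaceD assms bond_energy_tendsto[OF assms(3)] in \<open>auto simp: total_energy_def\<close>)
    show "(\<lambda>x. \<bar>u x\<bar> powr ps) summable_on UNIV"
      by (rule infsum_Fatou(1)[of sequentially "\<lambda>m x. \<bar>\<phi> m x\<bar> powr ps" A])
        (use assms energy_spaceD A powr_ps_tendsto[OF assms(3)] in auto)
  qed
qed

lemma Q_pos: assumes u: "u \<in> E" "u \<noteq> (\<lambda>_. 0)" shows "0 < Q u"
proof (rule ccontr)
  assume "\<not> ?thesis"
  then have 0: "Q u = 0" using Q_nonneg[of u] by linarith
  obtain S where S: "S > 0" "\<And>u. u \<in> E \<Longrightarrow> mass u \<le> S * Q u powr (ps / p)"
    using Sobolev by metis
  have "mass u \<le> 0" using S(2)[OF u(1)] 0 by simp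
  then have "\<bar>u x\<bar> powr ps = 0" for x
    using nonneg_infsum_le_0D[OF _ energy_spaceD(2)[OF u(1)], of x] by auto
  then show False using u(2) by (auto simp: fun_eq_iff)
qed

lemma E_translate:
  assumes V: "\<And>x. V (x + z) = V x" and u: "u \<in> E"
  shows "(\<lambda>x. u (x + z)) \<in> E" "Q (\<lambda>x. u (x + z)) = Q u"
proof -
  let ?h = "\<lambda>(x, y). (x + z, y + z)"
  have b: "bij_betw ?h UNIV UNIV"
    by (rule bij_betwI[where g = "\<lambda>(x, y). (x - z, y - z)"]) auto
  have eq: "bond_energy p V (\<lambda>x. u (x + z)) e = bond_energy p V u (?h e)" for e
    by (cases e) (simp add: bond_energy_def conductance_def bond_def V adj_translate)
  have b': "bij_betw (\<lambda>x. x + z) UNIV UNIV" by (rule bij_betwI[where g = "\<lambda>x. x - z"]) auto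
  show "(\<lambda>x. u (x + z)) \<in> E"
    unfolding mem_energy_space eq
    using energy_spaceD[OF u] summable_on_reindex_bij_betw[OF b] summable_on_reindex_bij_betw[OF b', of "\<lambda>x. \<bar>u x\<bar> powr ps"]
    by (auto simp: eq[abs_def])
  show "Q (\<lambda>x. u (x + z)) = Q u"
    unfolding total_energy_def eq by (rule infsum_reindex_bij_betw[OF b])
qed

text \<open>Splitting of the energy: \<open>w n\<close> tends to zero only pointwise and may carry energy to infinity, but that
energy decouples from the energy of \<open>u\<close>.\<close>

lemma Q_Brezis_Lieb:
  assumes u: "u \<in> E" and w: "\<And>n::nat. w n \<in> E" "\<And>n. Q (w n) \<le> B" "\<And>x. (\<lambda>n. w n x) \<longlonglongrightarrow> 0"
  shows "(\<lambda>n. Q (\<lambda>x. u x + w n x) - Q (w n)) \<longlonglongrightarrow> Q u"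
proof -
  let ?d = "\<lambda>n e. bond_energy p V (\<lambda>x. u x + w n x) e - bond_energy p V (w n) e - bond_energy p V u e"
  have "(\<lambda>n. infsum (?d n) UNIV) \<longlonglongrightarrow> 0"
  proof (rule infsum_almost_dominated[where e = "\<lambda>n. bond_energy p V (w n)" and h = "bond_energy p V u" and B = B])
    show "(\<lambda>n. ?d n e) \<longlonglongrightarrow> 0" for e
    proof -
      have 1: "(\<lambda>n. bond_energy p V (\<lambda>x. u x + w n x) e) \<longlonglongrightarrow> bond_energy p V u e"
        by (rule bond_energy_tendsto) (use w(3) tendsto_add[OF tendsto_const w(3)] in auto)
      have 2: "(\<lambda>n. bond_energy p V (w n) e) \<longlonglongrightarrow> bond_energy p V (\<lambda>_. 0) e"
        by (rule bond_energy_tendsto) (use w(3) in auto)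
      have "bond_energy p V (\<lambda>_. 0) e = 0" by (simp add: bond_energy_def bond_def)
      then show ?thesis using tendsto_diff[OF tendsto_diff[OF 1 2] tendsto_const[of "bond_energy p V u e"]] by simp
    qed
    fix \<epsilon> :: real assume "\<epsilon> > 0"
    then obtain C where C: "C > 0"
      "\<And>a b. \<bar>\<bar>a + b\<bar> powr p - \<bar>a\<bar> powr p\<bar> \<le> \<epsilon> * \<bar>a\<bar> powr p + C * \<bar>b\<bar> powr p"
      using powr_add_diff_le[of p \<epsilon>] p_gt_1 by auto
    have "\<bar>?d n e\<bar> \<le> \<epsilon> * bond_energy p V (w n) e + (C + 1) * bond_energy p V u e" for n e
    proof -
      have c: "0 \<le> conductance V e" using V_nonneg by (simp add: conductance_def)
      have "\<bar>\<bar>bond u e + bond (w n) e\<bar> powr p - \<bar>bond (w n) e\<bar> powr p - \<bar>bond u e\<bar> powr p\<bar>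
          \<le> \<epsilon> * \<bar>bond (w n) e\<bar> powr p + (C + 1) * \<bar>bond u e\<bar> powr p"
        using C(2)[of "bond (w n) e" "bond u e"] powr_ge_zero[of "\<bar>bond u e\<bar>" p]
        unfolding add.commute[of "bond (w n) e"] distrib_right by linarith
      from mult_left_mono[OF this c] show ?thesis
        unfolding bond_energy_def bond_add using c by (simp add: algebra_simps abs_mult[symmetric] abs_mult_pos' del: abs_mult)
    qed
    then show "\<exists>C. \<forall>\<^sub>F n in sequentially. \<forall>e. \<bar>?d n e\<bar> \<le> \<epsilon> * bond_energy p V (w n) e + C * bond_energy p V u e"
      by (intro exI[of _ "C + 1"] always_eventually) auto
  qed (use energy_spaceD u w bond_energy_nonneg in \<open>auto simp: total_energy_def\<close>)
  moreover have "infsum (?d n) UNIV = Q (\<lambda>x. u x + w n x) - Q (w n) - Q u" for n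
    unfolding total_energy_def
    using energy_spaceD(1)[OF E_add[OF u w(1)[of n]]] energy_spaceD(1)[OF u] energy_spaceD(1)[OF w(1)[of n]]
    by (simp add: infsum_diff_real)
  ultimately have "(\<lambda>n. Q (\<lambda>x. u x + w n x) - Q (w n) - Q u) \<longlonglongrightarrow> 0" by simp
  then show ?thesis by (simp add: LIM_zero_iff)
qed

text \<open>The part of \<open>Q\<close> that involves the vertex \<open>y\<close>, as a function of the value \<open>r\<close> there. Each neighbour
counts with weight 1, from two ordered pairs of weight \<open>1 / 2\<close>.\<close>

definition site_energy :: "(int ^ 'n \<Rightarrow> real) \<Rightarrow> int ^ 'n \<Rightarrow> real \<Rightarrow> real" where
  "site_energy u y r = (\<Sum>z | adj y z. \<bar>u z - r\<bar> powr p) + V y * \<bar>r\<bar> powr p"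

lemma Q_update:
  assumes u: "u \<in> E"
  shows "Q (u(y := r)) = Q u + site_energy u y r - site_energy u y (u y)"
proof -
  let ?N = "{z. adj y z}"
  let ?I = "insert (y, y) ((\<lambda>z. (y, z)) ` ?N \<union> (\<lambda>z. (z, y)) ` ?N)"
  have finI: "finite ?I" by (intro finite.insertI finite_UnI finite_imageI finite_adj)
  have Q: "Q v = site_energy v y (v y) + infsum (bond_energy p V v) (UNIV - ?I)" if v: "v \<in> E" for v
  proof -
    note sv = energy_spaceD(1)[OF v]
    have "Q v = infsum (bond_energy p V v) (?I \<union> (UNIV - ?I))" unfolding total_energy_def by simp
    also have "\<dots> = sum (bond_energy p V v) ?I + infsum (bond_energy p V v) (UNIV - ?I)"
      using finI by (subst infsum_Un_disjoint) (auto intro: summable_on_subset_banach[OF sv])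
    also have "sum (bond_energy p V v) ?I = bond_energy p V v (y, y)
        + ((\<Sum>e\<in>(\<lambda>z. (y, z)) ` ?N. bond_energy p V v e) + (\<Sum>e\<in>(\<lambda>z. (z, y)) ` ?N. bond_energy p V v e))"
      using finite_adj adj_irrefl by (subst sum.insert, force, force, subst sum.union_disjoint) auto
    also have "(\<Sum>e\<in>(\<lambda>z. (y, z)) ` ?N. bond_energy p V v e) = (\<Sum>z\<in>?N. 1 / 2 * \<bar>v z - v y\<bar> powr p)"
      by (subst sum.reindex)
        (auto simp: inj_on_def bond_energy_def conductance_def bond_def adj_irrefl intro!: sum.cong)
    also have "(\<Sum>e\<in>(\<lambda>z. (z, y)) ` ?N. bond_energy p V v e) = (\<Sum>z\<in>?N. 1 / 2 * \<bar>v z - v y\<bar> powr p)"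
      by (subst sum.reindex)
        (auto simp: inj_on_def bond_energy_def conductance_def bond_def adj_irrefl adj_sym[of _ y]
          abs_minus_commute intro!: sum.cong)
    also have "bond_energy p V v (y, y) + ((\<Sum>z\<in>?N. 1 / 2 * \<bar>v z - v y\<bar> powr p)
        + (\<Sum>z\<in>?N. 1 / 2 * \<bar>v z - v y\<bar> powr p)) = site_energy v y (v y)"
      by (simp add: site_energy_def bond_energy_def conductance_def bond_def sum.distrib[symmetric])
    finally show ?thesis .
  qed
  have 1: "infsum (bond_energy p V (u(y := r))) (UNIV - ?I) = infsum (bond_energy p V u) (UNIV - ?I)"
  proof (rule infsum_cong)
    fix e assume e: "e \<in> UNIV - ?I"
    obtain a b where ab: "e = (a, b)" by (cases e)
    show "bond_energy p V (u(y := r)) e = bond_energy p V u e"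
      using e adj_sym[of a b] by (auto simp: ab bond_energy_def conductance_def bond_def)
  qed
  have 2: "site_energy (u(y := r)) y ((u(y := r)) y) = site_energy u y r"
    unfolding site_energy_def using adj_irrefl[of y] by (auto intro!: sum.cong)
  show ?thesis using Q[OF u] Q[OF E_update[OF u, of y r]] 1 2 by linarith
qed

end

section \<open>The nonlinearity\<close>

lemma periodic_shift:
  assumes "periodic T h"
  shows "h (x + (\<chi> i. int T * k $ i)) = h x"
proof (rule lattice_walk[of "\<lambda>y. h y = h x"])
  fix y i assume y: "h y = h x"
  show "h (y + axis i (int T)) = h x" using assms y by (simp add: periodic_def)
  have "h (y - axis i (int T)) = h (y - axis i (int T) + axis i (int T))"
    using assms unfolding periodic_def by metis
  then show "h (y - axis i (int T)) = h x" using y by simp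
qed simp

lemma box_representative:
  fixes x :: "int ^ 'n::finite"
  assumes "0 < T"
  shows "\<exists>z k. (\<forall>i. z $ i \<in> {0..<int T}) \<and> x = z + (\<chi> i. int T * k $ i)"
  using assms
  by (intro exI[of _ "\<chi> i. x $ i mod int T"] exI[of _ "\<chi> i. x $ i div int T"])
    (auto simp: vec_eq_iff)

text \<open>Up to periods there are only finitely many vertices.\<close>

lemma periodic_uniformly_continuous:
  fixes h :: "int ^ 'n::finite \<Rightarrow> real \<Rightarrow> real" and \<epsilon> :: real
  assumes T: "0 < T" and per: "periodic T h" and cont: "\<And>x. continuous_on UNIV (h x)" and \<epsilon>: "0 < \<epsilon>"
  obtains \<delta> where "\<delta> > 0" "\<And>x s t. \<bar>s\<bar> \<le> M \<Longrightarrow> \<bar>t\<bar> \<le> M \<Longrightarrow> \<bar>s - t\<bar> < \<delta> \<Longrightarrow> \<bar>h x s - h x t\<bar> < \<epsilon>"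
proof -
  let ?B = "{z :: int ^ 'n. \<forall>i. z $ i \<in> {0..<int T}}"
  have fin: "finite ?B" by (rule card_lattice_box) simp
  have "0 \<in> ?B" using T by simp
  then have ne: "?B \<noteq> {}" by blast
  have "\<forall>x. \<exists>\<delta>>0. \<forall>s t. \<bar>s\<bar> \<le> M \<longrightarrow> \<bar>t\<bar> \<le> M \<longrightarrow> \<bar>s - t\<bar> < \<delta> \<longrightarrow> \<bar>h x s - h x t\<bar> < \<epsilon>"
  proof
    fix x
    have "uniformly_continuous_on {-M..M} (h x)"
      by (intro compact_uniformly_continuous continuous_on_subset[OF cont]) auto
    from uniformly_continuous_onE[OF this \<epsilon>] obtain \<delta> where "\<delta> > 0"
      "\<And>s t. s \<in> {-M..M} \<Longrightarrow> t \<in> {-M..M} \<Longrightarrow> dist t s < \<delta> \<Longrightarrow> dist (h x t) (h x s) < \<epsilon>" by blast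
    then show "\<exists>\<delta>>0. \<forall>s t. \<bar>s\<bar> \<le> M \<longrightarrow> \<bar>t\<bar> \<le> M \<longrightarrow> \<bar>s - t\<bar> < \<delta> \<longrightarrow> \<bar>h x s - h x t\<bar> < \<epsilon>"
      by (intro exI[of _ \<delta>]) (auto simp: dist_real_def abs_le_iff)
  qed
  then obtain d where d: "\<And>x. d x > 0"
    "\<And>x s t. \<bar>s\<bar> \<le> M \<Longrightarrow> \<bar>t\<bar> \<le> M \<Longrightarrow> \<bar>s - t\<bar> < d x \<Longrightarrow> \<bar>h x s - h x t\<bar> < \<epsilon>" by metis
  show ?thesis
  proof
    show "Min (d ` ?B) > 0" using fin ne d(1) by simp
    fix x s t assume st: "\<bar>s\<bar> \<le> M" "\<bar>t\<bar> \<le> M" "\<bar>s - t\<bar> < Min (d ` ?B)"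
    obtain z k where z: "z \<in> ?B" "x = z + (\<chi> i. int T * k $ i)" using box_representative[OF T, of x] by auto
    have "Min (d ` ?B) \<le> d z" using fin z(1) by (intro Min_le) auto
    then have "\<bar>h z s - h z t\<bar> < \<epsilon>" using st d(2)[of s t z] by linarith
    then show "\<bar>h x s - h x t\<bar> < \<epsilon>" unfolding z(2) periodic_shift[OF per] .
  qed
qed

locale periodic_problem = lattice_energy p ps V
  for p ps :: real and V :: "int ^ 'n::finite \<Rightarrow> real" +
  fixes f :: "int ^ 'n \<Rightarrow> real \<Rightarrow> real" and T :: nat and a q :: real
  assumes T_pos: "0 < T" and V_periodic: "periodic T V" and f_periodic: "periodic T f"
    and f_continuous: "\<And>x. continuous_on UNIV (f x)"
    and growth: "0 < a" "ps < q" "\<And>x t. \<bar>f x t\<bar> \<le> a * (1 + \<bar>t\<bar> powr (q - 1))"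
    and small_o: "uniform_limit UNIV (\<lambda>t x. f x t / \<bar>t\<bar> powr (ps - 1)) (\<lambda>_. 0) (at 0)"
    and increasing: "\<And>x. strict_mono_on ({..<0} \<union> {0<..}) (\<lambda>t. f x t / \<bar>t\<bar> powr (p - 1))"
    and superlinear: "\<And>M. \<forall>\<^sub>F t in at_infinity. \<forall>x. M \<le> primitive f x t / \<bar>t\<bar> powr p"
begin

abbreviation "F \<equiv> primitive f"

definition G :: "int ^ 'n \<Rightarrow> real \<Rightarrow> real" where "G x t = f x t * t"
definition H :: "int ^ 'n \<Rightarrow> real \<Rightarrow> real" where "H x t = G x t / p - F x t"

text \<open>The hypothesis on \<open>f\<close> is about \<open>t \<noteq> 0\<close>; continuity extends it to \<open>t = 0\<close> and thereby shows
that \<open>f x 0 = 0\<close>.\<close>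

lemma f_small:
  assumes "0 < \<epsilon>"
  obtains \<delta> where "0 < \<delta>" "\<delta> \<le> 1" "\<And>x t. \<bar>t\<bar> \<le> \<delta> \<Longrightarrow> \<bar>f x t\<bar> \<le> \<epsilon> * \<bar>t\<bar> powr (ps - 1)"
proof -
  have main: "\<exists>\<delta>>0. \<forall>x t. t \<noteq> 0 \<longrightarrow> \<bar>t\<bar> < \<delta> \<longrightarrow> \<bar>f x t\<bar> \<le> \<epsilon> * \<bar>t\<bar> powr (ps - 1)" if "0 < \<epsilon>" for \<epsilon>
  proof -
    have "\<forall>\<^sub>F t in at 0. \<forall>x\<in>UNIV. dist (f x t / \<bar>t\<bar> powr (ps - 1)) 0 < \<epsilon>"
      using uniform_limitD[OF small_o that] .
    then obtain \<delta> where d: "\<delta> > 0"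
      "\<And>t x. t \<noteq> 0 \<Longrightarrow> \<bar>t\<bar> < \<delta> \<Longrightarrow> \<bar>f x t / \<bar>t\<bar> powr (ps - 1)\<bar> < \<epsilon>"
      unfolding eventually_at by (auto simp: dist_real_def)
    have "\<bar>f x t\<bar> \<le> \<epsilon> * \<bar>t\<bar> powr (ps - 1)" if "t \<noteq> 0" "\<bar>t\<bar> < \<delta>" for x t
      using d(2)[OF that, of x] that by (simp add: abs_divide field_simps less_imp_le)
    then show ?thesis using d(1) by auto
  qed
  have f0: "f x 0 = 0" for x
  proof -
    obtain \<delta> where d: "\<delta> > 0" "\<And>t. t \<noteq> 0 \<Longrightarrow> \<bar>t\<bar> < \<delta> \<Longrightarrow> \<bar>f x t\<bar> \<le> 1 * \<bar>t\<bar> powr (ps - 1)"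
      using main[of 1] by auto
    have 1: "(f x \<longlongrightarrow> f x 0) (at 0)"
      using f_continuous[of x] by (simp add: continuous_on_eq_continuous_at isCont_def)
    have 2: "((\<lambda>t. \<bar>t\<bar> powr (ps - 1)) \<longlongrightarrow> \<bar>0\<bar> powr (ps - 1)) (at 0)"
      using ps_bounds by (intro tendsto_powr' tendsto_intros) auto
    have "(f x \<longlongrightarrow> 0) (at 0)"
    proof (rule Lim_null_comparison)
      show "\<forall>\<^sub>F t in at 0. norm (f x t) \<le> \<bar>t\<bar> powr (ps - 1)"
        unfolding eventually_at using d by (intro exI[of _ \<delta>]) (auto simp: dist_real_def)
    qed (use 2 in simp)
    then show ?thesis using 1 tendsto_unique[of "at (0::real)"] by auto
  qed
  obtain \<delta> where d: "\<delta> > 0" "\<And>x t. t \<noteq> 0 \<Longrightarrow> \<bar>t\<bar> < \<delta> \<Longrightarrow> \<bar>f x t\<bar> \<le> \<epsilon> * \<bar>t\<bar> powr (ps - 1)"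
    using main[OF assms] by auto
  show ?thesis
  proof (rule that[of "min (\<delta> / 2) 1"])
    fix x t assume "\<bar>t\<bar> \<le> min (\<delta> / 2) 1"
    then show "\<bar>f x t\<bar> \<le> \<epsilon> * \<bar>t\<bar> powr (ps - 1)" using d f0 by (cases "t = 0") auto
  qed (use d in auto)
qed

lemma f_0: "f x 0 = 0"
  using f_small[of 1] by (metis abs_zero abs_le_zero_iff less_eq_real_def mult_zero_right powr_0 zero_less_one)

lemma f_bound:
  obtains C where "0 < C" "\<And>x t. \<bar>t\<bar> \<le> M \<Longrightarrow> \<bar>f x t\<bar> \<le> C * \<bar>t\<bar> powr (ps - 1)"
proof -
  obtain \<delta> where d: "0 < \<delta>" "\<delta> \<le> 1" "\<And>x t. \<bar>t\<bar> \<le> \<delta> \<Longrightarrow> \<bar>f x t\<bar> \<le> 1 * \<bar>t\<bar> powr (ps - 1)"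
    using f_small[of 1] by auto
  define A where "A = a * (1 + \<bar>M\<bar> powr (q - 1))"
  have A: "A > 0" using growth(1) by (simp add: A_def add_pos_nonneg)
  define C where "C = A / \<delta> powr (ps - 1) + 1"
  show ?thesis
  proof
    have "0 < A / \<delta> powr (ps - 1)" using A d(1) by simp
    then show C: "C > 0" unfolding C_def by linarith
    fix x t assume t: "\<bar>t\<bar> \<le> M"
    show "\<bar>f x t\<bar> \<le> C * \<bar>t\<bar> powr (ps - 1)"
    proof (cases "\<bar>t\<bar> \<le> \<delta>")
      case True
      have "1 * \<bar>t\<bar> powr (ps - 1) \<le> C * \<bar>t\<bar> powr (ps - 1)"
        using \<open>0 < A / \<delta> powr (ps - 1)\<close> by (intro mult_right_mono) (auto simp: C_def)
      then show ?thesis using d(3)[OF True, of x] by linarith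
    next
      case False
      have "\<bar>f x t\<bar> \<le> a * (1 + \<bar>t\<bar> powr (q - 1))" by (rule growth)
      also have "\<dots> \<le> A" unfolding A_def using t growth ps_bounds
        by (intro mult_left_mono add_left_mono powr_mono2) auto
      also have "A = A / \<delta> powr (ps - 1) * \<delta> powr (ps - 1)" using d by simp
      also have "\<dots> \<le> A / \<delta> powr (ps - 1) * \<bar>t\<bar> powr (ps - 1)"
        using False d A ps_bounds by (intro mult_left_mono powr_mono2) auto
      also have "\<dots> \<le> C * \<bar>t\<bar> powr (ps - 1)" by (intro mult_right_mono) (auto simp: C_def)
      finally show ?thesis .
    qed
  qed
qed

lemma powr_ps_eq: "\<bar>t\<bar> powr (ps - 1) * \<bar>t\<bar> = \<bar>t :: real\<bar> powr ps"
  by (cases "t = 0") (auto simp: powr_diff)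

lemma G_small:
  assumes "0 < \<epsilon>"
  obtains \<delta> where "0 < \<delta>" "\<delta> \<le> 1" "\<And>x t. \<bar>t\<bar> \<le> \<delta> \<Longrightarrow> \<bar>G x t\<bar> \<le> \<epsilon> * \<bar>t\<bar> powr ps"
proof -
  obtain \<delta> where d: "0 < \<delta>" "\<delta> \<le> 1" "\<And>x t. \<bar>t\<bar> \<le> \<delta> \<Longrightarrow> \<bar>f x t\<bar> \<le> \<epsilon> * \<bar>t\<bar> powr (ps - 1)"
    using f_small[OF assms] by metis
  show ?thesis
  proof (rule that[OF d(1,2)])
    fix x t assume "\<bar>t\<bar> \<le> \<delta>"
    from mult_right_mono[OF d(3)[OF this, of x], of "\<bar>t\<bar>"]
    show "\<bar>G x t\<bar> \<le> \<epsilon> * \<bar>t\<bar> powr ps" by (simp add: G_def abs_mult mult.assoc powr_ps_eq)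
  qed
qed

lemma G_bound:
  obtains C where "0 < C" "\<And>x t. \<bar>t\<bar> \<le> M \<Longrightarrow> \<bar>G x t\<bar> \<le> C * \<bar>t\<bar> powr ps"
proof -
  obtain C where C: "0 < C" "\<And>x t. \<bar>t\<bar> \<le> M \<Longrightarrow> \<bar>f x t\<bar> \<le> C * \<bar>t\<bar> powr (ps - 1)"
    using f_bound by metis
  show ?thesis
  proof (rule that[OF C(1)])
    fix x t assume "\<bar>t\<bar> \<le> M"
    from mult_right_mono[OF C(2)[OF this, of x], of "\<bar>t\<bar>"]
    show "\<bar>G x t\<bar> \<le> C * \<bar>t\<bar> powr ps" by (simp add: G_def abs_mult mult.assoc powr_ps_eq)
  qed
qed

lemma F_0: "F x 0 = 0" by (simp add: primitive_def)

lemma F_deriv: "(F x has_real_derivative f x t) (at t)"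
proof -
  let ?a = "- \<bar>t\<bar> - 1" and ?b = "\<bar>t\<bar> + 1"
  have "((\<lambda>u. LBINT y=ereal 0..ereal u. f x y) has_vector_derivative f x t) (at t within {?a..?b})"
    by (rule interval_integral_FTC2) (auto intro: continuous_on_subset[OF f_continuous])
  moreover have "at t within {?a..?b} = at t" by (rule at_within_interior) auto
  ultimately show ?thesis
    by (simp add: has_real_derivative_iff_has_vector_derivative primitive_def[abs_def])
qed

lemma F_deriv' [derivative_intros]:
  "(g has_real_derivative g') (at s within A) \<Longrightarrow>
    ((\<lambda>s. F x (g s)) has_real_derivative f x (g s) * g') (at s within A)"
  using DERIV_chain2[OF F_deriv] by blast

lemma F_continuous: "continuous_on UNIV (F x)"
  using F_deriv by (meson DERIV_isCont continuous_at_imp_continuous_on)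

text \<open>The quotient \<open>f x t / \<bar>t\<bar> powr (p - 1)\<close> tends to \<open>0\<close> at \<open>t = 0\<close>, because \<open>ps > p\<close>, and increases strictly
on either side, so it has the sign of \<open>t\<close>.\<close>

lemma G_pos: assumes "t \<noteq> 0" shows "0 < G x t"
proof -
  let ?g = "\<lambda>t. f x t / \<bar>t\<bar> powr (p - 1)"
  have small: "\<exists>\<delta>>0. \<forall>s. s \<noteq> 0 \<longrightarrow> \<bar>s\<bar> \<le> \<delta> \<longrightarrow> \<bar>?g s\<bar> \<le> \<epsilon>" if \<epsilon>: "0 < \<epsilon>" for \<epsilon>
  proof -
    obtain \<delta> where d: "0 < \<delta>" "\<delta> \<le> 1" "\<And>x t. \<bar>t\<bar> \<le> \<delta> \<Longrightarrow> \<bar>f x t\<bar> \<le> \<epsilon> * \<bar>t\<bar> powr (ps - 1)"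
      using f_small[OF \<epsilon>] by metis
    have "\<bar>?g s\<bar> \<le> \<epsilon>" if "s \<noteq> 0" "\<bar>s\<bar> \<le> \<delta>" for s
    proof -
      have "\<bar>s\<bar> powr (ps - 1) \<le> \<bar>s\<bar> powr (p - 1)"
        using that d ps_bounds by (intro powr_mono') auto
      then have "\<epsilon> * \<bar>s\<bar> powr (ps - 1) \<le> \<epsilon> * \<bar>s\<bar> powr (p - 1)" using \<epsilon> by simp
      then have "\<bar>f x s\<bar> \<le> \<epsilon> * \<bar>s\<bar> powr (p - 1)" using d(3)[OF that(2), of x] by linarith
      then show ?thesis using that by (simp add: abs_divide field_simps)
    qed
    then show ?thesis using d(1) by auto
  qed
  \<comment> \<open>Reflection at \<open>0\<close> reduces negative \<open>t\<close> to positive ones.\<close>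
  define \<sigma> where "\<sigma> = sgn t"
  have \<sigma>: "\<sigma> = 1 \<or> \<sigma> = -1" using assms by (auto simp: \<sigma>_def sgn_if)
  define k where "k r = \<sigma> * ?g (\<sigma> * r)" for r
  have mono: "k r < k r'" if "0 < r" "r < r'" for r r'
    using \<sigma> strict_mono_onD[OF increasing[of x], of r r']
      strict_mono_onD[OF increasing[of x], of "- r'" "- r"] that by (auto simp: k_def)
  have "0 < k \<bar>t\<bar>"
  proof (rule ccontr)
    assume "\<not> 0 < k \<bar>t\<bar>"
    moreover have "k (\<bar>t\<bar> / 2) < k \<bar>t\<bar>" by (rule mono) (use assms in auto)
    ultimately have neg: "0 < - k (\<bar>t\<bar> / 2)" by linarith
    then obtain \<delta> where d: "\<delta> > 0" "\<And>s. s \<noteq> 0 \<Longrightarrow> \<bar>s\<bar> \<le> \<delta> \<Longrightarrow> \<bar>?g s\<bar> \<le> - k (\<bar>t\<bar> / 2)"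
      using small by metis
    define s where "s = min \<delta> (\<bar>t\<bar> / 4)"
    have s: "0 < s" "s < \<bar>t\<bar> / 2" "s \<le> \<delta>" using d assms by (auto simp: s_def)
    have "k s < k (\<bar>t\<bar> / 2)" by (rule mono) (use s in auto)
    moreover have "\<bar>?g (\<sigma> * s)\<bar> \<le> - k (\<bar>t\<bar> / 2)" by (rule d(2)) (use s \<sigma> in auto)
    moreover have "\<bar>k s\<bar> = \<bar>?g (\<sigma> * s)\<bar>" using \<sigma> by (auto simp: k_def)
    ultimately show False by linarith
  qed
  moreover have "\<sigma> * \<bar>t\<bar> = t" by (simp add: \<sigma>_def sgn_mult_abs)
  ultimately have "0 < \<sigma> * f x t" using assms by (simp add: k_def zero_less_divide_iff)
  moreover have "G x t = (\<sigma> * f x t) * \<bar>t\<bar>" using \<open>\<sigma> * \<bar>t\<bar> = t\<close> by (simp add: G_def mult_ac)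
  ultimately show ?thesis using assms by simp
qed

lemma G_0: "G x 0 = 0" by (simp add: G_def)

lemma G_nonneg: "0 \<le> G x t"
  using G_pos[of t x] G_0 by (cases "t = 0") auto

lemma G_scale_less:
  assumes s: "0 < s" "s < 1" and t: "t \<noteq> 0"
  shows "G x (s * t) < s powr p * G x t"
proof -
  let ?g = "\<lambda>t. f x t / \<bar>t\<bar> powr (p - 1)"
  note mono = strict_mono_onD[OF increasing[of x]]
  have eq: "G x r = ?g r * sgn r * \<bar>r\<bar> powr p" if "r \<noteq> 0" for r
  proof -
    have "\<bar>r\<bar> powr p = \<bar>r\<bar> powr (p - 1) * \<bar>r\<bar>" using that by (simp add: powr_diff)
    then show ?thesis using that by (simp add: G_def sgn_mult_abs mult.assoc)
  qed
  have "?g (s * t) * sgn t < ?g t * sgn t"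
  proof (cases "0 < t")
    case True
    have "?g (s * t) < ?g t" by (rule mono) (use s True in auto)
    then show ?thesis using True by simp
  next
    case False
    then have t: "t < 0" using assms by simp
    have "?g t < ?g (s * t)" by (rule mono) (use s t in \<open>auto simp: mult_pos_neg mult_less_cancel_right2\<close>)
    then show ?thesis using t by simp
  qed
  then have "?g (s * t) * sgn t * \<bar>s * t\<bar> powr p < ?g t * sgn t * \<bar>s * t\<bar> powr p"
    by (rule mult_strict_right_mono) (use s t in auto)
  then show ?thesis using eq[of "s * t"] eq[of t] s t
    by (simp add: sgn_mult abs_mult powr_mult mult_ac)
qed

lemma G_scale_le:
  assumes "0 < s" "s \<le> 1" shows "G x (s * t) \<le> s powr p * G x t"
  using G_scale_less[of s t x] assms G_0 by (cases "s = 1"; cases "t = 0") auto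

lemma G_scale_ge:
  assumes "1 \<le> s" shows "s powr p * G x t \<le> G x (s * t)"
  using G_scale_le[of "1 / s" x "s * t"] assms by (simp add: powr_divide field_simps)

lemma G_scale_greater:
  assumes "1 < s" "t \<noteq> 0" shows "s powr p * G x t < G x (s * t)"
  using G_scale_less[of "1 / s" "s * t" x] assms by (simp add: powr_divide field_simps)

text \<open>The right-hand side minus the left-hand side, as a function of \<open>s\<close>, has derivative
\<open>(G x (s * t) - s powr p * G x t) / s\<close>, which changes sign from negative to positive at \<open>s = 1\<close>. This is
the inequality from which all comparisons along rays follow.\<close>

lemma F_scale_ge:
  assumes s: "0 < s"
  shows "(s powr p - 1) / p * G x t \<le> F x (s * t) - F x t"
proof -
  define \<psi> where "\<psi> r = F x (r * t) - r powr p / p * G x t" for r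
  have deriv: "(\<psi> has_real_derivative (G x (r * t) - r powr p * G x t) / r) (at r)" if "0 < r" for r
    unfolding \<psi>_def using that p_gt_1
    by (auto intro!: derivative_eq_intros simp: G_def powr_diff field_simps)
  have "\<psi> 1 \<le> \<psi> s"
  proof (cases "1 \<le> s")
    case True
    show ?thesis
    proof (rule DERIV_nonneg_imp_nondecreasing[OF True])
      fix r assume r: "1 \<le> r" "r \<le> s"
      show "\<exists>y. DERIV \<psi> r :> y \<and> 0 \<le> y"
        using deriv[of r] r G_scale_ge[of r x t] by (intro exI conjI) auto
    qed
  next
    case False
    then have "s \<le> 1" by simp
    then show ?thesis
    proof (rule DERIV_nonpos_imp_nonincreasing)
      fix r assume r: "s \<le> r" "r \<le> 1"
      show "\<exists>y. DERIV \<psi> r :> y \<and> y \<le> 0"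
        using deriv[of r] r s G_scale_le[of r x t] by (intro exI conjI) (auto intro: divide_nonpos_pos)
    qed
  qed
  then show ?thesis by (simp add: \<psi>_def field_simps diff_divide_distrib)
qed

text \<open>Limit \<open>s \<rightarrow> 0\<close> of \<open>F_scale_ge\<close>.\<close>

lemma F_le: "F x t \<le> G x t / p"
proof -
  have id: "((\<lambda>s :: real. s) \<longlongrightarrow> 0) (at_right 0)" by (rule tendsto_ident_at)
  have pw: "((\<lambda>s :: real. s powr p) \<longlongrightarrow> 0 powr p) (at_right 0)"
    by (rule tendsto_powr'[OF id tendsto_const])
      (use p_gt_1 in \<open>auto simp: eventually_at_right_field intro!: exI[of _ 1]\<close>)
  have 1: "((\<lambda>s. F x (s * t) - F x t - (s powr p - 1) / p * G x t) \<longlongrightarrow>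
      F x (0 * t) - F x t - (0 powr p - 1) / p * G x t) (at_right 0)"
    using p_gt_1
    by (intro tendsto_intros pw id isCont_tendsto_compose[OF DERIV_isCont[OF F_deriv]]) auto
  have "0 \<le> F x (0 * t) - F x t - (0 powr p - 1) / p * G x t"
    by (rule tendsto_lowerbound[OF 1])
      (use F_scale_ge[of _ x t] in \<open>auto simp: eventually_at_right_field intro!: exI[of _ 1]\<close>)
  then show ?thesis by (simp add: F_0)
qed

lemma F_nonneg: "0 \<le> F x t"
proof (cases "0 \<le> t")
  case True
  have "F x 0 \<le> F x t"
  proof (rule DERIV_nonneg_imp_nondecreasing[OF True])
    fix r :: real assume "0 \<le> r"
    then show "\<exists>y. DERIV (F x) r :> y \<and> 0 \<le> y"
      using F_deriv[of x r] G_nonneg[of x r] f_0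
      by (intro exI[of _ "f x r"]) (cases "r = 0"; auto simp: G_def zero_le_mult_iff)
  qed
  then show ?thesis by (simp add: F_0)
next
  case False
  then have "t \<le> 0" by simp
  then have "F x 0 \<le> F x t"
  proof (rule DERIV_nonpos_imp_nonincreasing)
    fix r :: real assume "r \<le> 0"
    then show "\<exists>y. DERIV (F x) r :> y \<and> y \<le> 0"
      using F_deriv[of x r] G_nonneg[of x r] f_0
      by (intro exI[of _ "f x r"]) (cases "r = 0"; auto simp: G_def zero_le_mult_iff)
  qed
  then show ?thesis by (simp add: F_0)
qed

lemma H_nonneg: "0 \<le> H x t" using F_le by (simp add: H_def)

lemma H_scale: assumes s: "0 < s" "s \<le> 1"
  shows "H x (s * t) + (s powr p * G x t - G x (s * t)) / p \<le> H x t"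
proof -
  have "(s powr p - 1) / p * G x t = s powr p * G x t / p - G x t / p"
    by (simp add: diff_divide_distrib left_diff_distrib)
  then show ?thesis using F_scale_ge[OF s(1), of x t] unfolding H_def diff_divide_distrib by linarith
qed

lemma H_mono: assumes s: "0 < s" "s \<le> 1" shows "H x (s * t) \<le> H x t"
proof -
  have "0 \<le> (s powr p * G x t - G x (s * t)) / p" using G_scale_le[OF s] p_gt_1 by simp
  then show ?thesis using H_scale[OF s, of x t] by linarith
qed

lemma H_pos: assumes "t \<noteq> 0" shows "0 < H x t"
proof -
  have "0 < ((1 / 2) powr p * G x t - G x (1 / 2 * t)) / p"
    using G_scale_less[of "1 / 2" t x] assms p_gt_1 by simp
  then show ?thesis using H_scale[of "1 / 2" x t] H_nonneg[of x "1 / 2 * t"] by linarith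
qed

lemma H_le: "H x t \<le> G x t / p" using F_nonneg by (simp add: H_def)

lemma G_periodic: "periodic T G" and H_periodic: "periodic T H"
  using f_periodic by (auto simp: periodic_def G_def[abs_def] H_def[abs_def] primitive_def[abs_def])

lemma G_continuous: "continuous_on UNIV (G x)" and H_continuous: "continuous_on UNIV (H x)"
  unfolding G_def[abs_def] H_def[abs_def] using p_gt_1
  by (auto intro!: continuous_intros f_continuous F_continuous)

section \<open>Sums over the nonlinearity\<close>

text \<open>The densities \<open>F\<close>, \<open>G\<close> and \<open>H\<close> share these properties, which suffice for summability, for continuity
along rays and for the Brezis-Lieb splitting.\<close>

definition controlled :: "(int ^ 'n \<Rightarrow> real \<Rightarrow> real) \<Rightarrow> bool" where
  "controlled h \<longleftrightarrow> periodic T h \<and> (\<forall>x. continuous_on UNIV (h x)) \<and>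
    (\<exists>c\<ge>0. \<forall>x t. \<bar>h x t\<bar> \<le> c * G x t)"

lemma controlled_G: "controlled G"
  unfolding controlled_def using G_periodic G_continuous G_nonneg
  by (auto intro!: exI[of _ 1])

lemma controlled_H: "controlled H"
  unfolding controlled_def using H_periodic H_continuous H_nonneg H_le p_gt_1
  by (auto intro!: exI[of _ "1 / p"])

lemma F_periodic: "periodic T F"
  using f_periodic by (auto simp: periodic_def primitive_def[abs_def])

lemma controlled_F: "controlled F"
  unfolding controlled_def using F_periodic F_continuous F_nonneg F_le p_gt_1
  by (auto intro!: exI[of _ "1 / p"])

lemma controlled_small:
  assumes h: "controlled h" and \<epsilon>: "0 < \<epsilon>"
  obtains \<delta> where "0 < \<delta>" "\<delta> \<le> 1" "\<And>x t. \<bar>t\<bar> \<le> \<delta> \<Longrightarrow> \<bar>h x t\<bar> \<le> \<epsilon> * \<bar>t\<bar> powr ps"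
proof -
  obtain c where c: "0 \<le> c" "\<And>x t. \<bar>h x t\<bar> \<le> c * G x t" using h by (auto simp: controlled_def)
  have "0 < \<epsilon> / (c + 1)" using \<epsilon> c by simp
  from G_small[OF this] obtain \<delta> where d: "0 < \<delta>" "\<delta> \<le> 1"
    "\<And>x t. \<bar>t\<bar> \<le> \<delta> \<Longrightarrow> \<bar>G x t\<bar> \<le> \<epsilon> / (c + 1) * \<bar>t\<bar> powr ps" by metis
  show ?thesis
  proof (rule that[OF d(1,2)])
    fix x t assume t: "\<bar>t\<bar> \<le> \<delta>"
    have "\<bar>h x t\<bar> \<le> c * G x t" by (rule c)
    also have "\<dots> \<le> (c + 1) * (\<epsilon> / (c + 1) * \<bar>t\<bar> powr ps)"
      using d(3)[OF t, of x] c(1) G_nonneg[of x t] by (intro mult_mono) auto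
    also have "\<dots> = \<epsilon> * \<bar>t\<bar> powr ps" using c(1) by simp
    finally show "\<bar>h x t\<bar> \<le> \<epsilon> * \<bar>t\<bar> powr ps" .
  qed
qed

lemma controlled_bound:
  assumes h: "controlled h"
  obtains C where "0 < C" "\<And>x t. \<bar>t\<bar> \<le> M \<Longrightarrow> \<bar>h x t\<bar> \<le> C * \<bar>t\<bar> powr ps"
proof -
  obtain c where c: "0 \<le> c" "\<And>x t. \<bar>h x t\<bar> \<le> c * G x t" using h by (auto simp: controlled_def)
  obtain C where C: "0 < C" "\<And>x t. \<bar>t\<bar> \<le> M \<Longrightarrow> \<bar>G x t\<bar> \<le> C * \<bar>t\<bar> powr ps" using G_bound by metis
  show ?thesis
  proof (rule that[of "(c + 1) * C"])
    fix x t assume t: "\<bar>t\<bar> \<le> M"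
    have "\<bar>h x t\<bar> \<le> c * G x t" by (rule c)
    also have "\<dots> \<le> (c + 1) * (C * \<bar>t\<bar> powr ps)"
      using C(2)[OF t, of x] c(1) G_nonneg[of x t] by (intro mult_mono) auto
    finally show "\<bar>h x t\<bar> \<le> (c + 1) * C * \<bar>t\<bar> powr ps" by simp
  qed (use c C in auto)
qed

lemma controlled_0: "controlled h \<Longrightarrow> h x 0 = 0"
  unfolding controlled_def using G_0 by (metis abs_le_zero_iff mult_zero_right)

lemma controlled_summable:
  assumes h: "controlled h" and u: "u \<in> E"
  shows "(\<lambda>x. h x (u x)) summable_on UNIV"
proof -
  obtain M where M: "\<And>x. \<bar>u x\<bar> \<le> M" using E_bounded[OF u] by metis
  obtain C where C: "0 < C" "\<And>x t. \<bar>t\<bar> \<le> M \<Longrightarrow> \<bar>h x t\<bar> \<le> C * \<bar>t\<bar> powr ps"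
    using controlled_bound[OF h] by metis
  have s: "(\<lambda>x. C * \<bar>u x\<bar> powr ps) summable_on UNIV"
    using energy_spaceD(2)[OF u] by (intro summable_on_cmult_right)
  show ?thesis
    by (rule abs_summable_summable, rule summable_on_comparison_test[OF s]) (use C(2) M in auto)
qed

lemma controlled_tendsto:
  assumes h: "controlled h" and "((\<lambda>b. g b) \<longlongrightarrow> t) A"
  shows "((\<lambda>b. h x (g b)) \<longlongrightarrow> h x t) A"
  using h assms(2) by (intro isCont_tendsto_compose[of t "h x" g]) (auto simp: controlled_def continuous_on_eq_continuous_at)

lemma controlled_ray_continuous:
  assumes h: "controlled h" and u: "u \<in> E"
  shows "isCont (\<lambda>s. \<Sum>\<^sub>\<infinity>x. h x (s * u x)) s"
proof -
  obtain M where M: "0 < M" "\<And>x. \<bar>u x\<bar> \<le> M" using E_bounded[OF u] by metis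
  define R where "R = \<bar>s\<bar> + 1"
  have R: "R > 0" by (simp add: R_def add_nonneg_pos)
  obtain C where C: "0 < C" "\<And>x t. \<bar>t\<bar> \<le> R * M \<Longrightarrow> \<bar>h x t\<bar> \<le> C * \<bar>t\<bar> powr ps"
    using controlled_bound[OF h] by metis
  have bd: "\<bar>h x (r * u x)\<bar> \<le> C * R powr ps * \<bar>u x\<bar> powr ps" if r: "\<bar>r\<bar> \<le> R" for r x
  proof -
    have "\<bar>h x (r * u x)\<bar> \<le> C * \<bar>r * u x\<bar> powr ps"
      using M r R by (intro C(2)) (auto simp: abs_mult intro!: mult_mono)
    also have "\<dots> = C * (\<bar>r\<bar> powr ps * \<bar>u x\<bar> powr ps)" by (simp add: abs_mult powr_mult)
    also have "\<dots> \<le> C * (R powr ps * \<bar>u x\<bar> powr ps)"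
      using r C(1) ps_bounds by (intro mult_left_mono mult_right_mono powr_mono2) auto
    finally show ?thesis by (simp add: mult.assoc)
  qed
  have "((\<lambda>r. \<Sum>\<^sub>\<infinity>x. h x (r * u x)) \<longlongrightarrow> (\<Sum>\<^sub>\<infinity>x. h x (s * u x))) (at s)"
  proof (rule infsum_dominated[where h = "\<lambda>x. C * R powr ps * \<bar>u x\<bar> powr ps"])
    show "((\<lambda>r. h x (r * u x)) \<longlongrightarrow> h x (s * u x)) (at s)" for x
      by (intro controlled_tendsto[OF h] tendsto_intros)
    show "\<forall>\<^sub>F r in at s. \<forall>x. \<bar>h x (r * u x)\<bar> \<le> C * R powr ps * \<bar>u x\<bar> powr ps"
      unfolding eventually_at
      by (rule exI[of _ 1]) (use bd in \<open>auto simp: R_def dist_real_def\<close>)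
    show "\<bar>h x (s * u x)\<bar> \<le> C * R powr ps * \<bar>u x\<bar> powr ps" for x by (rule bd) (simp add: R_def)
    show "(\<lambda>x. C * R powr ps * \<bar>u x\<bar> powr ps) summable_on UNIV"
      using energy_spaceD(2)[OF u] by (intro summable_on_cmult_right)
  qed
  then show ?thesis by (simp add: isCont_def)
qed

text \<open>Three regimes. If both arguments are small and \<open>\<beta>\<close> is dominated by \<open>\<alpha>\<close>, smallness of \<open>h\<close> near zero
suffices. If \<open>\<alpha>\<close> is bounded below and \<open>\<beta>\<close> is tiny, uniform continuity suffices, since there a constant
error is an error of order \<open>\<bar>\<alpha>\<bar> powr ps\<close>. In the remaining case \<open>\<alpha>\<close> is at most a multiple of \<open>\<beta>\<close>.\<close>

lemma controlled_almost_additive: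
  assumes h: "controlled h" and \<epsilon>: "0 < \<epsilon>" and M: "0 < M"
  obtains C where "0 < C" "\<And>x \<alpha> \<beta>. \<bar>\<alpha>\<bar> \<le> M \<Longrightarrow> \<bar>\<beta>\<bar> \<le> M \<Longrightarrow>
    \<bar>h x (\<beta> + \<alpha>) - h x \<alpha> - h x \<beta>\<bar> \<le> \<epsilon> * \<bar>\<alpha>\<bar> powr ps + C * \<bar>\<beta>\<bar> powr ps"
proof -
  obtain K where K: "0 < K" "\<And>x t. \<bar>t\<bar> \<le> 2 * M \<Longrightarrow> \<bar>h x t\<bar> \<le> K * \<bar>t\<bar> powr ps"
    using controlled_bound[OF h] by metis
  define \<epsilon>' where "\<epsilon>' = \<epsilon> / (2 powr ps + 1)"
  have pp: "0 < 2 powr ps + (1::real)" by (simp add: add_pos_pos)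
  have \<epsilon>': "0 < \<epsilon>'" using \<epsilon> pp by (simp add: \<epsilon>'_def)
  from controlled_small[OF h this] obtain d1 where d1: "0 < d1"
    "\<And>x t. \<bar>t\<bar> \<le> d1 \<Longrightarrow> \<bar>h x t\<bar> \<le> \<epsilon>' * \<bar>t\<bar> powr ps" by metis
  have "0 < \<epsilon> * (d1 / 2) powr ps" using \<epsilon> d1 by simp
  with h T_pos obtain d2 where d2: "0 < d2"
    "\<And>x s t. \<bar>s\<bar> \<le> 2 * M \<Longrightarrow> \<bar>t\<bar> \<le> 2 * M \<Longrightarrow> \<bar>s - t\<bar> < d2 \<Longrightarrow> \<bar>h x s - h x t\<bar> < \<epsilon> * (d1 / 2) powr ps"
    unfolding controlled_def using periodic_uniformly_continuous[of T h "\<epsilon> * (d1 / 2) powr ps" "2 * M"] by metis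
  \<comment> \<open>Both \<open>\<bar>\<alpha>\<bar> \<le> \<bar>\<beta>\<bar>\<close> and \<open>\<bar>\<beta>\<bar> \<ge> d2\<close> imply \<open>\<bar>\<alpha>\<bar> \<le> \<kappa> * \<bar>\<beta>\<bar>\<close>.\<close>
  define \<kappa> where "\<kappa> = max 1 (M / d2)"
  have \<kappa>: "1 \<le> \<kappa>" by (simp add: \<kappa>_def)
  define C where "C = 3 * K * (1 + \<kappa>) powr ps"
  show ?thesis
  proof
    show "0 < C" using K \<kappa> by (simp add: C_def)
    fix x \<alpha> \<beta> assume ab: "\<bar>\<alpha>\<bar> \<le> M" "\<bar>\<beta>\<bar> \<le> M"
    have big: "\<bar>h x t\<bar> \<le> C / 3 * \<bar>\<beta>\<bar> powr ps" if "\<bar>t\<bar> \<le> 2 * M" "\<bar>t\<bar> \<le> (1 + \<kappa>) * \<bar>\<beta>\<bar>" for t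
    proof -
      have "\<bar>h x t\<bar> \<le> K * \<bar>t\<bar> powr ps" by (rule K(2)) fact
      also have "\<dots> \<le> K * ((1 + \<kappa>) * \<bar>\<beta>\<bar>) powr ps"
        using that K(1) ps_bounds by (intro mult_left_mono powr_mono2) auto
      also have "\<dots> = C / 3 * \<bar>\<beta>\<bar> powr ps" using \<kappa> by (simp add: C_def powr_mult)
      finally show ?thesis .
    qed
    have \<beta>: "\<bar>h x \<beta>\<bar> \<le> C / 3 * \<bar>\<beta>\<bar> powr ps"
      using ab \<kappa> by (intro big) (auto simp: algebra_simps)
    have nn: "0 \<le> C / 3 * \<bar>\<beta>\<bar> powr ps" "0 \<le> \<epsilon> * \<bar>\<alpha>\<bar> powr ps" using K \<kappa> \<epsilon> by (simp_all add: C_def)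
    consider "\<bar>\<alpha>\<bar> \<le> d1 / 2" "\<bar>\<beta>\<bar> \<le> \<bar>\<alpha>\<bar>" | "d1 / 2 < \<bar>\<alpha>\<bar>" "\<bar>\<beta>\<bar> < d2" | "\<bar>\<alpha>\<bar> \<le> \<kappa> * \<bar>\<beta>\<bar>"
    proof -
      have 1: "\<bar>\<alpha>\<bar> \<le> \<kappa> * \<bar>\<beta>\<bar>" if "\<bar>\<alpha>\<bar> \<le> \<bar>\<beta>\<bar>"
        using that \<kappa> mult_right_mono[OF \<kappa>, of "\<bar>\<beta>\<bar>"] by linarith
      have 2: "\<bar>\<alpha>\<bar> \<le> \<kappa> * \<bar>\<beta>\<bar>" if "d2 \<le> \<bar>\<beta>\<bar>"
      proof -
        have "M = M / d2 * d2" using d2 by simp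
        also have "\<dots> \<le> \<kappa> * \<bar>\<beta>\<bar>" using that d2 M by (intro mult_mono) (auto simp: \<kappa>_def)
        finally show ?thesis using ab by linarith
      qed
      show ?thesis using 1 2 that by linarith
    qed
    then show "\<bar>h x (\<beta> + \<alpha>) - h x \<alpha> - h x \<beta>\<bar> \<le> \<epsilon> * \<bar>\<alpha>\<bar> powr ps + C * \<bar>\<beta>\<bar> powr ps"
    proof cases
      case 1
      have "\<bar>h x (\<beta> + \<alpha>)\<bar> \<le> \<epsilon>' * \<bar>\<beta> + \<alpha>\<bar> powr ps" using 1 by (intro d1(2)) linarith
      also have "\<dots> \<le> \<epsilon>' * (2 * \<bar>\<alpha>\<bar>) powr ps"
        using 1 \<epsilon>' ps_bounds by (intro mult_left_mono powr_mono2) linarith+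
      finally have "\<bar>h x (\<beta> + \<alpha>)\<bar> \<le> \<epsilon>' * (2 powr ps * \<bar>\<alpha>\<bar> powr ps)" by (simp add: powr_mult)
      moreover have "\<bar>h x \<alpha>\<bar> \<le> \<epsilon>' * \<bar>\<alpha>\<bar> powr ps" using 1 d1 by (intro d1(2)) linarith
      moreover have "\<epsilon>' * (2 powr ps * \<bar>\<alpha>\<bar> powr ps) + \<epsilon>' * \<bar>\<alpha>\<bar> powr ps = \<epsilon> * \<bar>\<alpha>\<bar> powr ps"
      proof -
        have "\<epsilon>' * (2 powr ps * \<bar>\<alpha>\<bar> powr ps) + \<epsilon>' * \<bar>\<alpha>\<bar> powr ps = (\<epsilon>' * (2 powr ps + 1)) * \<bar>\<alpha>\<bar> powr ps"
          by (simp add: algebra_simps)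
        also have "\<epsilon>' * (2 powr ps + 1) = \<epsilon>" using pp by (simp add: \<epsilon>'_def)
        finally show ?thesis .
      qed
      ultimately show ?thesis using \<beta> nn by linarith
    next
      case 2
      have "\<bar>h x (\<beta> + \<alpha>) - h x \<alpha>\<bar> < \<epsilon> * (d1 / 2) powr ps" using ab 2 by (intro d2(2)) linarith+
      also have "\<dots> \<le> \<epsilon> * \<bar>\<alpha>\<bar> powr ps" using 2 d1 \<epsilon> ps_bounds by (intro mult_left_mono powr_mono2) auto
      finally show ?thesis using \<beta> nn by linarith
    next
      case 3
      have "\<bar>h x (\<beta> + \<alpha>)\<bar> \<le> C / 3 * \<bar>\<beta>\<bar> powr ps" "\<bar>h x \<alpha>\<bar> \<le> C / 3 * \<bar>\<beta>\<bar> powr ps"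
        using ab 3 \<kappa> unfolding distrib_right by (intro big; simp add: distrib_right; linarith)+
      then show ?thesis using \<beta> nn by linarith
    qed
  qed
qed

lemma controlled_Brezis_Lieb:
  assumes h: "controlled h"
    and u: "u \<in> E" and w: "\<And>n::nat. w n \<in> E" "\<And>n. Q (w n) \<le> B" "\<And>x. (\<lambda>n. w n x) \<longlonglongrightarrow> 0"
  shows "(\<lambda>n. (\<Sum>\<^sub>\<infinity>x. h x (u x + w n x)) - (\<Sum>\<^sub>\<infinity>x. h x (w n x))) \<longlonglongrightarrow> (\<Sum>\<^sub>\<infinity>x. h x (u x))"
proof -
  let ?d = "\<lambda>n x. h x (u x + w n x) - h x (w n x) - h x (u x)"
  obtain M1 A where M1: "0 < M1" "\<And>u x. u \<in> E \<Longrightarrow> Q u \<le> B \<Longrightarrow> \<bar>u x\<bar> \<le> M1"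
    "\<And>u. u \<in> E \<Longrightarrow> Q u \<le> B \<Longrightarrow> mass u \<le> A" using E_bounds[of B] by metis
  obtain M2 where M2: "\<And>x. \<bar>u x\<bar> \<le> M2" using E_bounded[OF u] by metis
  define M where "M = max M1 M2"
  have M: "0 < M" "\<And>x. \<bar>u x\<bar> \<le> M" "\<And>n x. \<bar>w n x\<bar> \<le> M"
  proof -
    show "0 < M" using M1(1) by (simp add: M_def)
    show "\<bar>u x\<bar> \<le> M" for x using M2[of x] by (simp add: M_def)
    show "\<bar>w n x\<bar> \<le> M" for n x using M1(2)[OF w(1) w(2), of n x] by (simp add: M_def)
  qed
  have "(\<lambda>n. infsum (?d n) UNIV) \<longlonglongrightarrow> 0"
  proof (rule infsum_almost_dominated[where e = "\<lambda>n x. \<bar>w n x\<bar> powr ps" and h = "\<lambda>x. \<bar>u x\<bar> powr ps" and B = A])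
    show "(\<lambda>n. ?d n x) \<longlonglongrightarrow> 0" for x
    proof -
      have "(\<lambda>n. ?d n x) \<longlonglongrightarrow> h x (u x + 0) - h x 0 - h x (u x)"
        by (intro tendsto_diff tendsto_const controlled_tendsto[OF h] tendsto_add w(3))
      then show ?thesis by (simp add: controlled_0[OF h])
    qed
    show "\<exists>C. \<forall>\<^sub>F n in sequentially. \<forall>x. \<bar>?d n x\<bar> \<le> \<epsilon> * \<bar>w n x\<bar> powr ps + C * \<bar>u x\<bar> powr ps"
      if \<epsilon>: "\<epsilon> > 0" for \<epsilon>
    proof -
      obtain C where C: "0 < C" "\<And>x \<alpha> \<beta>. \<bar>\<alpha>\<bar> \<le> M \<Longrightarrow> \<bar>\<beta>\<bar> \<le> M \<Longrightarrow>
          \<bar>h x (\<beta> + \<alpha>) - h x \<alpha> - h x \<beta>\<bar> \<le> \<epsilon> * \<bar>\<alpha>\<bar> powr ps + C * \<bar>\<beta>\<bar> powr ps"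
        using controlled_almost_additive[OF h \<epsilon> M(1)] by metis
      show ?thesis by (intro exI[of _ C] always_eventually allI C(2) M)
    qed
    show "(\<lambda>x. \<bar>u x\<bar> powr ps) summable_on UNIV" "(\<lambda>x. \<bar>w n x\<bar> powr ps) summable_on UNIV" for n
      by (rule energy_spaceD(2), rule u, rule energy_spaceD(2), rule w(1))
    show "mass (w n) \<le> A" for n by (rule M1(3)[OF w(1) w(2)])
  qed auto
  moreover have "infsum (?d n) UNIV = (\<Sum>\<^sub>\<infinity>x. h x (u x + w n x)) - (\<Sum>\<^sub>\<infinity>x. h x (w n x)) - (\<Sum>\<^sub>\<infinity>x. h x (u x))" for n
    using controlled_summable[OF h E_add[OF u w(1)[of n]]] controlled_summable[OF h u]
      controlled_summable[OF h w(1)[of n]]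
    by (simp add: infsum_diff_real)
  ultimately have "(\<lambda>n. (\<Sum>\<^sub>\<infinity>x. h x (u x + w n x)) - (\<Sum>\<^sub>\<infinity>x. h x (w n x)) - (\<Sum>\<^sub>\<infinity>x. h x (u x))) \<longlonglongrightarrow> 0"
    by simp
  then show ?thesis by (simp add: LIM_zero_iff)
qed

lemma infsum_update:
  assumes h: "controlled h" and u: "u \<in> E"
  shows "(\<Sum>\<^sub>\<infinity>x. h x ((u(y := r)) x)) = (\<Sum>\<^sub>\<infinity>x. h x (u x)) + h y r - h y (u y)"
proof -
  have split: "(\<Sum>\<^sub>\<infinity>x. h x (v x)) = h y (v y) + (\<Sum>\<^sub>\<infinity>x\<in>UNIV - {y}. h x (v x))" if v: "v \<in> E" for v
  proof -
    have "(\<Sum>\<^sub>\<infinity>x. h x (v x)) = (\<Sum>\<^sub>\<infinity>x\<in>{y} \<union> (UNIV - {y}). h x (v x))" by simp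
    also have "\<dots> = (\<Sum>\<^sub>\<infinity>x\<in>{y}. h x (v x)) + (\<Sum>\<^sub>\<infinity>x\<in>UNIV - {y}. h x (v x))"
      by (subst infsum_Un_disjoint)
        (auto intro: summable_on_subset_banach[OF controlled_summable[OF h v]])
    finally show ?thesis by simp
  qed
  have "(\<Sum>\<^sub>\<infinity>x\<in>UNIV - {y}. h x ((u(y := r)) x)) = (\<Sum>\<^sub>\<infinity>x\<in>UNIV - {y}. h x (u x))"
    by (rule infsum_cong) auto
  then show ?thesis using split[OF u] split[OF E_update[OF u, of y r]] by simp
qed

section \<open>The Nehari manifold\<close>

abbreviation "N \<equiv> nehari p V f"
abbreviation "\<Phi> \<equiv> energy p V f"

text \<open>\<open>energy_deriv p V f u u\<close> for \<open>u\<close> in the energy space.\<close>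

definition J :: "(int ^ 'n \<Rightarrow> real) \<Rightarrow> real" where
  "J u = Q u - (\<Sum>\<^sub>\<infinity>x. G x (u x))"

lemma energy_eq: "u \<in> E \<Longrightarrow> \<Phi> u = Q u / p - (\<Sum>\<^sub>\<infinity>x. F x (u x))"
  using energy_norm_powr(2)[OF energy_spaceD(1)] by (simp add: energy_def)

lemma mem_nehari: "u \<in> N \<longleftrightarrow> u \<in> E \<and> u \<noteq> (\<lambda>_. 0) \<and> J u = 0"
  using energy_deriv_self[OF energy_spaceD(1)] by (auto simp: nehari_def J_def G_def)

lemma energy_H:
  assumes u: "u \<in> E" shows "\<Phi> u = J u / p + (\<Sum>\<^sub>\<infinity>x. H x (u x))"
proof -
  have "(\<Sum>\<^sub>\<infinity>x. H x (u x)) = (\<Sum>\<^sub>\<infinity>x. G x (u x) * (1 / p) - F x (u x))"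
    by (simp add: H_def)
  also have "\<dots> = (\<Sum>\<^sub>\<infinity>x. G x (u x) * (1 / p)) - (\<Sum>\<^sub>\<infinity>x. F x (u x))"
    using controlled_summable[OF controlled_G u] controlled_summable[OF controlled_F u]
    by (intro infsum_diff_real summable_on_cmult_left)
  also have "(\<Sum>\<^sub>\<infinity>x. G x (u x) * (1 / p)) = (\<Sum>\<^sub>\<infinity>x. G x (u x)) * (1 / p)"
    by (rule infsum_cmult_left')
  finally show ?thesis by (simp add: energy_eq[OF u] J_def diff_divide_distrib)
qed

lemma energy_nehari: "u \<in> N \<Longrightarrow> \<Phi> u = (\<Sum>\<^sub>\<infinity>x. H x (u x))"
  using energy_H[of u] mem_nehari by simp

lemma energy_nehari_nonneg: "u \<in> N \<Longrightarrow> 0 \<le> \<Phi> u"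
  unfolding energy_nehari by (intro infsum_nonneg H_nonneg)

lemma J_le_energy: assumes "u \<in> E" shows "J u \<le> p * \<Phi> u"
proof -
  have "0 \<le> (\<Sum>\<^sub>\<infinity>x. H x (u x))" by (intro infsum_nonneg H_nonneg)
  then have "J u / p \<le> \<Phi> u" using energy_H[OF assms] by linarith
  then show ?thesis using p_gt_1 by (simp add: field_simps)
qed

text \<open>For \<open>J u = 0\<close> this says that \<open>\<Phi>\<close> attains its maximum along the ray through \<open>u\<close> at \<open>u\<close>.\<close>

lemma energy_ray:
  assumes u: "u \<in> E" and s: "0 < s"
  shows "\<Phi> (\<lambda>x. s * u x) \<le> \<Phi> u + (s powr p - 1) / p * J u"
proof -
  let ?c = "(s powr p - 1) / p"
  have "(\<Sum>\<^sub>\<infinity>x. ?c * G x (u x)) \<le> (\<Sum>\<^sub>\<infinity>x. F x (s * u x) - F x (u x))"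
    using controlled_summable[OF controlled_G u] controlled_summable[OF controlled_F u]
      controlled_summable[OF controlled_F E_scale[OF u, of s]]
    by (intro infsum_mono infsum_diff_real summable_on_cmult_right F_scale_ge s)
  also have "\<dots> = (\<Sum>\<^sub>\<infinity>x. F x (s * u x)) - (\<Sum>\<^sub>\<infinity>x. F x (u x))"
    using controlled_summable[OF controlled_F u] controlled_summable[OF controlled_F E_scale[OF u, of s]]
    by (intro infsum_diff_real)
  finally have "?c * (\<Sum>\<^sub>\<infinity>x. G x (u x)) \<le> (\<Sum>\<^sub>\<infinity>x. F x (s * u x)) - (\<Sum>\<^sub>\<infinity>x. F x (u x))"
    unfolding infsum_cmult_right' .
  moreover have "s powr p * Q u / p = Q u / p + ?c * Q u" by (simp add: field_simps diff_divide_distrib)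
  moreover have "?c * J u = ?c * Q u - ?c * (\<Sum>\<^sub>\<infinity>x. G x (u x))" unfolding J_def by (rule right_diff_distrib)
  ultimately show ?thesis
    unfolding energy_eq[OF u] energy_eq[OF E_scale[OF u]] total_energy_scale using s by simp
qed

lemma energy_ray_le: "u \<in> N \<Longrightarrow> 0 < s \<Longrightarrow> \<Phi> (\<lambda>x. s * u x) \<le> \<Phi> u"
  using energy_ray[of u s] by (simp add: mem_nehari)

lemma J_ray_continuous:
  assumes u: "u \<in> E" shows "isCont (\<lambda>s. J (\<lambda>x. s * u x)) s"
  unfolding J_def total_energy_scale
  using controlled_ray_continuous[OF controlled_G u] p_gt_1 by (auto intro!: continuous_intros)

lemma J_zero: "J (\<lambda>_. 0) = 0"
proof -
  have "bond_energy p V (\<lambda>_. 0) = (\<lambda>_. 0)" by (simp add: fun_eq_iff bond_energy_def bond_def)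
  then show ?thesis by (simp add: J_def total_energy_def G_0)
qed

lemma J_ray_strict:
  assumes u: "u \<in> N"
  shows "0 < s \<Longrightarrow> s < 1 \<Longrightarrow> 0 < J (\<lambda>x. s * u x)" "1 < s \<Longrightarrow> J (\<lambda>x. s * u x) < 0"
proof -
  have uE: "u \<in> E" and Ju: "Q u = (\<Sum>\<^sub>\<infinity>x. G x (u x))" and "u \<noteq> (\<lambda>_. 0)"
    using u by (auto simp: mem_nehari J_def)
  then obtain y where y: "u y \<noteq> 0" by (auto simp: fun_eq_iff)
  have sm: "(\<lambda>x. G x (s * u x)) summable_on UNIV" "(\<lambda>x. s powr p * G x (u x)) summable_on UNIV" for s
    using controlled_summable[OF controlled_G E_scale[OF uE, of s]] controlled_summable[OF controlled_G uE]
    by (auto intro: summable_on_cmult_right)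
  have eq: "J (\<lambda>x. s * u x) = (\<Sum>\<^sub>\<infinity>x. s powr p * G x (u x)) - (\<Sum>\<^sub>\<infinity>x. G x (s * u x))" if "0 < s" for s
    using that by (simp add: J_def total_energy_scale Ju infsum_cmult_right')
  show "0 < J (\<lambda>x. s * u x)" if s: "0 < s" "s < 1"
  proof -
    have "(\<Sum>\<^sub>\<infinity>x. G x (s * u x)) < (\<Sum>\<^sub>\<infinity>x. s powr p * G x (u x))"
      by (rule infsum_strict_mono_real[OF sm, where j = y]) (use s y G_scale_le G_scale_less in auto)
    then show ?thesis using eq[OF s(1)] by simp
  qed
  show "J (\<lambda>x. s * u x) < 0" if s: "1 < s"
  proof -
    have "(\<Sum>\<^sub>\<infinity>x. s powr p * G x (u x)) < (\<Sum>\<^sub>\<infinity>x. G x (s * u x))"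
      by (rule infsum_strict_mono_real[OF sm(2,1), where j = y]) (use s y G_scale_ge G_scale_greater in auto)
    then show ?thesis using eq[of s] s by simp
  qed
qed

lemma infsum_le_small:
  assumes h: "controlled h" and v: "v \<in> E" and \<epsilon>: "0 \<le> \<epsilon>"
    and le: "\<And>x. \<bar>h x (v x)\<bar> \<le> \<epsilon> * \<bar>v x\<bar> powr ps"
  shows "(\<Sum>\<^sub>\<infinity>x. h x (v x)) \<le> \<epsilon> * mass v"
proof -
  have "(\<Sum>\<^sub>\<infinity>x. h x (v x)) \<le> (\<Sum>\<^sub>\<infinity>x. \<epsilon> * \<bar>v x\<bar> powr ps)"
    using controlled_summable[OF h v] energy_spaceD(2)[OF v] abs_le_D1[OF le]
    by (intro infsum_mono summable_on_cmult_right)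
  then show ?thesis by (simp add: infsum_cmult_right')
qed

text \<open>Near zero the sum of \<open>G\<close> is at most \<open>\<epsilon> * s powr ps\<close> times a constant, which is of smaller order than
\<open>s powr p * Q u\<close>.\<close>

lemma J_ray_small:
  assumes u: "u \<in> E" "u \<noteq> (\<lambda>_. 0)"
  obtains s where "0 < s" "s \<le> 1" "0 < J (\<lambda>x. s * u x)"
proof -
  let ?A = "mass u"
  have A: "0 \<le> ?A" by (intro infsum_nonneg) simp
  have Qu: "0 < Q u" by (rule Q_pos[OF u])
  obtain M where M: "0 < M" "\<And>x. \<bar>u x\<bar> \<le> M" using E_bounded[OF u(1)] by metis
  define \<epsilon> where "\<epsilon> = Q u / (2 * (?A + 1))"
  have \<epsilon>: "0 < \<epsilon>" using Qu A by (simp add: \<epsilon>_def)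
  have "\<epsilon> * ?A \<le> \<epsilon> * (?A + 1)" using \<epsilon> by (intro mult_left_mono) auto
  also have "\<dots> = Q u / 2" using A by (simp add: \<epsilon>_def field_simps)
  finally have \<epsilon>A: "\<epsilon> * ?A < Q u" using Qu by linarith
  obtain \<delta> where d: "0 < \<delta>" "\<And>x t. \<bar>t\<bar> \<le> \<delta> \<Longrightarrow> \<bar>G x t\<bar> \<le> \<epsilon> * \<bar>t\<bar> powr ps"
    using controlled_small[OF controlled_G \<epsilon>] by metis
  define s where "s = min 1 (\<delta> / M)"
  have s: "0 < s" "s \<le> 1" "s * M \<le> \<delta>" using d(1) M(1) by (auto simp: s_def field_simps min_def)
  have "(\<Sum>\<^sub>\<infinity>x. G x (s * u x)) \<le> \<epsilon> * (\<Sum>\<^sub>\<infinity>x. \<bar>s * u x\<bar> powr ps)"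
  proof (rule infsum_le_small[OF controlled_G E_scale[OF u(1)]])
    fix x
    have "\<bar>s * u x\<bar> \<le> s * M" using s(1) M(2)[of x] by (simp add: abs_mult)
    then show "\<bar>G x (s * u x)\<bar> \<le> \<epsilon> * \<bar>s * u x\<bar> powr ps" using s(3) by (intro d(2)) linarith
  qed (use \<epsilon> in simp)
  also have "(\<Sum>\<^sub>\<infinity>x. \<bar>s * u x\<bar> powr ps) = s powr ps * ?A"
    using s(1) by (simp add: abs_mult powr_mult infsum_cmult_right')
  also have "\<epsilon> * (s powr ps * ?A) \<le> \<epsilon> * (s powr p * ?A)"
    using s ps_bounds \<epsilon> A by (intro mult_left_mono mult_right_mono powr_mono') auto
  also have "\<dots> = s powr p * (\<epsilon> * ?A)" by simp
  also have "\<dots> < s powr p * Q u" using \<epsilon>A s(1) by (intro mult_strict_left_mono) auto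
  finally have "0 < J (\<lambda>x. s * u x)" using s(1) by (simp add: J_def total_energy_scale)
  then show ?thesis using that s by blast
qed

lemma nehari_scaleI:
  assumes "u \<in> E" "u \<noteq> (\<lambda>_. 0)" "0 < s" "J (\<lambda>x. s * u x) = 0"
  shows "(\<lambda>x. s * u x) \<in> N"
  using assms E_scale[of u s] by (auto simp: mem_nehari fun_eq_iff)

text \<open>Intermediate value theorem on the ray, between a small factor and \<open>1\<close>. That the factor is at most \<open>1\<close>
matters, since \<open>H\<close> then does not increase.\<close>

lemma nehari_project_down:
  assumes u: "u \<in> E" "u \<noteq> (\<lambda>_. 0)" and J: "J u \<le> 0"
  obtains s where "0 < s" "s \<le> 1" "(\<lambda>x. s * u x) \<in> N"
proof -
  obtain s0 where s0: "0 < s0" "s0 \<le> 1" "0 < J (\<lambda>x. s0 * u x)" using J_ray_small[OF u] by metis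
  have "\<exists>s. s0 \<le> s \<and> s \<le> 1 \<and> J (\<lambda>x. s * u x) = 0"
    by (rule IVT2) (use s0 J J_ray_continuous[OF u(1)] in auto)
  then show ?thesis using that s0 nehari_scaleI[OF u] by (metis less_le_trans)
qed

text \<open>By superlinearity a single vertex \<open>y\<close> with \<open>u y \<noteq> 0\<close> outweighs the whole norm.\<close>

lemma energy_ray_negative:
  assumes u: "u \<in> E" "u \<noteq> (\<lambda>_. 0)"
  obtains R where "0 < R" "\<Phi> (\<lambda>x. R * u x) < 0"
proof -
  have Qu: "0 < Q u" by (rule Q_pos[OF u])
  obtain y where y: "u y \<noteq> 0" using u(2) by (auto simp: fun_eq_iff)
  define M where "M = 2 * Q u / \<bar>u y\<bar> powr p"
  obtain B where B: "\<And>t x. B \<le> \<bar>t\<bar> \<Longrightarrow> M \<le> F x t / \<bar>t\<bar> powr p"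
    using superlinear[of M] unfolding eventually_at_infinity by auto
  define R where "R = (\<bar>B\<bar> + 1) / \<bar>u y\<bar>"
  have R: "0 < R" using y by (simp add: R_def)
  have "\<bar>R * u y\<bar> = \<bar>B\<bar> + 1" using y by (simp add: R_def abs_mult)
  then have "M \<le> F y (R * u y) / \<bar>R * u y\<bar> powr p" by (intro B) linarith
  then have "M * \<bar>R * u y\<bar> powr p \<le> F y (R * u y)" using y R by (simp add: field_simps)
  moreover have "M * \<bar>R * u y\<bar> powr p = 2 * (R powr p * Q u)"
    using y R by (simp add: M_def abs_mult powr_mult field_simps)
  moreover have "F y (R * u y) \<le> (\<Sum>\<^sub>\<infinity>x. F x (R * u x))"
    using finite_sum_le_infsum[OF controlled_summable[OF controlled_F E_scale[OF u(1), of R]], of "{y}"] F_nonneg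
    by simp
  moreover have "R powr p * Q u / p \<le> R powr p * Q u" using R Qu p_gt_1 by (simp add: field_simps)
  moreover have "0 < R powr p * Q u" using R Qu by simp
  ultimately have "\<Phi> (\<lambda>x. R * u x) < 0"
    unfolding energy_eq[OF E_scale[OF u(1)]] total_energy_scale using R by simp
  then show ?thesis using that R by blast
qed

lemma nehari_project:
  assumes u: "u \<in> E" "u \<noteq> (\<lambda>_. 0)"
  obtains s where "0 < s" "(\<lambda>x. s * u x) \<in> N"
proof -
  obtain R where R: "0 < R" "\<Phi> (\<lambda>x. R * u x) < 0" using energy_ray_negative[OF u] by metis
  have v: "(\<lambda>x. R * u x) \<in> E" "(\<lambda>x. R * u x) \<noteq> (\<lambda>_. 0)" using E_scale[OF u(1)] R u(2) by (auto simp: fun_eq_iff)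
  have "p * \<Phi> (\<lambda>x. R * u x) \<le> 0" using R(2) p_gt_1 by (simp add: mult_le_0_iff)
  then have "J (\<lambda>x. R * u x) \<le> 0" using J_le_energy[OF v(1)] by linarith
  from nehari_project_down[OF v this] obtain s where s: "0 < s" "(\<lambda>x. s * (R * u x)) \<in> N" by metis
  then show ?thesis using that[of "s * R"] R(1) by (simp add: mult.assoc)
qed

lemma nehari_nonempty: "N \<noteq> {}"
proof -
  have "(\<lambda>x :: int ^ 'n. if x = 0 then 1 else 0) \<in> E" by (rule E_finite_support) simp
  moreover have "(\<lambda>x :: int ^ 'n. if x = 0 then 1 else 0) \<noteq> (\<lambda>_. 0 :: real)" by (metis zero_neq_one)
  ultimately show ?thesis using nehari_project by blast
qed

section \<open>A minimiser on the Nehari manifold\<close>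

definition ground_level :: real where "ground_level = (INF v\<in>N. \<Phi> v)"

lemma ground_level_le: "v \<in> N \<Longrightarrow> ground_level \<le> \<Phi> v"
  unfolding ground_level_def
  by (rule cINF_lower) (auto intro!: bdd_belowI[of _ 0] energy_nehari_nonneg)

text \<open>Let \<open>v\<close> be \<open>u\<close> normalised to \<open>Q v = 1\<close>. If \<open>v\<close> were uniformly small, the sum of \<open>F\<close> at \<open>s * v\<close> would be
at most \<open>1\<close>, and \<open>\<Phi> u \<ge> \<Phi> (s * v)\<close>, which is about \<open>s powr p / p\<close>, would exceed \<open>K\<close>. So \<open>v\<close> exceeds a
fixed \<open>\<eta>\<close> somewhere; if \<open>Q u\<close> were large, superlinearity at that vertex would make \<open>\<Phi> u\<close> negative.\<close>

lemma nehari_norm_bounded: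
  obtains B where "\<And>u. u \<in> N \<Longrightarrow> \<Phi> u \<le> K \<Longrightarrow> Q u \<le> B"
proof -
  \<comment> \<open>Chosen such that \<open>s powr p / p\<close> exceeds \<open>K\<close> by more than the bound \<open>1\<close> on the sum of \<open>F\<close>.\<close>
  define s where "s = (p * (\<bar>K\<bar> + 2)) powr (1 / p)"
  have s: "0 < s" "s powr p / p = \<bar>K\<bar> + 2" using p_gt_1 by (auto simp: s_def powr_powr)
  obtain A where A: "\<And>u. u \<in> E \<Longrightarrow> Q u \<le> 1 \<Longrightarrow> mass u \<le> A" using E_bounds[of 1] by metis
  define \<epsilon> where "\<epsilon> = 1 / (s powr ps * (\<bar>A\<bar> + 1))"
  have \<epsilon>: "0 < \<epsilon>" using s by (simp add: \<epsilon>_def add_nonneg_pos)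
  obtain \<delta> where d: "0 < \<delta>" "\<And>x t. \<bar>t\<bar> \<le> \<delta> \<Longrightarrow> \<bar>F x t\<bar> \<le> \<epsilon> * \<bar>t\<bar> powr ps"
    using controlled_small[OF controlled_F \<epsilon>] by metis
  define \<eta> where "\<eta> = \<delta> / s"
  have \<eta>: "0 < \<eta>" using d s by (simp add: \<eta>_def)
  obtain R where R: "\<And>t x. R \<le> \<bar>t\<bar> \<Longrightarrow> 1 / \<eta> powr p \<le> F x t / \<bar>t\<bar> powr p"
    using superlinear[of "1 / \<eta> powr p"] unfolding eventually_at_infinity by auto
  show ?thesis
  proof (rule that[of "(\<bar>R\<bar> / \<eta>) powr p"])
    fix u assume u: "u \<in> N" "\<Phi> u \<le> K"
    then have uE: "u \<in> E" and u0: "u \<noteq> (\<lambda>_. 0)" by (auto simp: mem_nehari)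
    have Qu: "0 < Q u" by (rule Q_pos[OF uE u0])
    define r where "r = Q u powr (1 / p)"
    have r: "0 < r" "r powr p = Q u" using Qu p_gt_1 by (auto simp: r_def powr_powr)
    define v where "v x = 1 / r * u x" for x
    have v: "v \<in> E" "Q v = 1"
    proof -
      show "v \<in> E" unfolding v_def[abs_def] by (rule E_scale[OF uE])
      show "Q v = 1" unfolding v_def[abs_def] total_energy_scale using r Qu by (simp add: powr_divide)
    qed
    have "\<exists>x. \<eta> < \<bar>v x\<bar>"
    proof (rule ccontr)
      assume "\<not> ?thesis"
      then have le: "\<bar>v x\<bar> \<le> \<eta>" for x by (meson not_less)
      have "(\<Sum>\<^sub>\<infinity>x. F x (s * v x)) \<le> \<epsilon> * (\<Sum>\<^sub>\<infinity>x. \<bar>s * v x\<bar> powr ps)"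
      proof (rule infsum_le_small[OF controlled_F E_scale[OF v(1)]])
        fix x
        have "\<bar>s * v x\<bar> \<le> s * \<eta>" using s(1) le[of x] by (simp add: abs_mult)
        also have "s * \<eta> = \<delta>" using s by (simp add: \<eta>_def)
        finally show "\<bar>F x (s * v x)\<bar> \<le> \<epsilon> * \<bar>s * v x\<bar> powr ps" by (rule d(2))
      qed (use \<epsilon> in simp)
      also have "(\<Sum>\<^sub>\<infinity>x. \<bar>s * v x\<bar> powr ps) = s powr ps * mass v"
        using s(1) by (simp add: abs_mult powr_mult infsum_cmult_right')
      also have "\<epsilon> * (s powr ps * mass v) \<le> \<epsilon> * (s powr ps * (\<bar>A\<bar> + 1))"
      proof -
        have "mass v \<le> \<bar>A\<bar> + 1" using A[OF v(1)] v(2) by simp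
        then show ?thesis using \<epsilon> by (intro mult_left_mono) auto
      qed
      also have "\<dots> = 1"
      proof -
        have "s powr ps * (\<bar>A\<bar> + 1) \<noteq> 0" using s(1) by (simp add: add_nonneg_eq_0_iff)
        then show ?thesis by (simp add: \<epsilon>_def)
      qed
      finally have "\<bar>K\<bar> + 2 - 1 \<le> \<Phi> (\<lambda>x. s * v x)"
        unfolding energy_eq[OF E_scale[OF v(1)]] total_energy_scale v(2) using s by simp
      also have "(\<lambda>x. s * v x) = (\<lambda>x. s / r * u x)" by (simp add: v_def fun_eq_iff)
      also have "\<Phi> (\<lambda>x. s / r * u x) \<le> \<Phi> u" by (rule energy_ray_le[OF u(1)]) (use s r in simp)
      finally show False using u(2) by linarith
    qed
    then obtain x where x: "\<eta> < \<bar>v x\<bar>" by blast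
    have ux: "\<eta> * r < \<bar>u x\<bar>" using x r(1) by (simp add: v_def abs_mult field_simps)
    have "\<eta> * r < \<bar>R\<bar>"
    proof (rule ccontr)
      assume "\<not> ?thesis"
      then have "1 / \<eta> powr p \<le> F x (u x) / \<bar>u x\<bar> powr p" using ux by (intro R) linarith
      moreover have "0 < \<eta> * r" using \<eta> r by simp
      ultimately have "\<bar>u x\<bar> powr p / \<eta> powr p \<le> F x (u x)" using ux \<eta> by (simp add: field_simps)
      moreover have "(\<eta> * r) powr p \<le> \<bar>u x\<bar> powr p" using ux p_gt_1 \<eta> r by (intro powr_mono2) auto
      then have "Q u \<le> \<bar>u x\<bar> powr p / \<eta> powr p" using \<eta> r by (simp add: powr_mult field_simps)
      moreover have "F x (u x) \<le> (\<Sum>\<^sub>\<infinity>x. F x (u x))"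
        using finite_sum_le_infsum[OF controlled_summable[OF controlled_F uE], of "{x}"] F_nonneg by simp
      moreover have "Q u / p < Q u" using Qu p_gt_1 by (simp add: field_simps)
      ultimately have "\<Phi> u < 0" unfolding energy_eq[OF uE] by linarith
      then show False using energy_nehari_nonneg[OF u(1)] by simp
    qed
    then have "r \<le> \<bar>R\<bar> / \<eta>" using \<eta> by (simp add: field_simps)
    then show "Q u \<le> (\<bar>R\<bar> / \<eta>) powr p" unfolding r(2)[symmetric] using r(1) p_gt_1 by (intro powr_mono2) auto
  qed
qed

text \<open>If \<open>u\<close> were uniformly small, then the sum of \<open>G\<close> would be at most \<open>\<epsilon>\<close> times the sum of
\<open>\<bar>u x\<bar> powr ps\<close>, hence by Sobolev less than \<open>Q u\<close>, contradicting \<open>J u = 0\<close>.\<close>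

lemma nehari_nonvanishing:
  obtains \<delta> where "0 < \<delta>" "\<And>u. u \<in> N \<Longrightarrow> Q u \<le> B \<Longrightarrow> \<exists>x. \<delta> < \<bar>u x\<bar>"
proof -
  obtain S where S: "S > 0" "\<And>u. u \<in> E \<Longrightarrow> mass u \<le> S * Q u powr (ps / p)"
    using Sobolev by metis
  define D where "D = S * \<bar>B\<bar> powr (ps / p - 1)"
  have D: "0 \<le> D" using S by (simp add: D_def)
  define \<epsilon> where "\<epsilon> = 1 / (D + 1)"
  have \<epsilon>: "0 < \<epsilon>" "\<epsilon> * D < 1" using D by (auto simp: \<epsilon>_def field_simps)
  obtain \<delta> where d: "0 < \<delta>" "\<And>x t. \<bar>t\<bar> \<le> \<delta> \<Longrightarrow> \<bar>G x t\<bar> \<le> \<epsilon> * \<bar>t\<bar> powr ps"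
    using controlled_small[OF controlled_G \<epsilon>(1)] by metis
  show ?thesis
  proof (rule that[OF d(1)], rule ccontr)
    fix u assume u: "u \<in> N" "Q u \<le> B" and H: "\<not> (\<exists>x. \<delta> < \<bar>u x\<bar>)"
    have uE: "u \<in> E" and u0: "u \<noteq> (\<lambda>_. 0)" and J: "J u = 0" using u by (auto simp: mem_nehari)
    have Qu: "0 < Q u" by (rule Q_pos[OF uE u0])
    have "Q u = (\<Sum>\<^sub>\<infinity>x. G x (u x))" using J by (simp add: J_def)
    also have "\<dots> \<le> \<epsilon> * mass u"
      using H \<epsilon> by (intro infsum_le_small[OF controlled_G uE] d(2)) (auto simp: not_less)
    also have "\<dots> \<le> \<epsilon> * (S * Q u powr (ps / p))" using S(2)[OF uE] \<epsilon> by (intro mult_left_mono) auto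
    also have "Q u powr (ps / p) = Q u powr (ps / p - 1) * Q u" using Qu by (simp add: powr_diff)
    also have "\<epsilon> * (S * (Q u powr (ps / p - 1) * Q u)) \<le> \<epsilon> * (S * (\<bar>B\<bar> powr (ps / p - 1) * Q u))"
      using u(2) Qu \<epsilon> S(1) ps_bounds p_gt_1 by (intro mult_left_mono mult_right_mono powr_mono2) (auto simp: field_simps)
    also have "\<dots> = (\<epsilon> * D) * Q u" by (simp add: D_def)
    also have "\<dots> < 1 * Q u" using \<epsilon> Qu by (intro mult_strict_right_mono)
    finally show False by simp
  qed
qed

lemma infsum_translate:
  assumes h: "periodic T h"
  shows "(\<Sum>\<^sub>\<infinity>x. h x (u (x + (\<chi> i. int T * k $ i)))) = (\<Sum>\<^sub>\<infinity>x. h x (u x) :: real)"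
proof -
  let ?z = "\<chi> i. int T * k $ i"
  have b: "bij_betw (\<lambda>x. x + ?z) UNIV UNIV" by (rule bij_betwI[where g = "\<lambda>x. x - ?z"]) auto
  have "(\<Sum>\<^sub>\<infinity>x. h x (u (x + ?z))) = (\<Sum>\<^sub>\<infinity>x. h (x + ?z) (u (x + ?z)))"
    by (simp add: periodic_shift[OF h])
  also have "\<dots> = (\<Sum>\<^sub>\<infinity>x. h x (u x))" using infsum_reindex_bij_betw[OF b, of "\<lambda>x. h x (u x)"] by simp
  finally show ?thesis .
qed

lemma nehari_translate:
  fixes k :: "int ^ 'n"
  assumes u: "u \<in> N"
  defines "v \<equiv> \<lambda>x. u (x + (\<chi> i. int T * k $ i))"
  shows "v \<in> N" "\<Phi> v = \<Phi> u"
proof -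
  have uE: "u \<in> E" and u0: "u \<noteq> (\<lambda>_. 0)" and J: "J u = 0" using u by (auto simp: mem_nehari)
  have vE: "v \<in> E" and Qv: "Q v = Q u"
    unfolding v_def using E_translate[OF periodic_shift[OF V_periodic] uE] by auto
  obtain y where y: "u y \<noteq> 0" using u0 by (auto simp: fun_eq_iff)
  then have "v (y - (\<chi> i. int T * k $ i)) \<noteq> 0" by (simp add: v_def)
  then have "v \<noteq> (\<lambda>_. 0)" by auto
  moreover have "J v = 0" using J Qv infsum_translate[OF G_periodic, of u k] by (simp add: J_def v_def)
  ultimately show "v \<in> N" using vE by (simp add: mem_nehari)
  show "\<Phi> v = \<Phi> u"
    using infsum_translate[OF F_periodic, of u k] Qv energy_eq[OF vE] energy_eq[OF uE] by (simp add: v_def)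
qed

lemma infsum_H_ray_le:
  assumes u: "u \<in> E" and s: "0 < s" "s \<le> 1" and N: "(\<lambda>x. s * u x) \<in> N"
  shows "\<Phi> (\<lambda>x. s * u x) \<le> (\<Sum>\<^sub>\<infinity>x. H x (u x))"
  unfolding energy_nehari[OF N]
  by (intro infsum_mono controlled_summable[OF controlled_H] u E_scale H_mono s)

text \<open>Concentration compactness in two steps. The weak limit \<open>w\<close> of a translated minimising sequence
and the remainders \<open>y n\<close> share \<open>J = 0\<close> and the level between them. If \<open>J w > 0\<close>, the remainders have
\<open>J < 0\<close>, and a competitor below the ground level arises from them; otherwise one arises from \<open>w\<close>
at or below the ground level.\<close>

theorem ground_level_attained: "\<exists>u\<in>N. \<Phi> u = ground_level"
proof -
  let ?c = ground_level
  have bdd: "bdd_below (\<Phi> ` N)" by (auto intro!: bdd_belowI[of _ 0] energy_nehari_nonneg)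
  have "\<exists>v\<in>N. \<Phi> v < ?c + 1 / real (Suc n)" for n
  proof -
    have "(INF v\<in>N. \<Phi> v) < ?c + 1 / real (Suc n)" unfolding ground_level_def by simp
    then show ?thesis unfolding cINF_less_iff[OF nehari_nonempty bdd] .
  qed
  then obtain u where u: "\<And>n. u n \<in> N" "\<And>n. \<Phi> (u n) < ?c + 1 / real (Suc n)" by metis
  obtain B where B: "\<And>u. u \<in> N \<Longrightarrow> \<Phi> u \<le> ?c + 1 \<Longrightarrow> Q u \<le> B" using nehari_norm_bounded by metis
  have uB: "\<Phi> v \<le> ?c + 1" if "\<Phi> v < ?c + 1 / real (Suc n)" for v n
  proof -
    have "1 / real (Suc n) \<le> 1" by simp
    then show ?thesis using that by linarith
  qed
  obtain \<delta> where d: "0 < \<delta>" "\<And>u. u \<in> N \<Longrightarrow> Q u \<le> B \<Longrightarrow> \<exists>x. \<delta> < \<bar>u x\<bar>"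
    using nehari_nonvanishing by metis
  define box where "box = {z :: int ^ 'n. \<forall>i. z $ i \<in> {0..<int T}}"
  have "\<exists>v z. v \<in> N \<and> \<Phi> v < ?c + 1 / real (Suc n) \<and> z \<in> box \<and> \<delta> < \<bar>v z\<bar>" for n
  proof -
    obtain x where x: "\<delta> < \<bar>u n x\<bar>" using d(2)[OF u(1)] B[OF u(1) uB[OF u(2)]] by blast
    obtain z k where zk: "z \<in> box" "x = z + (\<chi> i. int T * k $ i)" using box_representative[OF T_pos, of x]
      by (auto simp: box_def)
    note tr = nehari_translate[OF u(1)[of n], of k]
    show ?thesis
    proof (intro exI conjI)
      show "(\<lambda>x. u n (x + (\<chi> i. int T * k $ i))) \<in> N" by (rule tr(1))
      show "\<Phi> (\<lambda>x. u n (x + (\<chi> i. int T * k $ i))) < ?c + 1 / real (Suc n)" unfolding tr(2) by (rule u(2))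
      show "z \<in> box" by (rule zk(1))
      show "\<delta> < \<bar>u n (z + (\<chi> i. int T * k $ i))\<bar>" using x unfolding zk(2) .
    qed
  qed
  then have "\<forall>n. \<exists>vz. fst vz \<in> N \<and> \<Phi> (fst vz) < ?c + 1 / real (Suc n) \<and> snd vz \<in> box \<and> \<delta> < \<bar>fst vz (snd vz)\<bar>"
    by (simp add: split_paired_Ex)
  from choice[OF this] obtain vz where vz: "\<And>n. fst (vz n) \<in> N \<and> \<Phi> (fst (vz n)) < ?c + 1 / real (Suc n) \<and>
      snd (vz n) \<in> box \<and> \<delta> < \<bar>fst (vz n) (snd (vz n))\<bar>" by blast
  define v where "v n = fst (vz n)" for n
  define z where "z n = snd (vz n)" for n
  have v: "v n \<in> N" "\<Phi> (v n) < ?c + 1 / real (Suc n)" and z: "z n \<in> box" "\<delta> < \<bar>v n (z n)\<bar>" for n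
    using vz[of n] by (simp_all add: v_def z_def)
  have vE: "v n \<in> E" and vJ: "J (v n) = 0" for n using v(1) by (auto simp: mem_nehari)
  have vB: "Q (v n) \<le> B" for n using B[OF v(1) uB[OF v(2)]] .
  obtain M where M: "\<And>u x. u \<in> E \<Longrightarrow> Q u \<le> B \<Longrightarrow> \<bar>u x\<bar> \<le> M" using E_bounds[of B] by metis
  have "norm (v n x) \<le> M" for n x using M[OF vE vB] by simp
  then obtain k where k: "strict_mono (k :: nat \<Rightarrow> nat)" "\<And>x. x \<in> UNIV \<Longrightarrow> \<exists>l. (\<lambda>n. v (k n) x) \<longlonglongrightarrow> l"
    using function_convergent_subsequence[of "UNIV :: (int ^ 'n) set" v M] countableI_type by blast
  have "\<forall>x. \<exists>l. (\<lambda>n. v (k n) x) \<longlonglongrightarrow> l" using k(2) by simp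
  from choice[OF this] obtain w where w: "\<And>x. (\<lambda>n. v (k n) x) \<longlonglongrightarrow> w x" by blast
  have wE: "w \<in> E" by (rule E_limit[OF vE vB w])
  have w0: "w \<noteq> (\<lambda>_. 0)"
  proof
    assume "w = (\<lambda>_. 0)"
    then have w_0: "(\<lambda>n. v (k n) x) \<longlonglongrightarrow> 0" for x using w[of x] by simp
    have "\<forall>\<^sub>F n in sequentially. \<bar>v (k n) x\<bar> < \<delta>" for x
      by (rule order_tendstoD(2)[OF tendsto_rabs[OF w_0]]) (use d(1) in simp)
    moreover have "finite box" unfolding box_def by (rule card_lattice_box) simp
    ultimately have "\<forall>\<^sub>F n in sequentially. \<forall>x\<in>box. \<bar>v (k n) x\<bar> < \<delta>" by (simp add: eventually_ball_finite)
    then obtain n where "\<forall>x\<in>box. \<bar>v (k n) x\<bar> < \<delta>" by (auto simp: eventually_sequentially)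
    then show False using z(1)[of "k n"] z(2)[of "k n"] by (meson less_asym)
  qed
  define y where "y n x = v (k n) x - w x" for n x
  have yE: "y n \<in> E" for n unfolding y_def[abs_def] by (rule E_diff[OF vE wE])
  have y0: "(\<lambda>n. y n x) \<longlonglongrightarrow> 0" for x unfolding y_def using w by (simp add: LIM_zero_iff)
  have yB: "Q (y n) \<le> 2 powr p * (B + Q w)" for n
  proof -
    have "Q (y n) \<le> 2 powr p * (Q (v (k n)) + Q w)"
      unfolding y_def[abs_def] by (intro Q_diff_le energy_spaceD vE wE)
    also have "\<dots> \<le> 2 powr p * (B + Q w)" using vB by (intro mult_left_mono) auto
    finally show ?thesis .
  qed
  have vy: "(\<lambda>x. w x + y n x) = v (k n)" for n by (simp add: y_def fun_eq_iff)
  have wy: "w x + y n x = v (k n) x" for n x by (simp add: y_def)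
  note BL_h = controlled_Brezis_Lieb[OF _ wE yE yB y0, unfolded wy]
  have limJ: "(\<lambda>n. J (y n)) \<longlonglongrightarrow> - J w"
  proof -
    have "(\<lambda>n. Q (v (k n)) - Q (y n)) \<longlonglongrightarrow> Q w"
      using Q_Brezis_Lieb[OF wE yE yB y0] unfolding vy .
    from tendsto_diff[OF BL_h[OF controlled_G] this]
    have "(\<lambda>n. J (y n) - J (v (k n))) \<longlonglongrightarrow> - J w" by (simp add: J_def algebra_simps)
    then show ?thesis by (simp add: vJ)
  qed
  have limH: "(\<lambda>n. (\<Sum>\<^sub>\<infinity>x. H x (v (k n) x)) - (\<Sum>\<^sub>\<infinity>x. H x (y n x))) \<longlonglongrightarrow> (\<Sum>\<^sub>\<infinity>x. H x (w x))"
    by (rule BL_h[OF controlled_H])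
  have limv: "(\<lambda>n. (\<Sum>\<^sub>\<infinity>x. H x (v (k n) x))) \<longlonglongrightarrow> ?c"
  proof -
    have "(\<lambda>n. \<Phi> (v n)) \<longlonglongrightarrow> ?c"
    proof (rule tendsto_sandwich[of "\<lambda>_. ?c" _ _ "\<lambda>n. ?c + 1 / real (Suc n)"])
      have "(\<lambda>n. ?c + inverse (real (Suc n))) \<longlonglongrightarrow> ?c + 0"
        by (intro tendsto_add tendsto_const LIMSEQ_inverse_real_of_nat)
      then show "(\<lambda>n. ?c + 1 / real (Suc n)) \<longlonglongrightarrow> ?c" by (simp add: inverse_eq_divide)
    qed (use ground_level_le v in \<open>auto intro!: always_eventually less_imp_le\<close>)
    from LIMSEQ_subseq_LIMSEQ[OF this k(1)] show ?thesis by (simp add: o_def energy_nehari[OF v(1)])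
  qed
  have limy: "(\<lambda>n. (\<Sum>\<^sub>\<infinity>x. H x (y n x))) \<longlonglongrightarrow> ?c - (\<Sum>\<^sub>\<infinity>x. H x (w x))"
    using tendsto_diff[OF limv limH] by simp
  have Jw: "J w \<le> 0"
  proof (rule ccontr)
    assume "\<not> ?thesis"
    then have "\<forall>\<^sub>F n in sequentially. J (y n) < 0" using order_tendstoD(2)[OF limJ, of 0] by simp
    then have "\<forall>\<^sub>F n in sequentially. ?c \<le> (\<Sum>\<^sub>\<infinity>x. H x (y n x))"
    proof eventually_elim
      case (elim n)
      then have "y n \<noteq> (\<lambda>_. 0)" using J_zero by auto
      then obtain s where s: "0 < s" "s \<le> 1" "(\<lambda>x. s * y n x) \<in> N"
        using nehari_project_down[OF yE] elim by (metis less_imp_le)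
      show ?case using infsum_H_ray_le[OF yE s] ground_level_le[OF s(3)] by linarith
    qed
    then have "?c \<le> ?c - (\<Sum>\<^sub>\<infinity>x. H x (w x))"
      by (intro tendsto_lowerbound[OF limy]) auto
    moreover obtain x where "w x \<noteq> 0" using w0 by (auto simp: fun_eq_iff)
    then have "0 < H x (w x)" by (rule H_pos)
    then have "0 < (\<Sum>\<^sub>\<infinity>x. H x (w x))"
      using finite_sum_le_infsum[OF controlled_summable[OF controlled_H wE], of "{x}"] H_nonneg by simp
    ultimately show False by linarith
  qed
  obtain s where s: "0 < s" "s \<le> 1" "(\<lambda>x. s * w x) \<in> N" using nehari_project_down[OF wE w0 Jw] by metis
  have "0 \<le> ?c - (\<Sum>\<^sub>\<infinity>x. H x (w x))"
    by (rule tendsto_lowerbound[OF limy]) (auto intro!: always_eventually infsum_nonneg H_nonneg)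
  then have "\<Phi> (\<lambda>x. s * w x) \<le> ?c" using infsum_H_ray_le[OF wE s] by linarith
  then show ?thesis using ground_level_le[OF s(3)] s(3) by force
qed

section \<open>Ground states are solutions\<close>

text \<open>The difference of the two sides of the equation at \<open>y\<close>, with the value of \<open>u\<close> at \<open>y\<close> replaced by \<open>r\<close>.\<close>

definition site_deriv :: "(int ^ 'n \<Rightarrow> real) \<Rightarrow> int ^ 'n \<Rightarrow> real \<Rightarrow> real" where
  "site_deriv u y r = (\<Sum>z | adj y z. \<bar>r - u z\<bar> powr (p - 2) * (r - u z))
     + V y * (\<bar>r\<bar> powr (p - 2) * r) - f y r"

lemma site_energy_deriv:
  "((\<lambda>r. site_energy u y r / p - F y r) has_real_derivative site_deriv u y r) (at r)"
proof -
  have 1: "((\<lambda>r. \<bar>u z - r\<bar> powr p) has_real_derivative p * (\<bar>r - u z\<bar> powr (p - 2) * (r - u z))) (at r)" for z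
  proof -
    have "((\<lambda>r. \<bar>r - u z\<bar> powr p) has_real_derivative p * (\<bar>r - u z\<bar> powr (p - 2) * (r - u z)) * 1) (at r)"
      by (rule DERIV_chain2[OF has_real_derivative_abs_powr[OF p_gt_1]]) (auto intro!: derivative_eq_intros)
    then show ?thesis by (simp add: abs_minus_commute)
  qed
  have "((\<lambda>r. ((\<Sum>z | adj y z. \<bar>u z - r\<bar> powr p) + V y * \<bar>r\<bar> powr p) / p - F y r) has_real_derivative
     ((\<Sum>z | adj y z. p * (\<bar>r - u z\<bar> powr (p - 2) * (r - u z))) + V y * (p * (\<bar>r\<bar> powr (p - 2) * r))) / p - f y r) (at r)"
    by (intro DERIV_diff DERIV_cdivide DERIV_add DERIV_sum DERIV_cmult 1 F_deriv
        has_real_derivative_abs_powr p_gt_1)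
  then show ?thesis using p_gt_1
    by (simp add: site_energy_def site_deriv_def sum_distrib_left[symmetric] add_divide_distrib)
qed

lemma energy_update:
  assumes u: "u \<in> E"
  shows "\<Phi> (u(y := r)) = \<Phi> u + (site_energy u y r / p - F y r) - (site_energy u y (u y) / p - F y (u y))"
  unfolding energy_eq[OF u] energy_eq[OF E_update[OF u]] Q_update[OF u] infsum_update[OF controlled_F u]
  by (simp add: field_simps add_divide_distrib diff_divide_distrib)

lemma J_update:
  assumes u: "u \<in> E"
  shows "J (u(y := r)) = J u + (site_energy u y r - G y r) - (site_energy u y (u y) - G y (u y))"
  unfolding J_def Q_update[OF u] infsum_update[OF controlled_G u] by simp

lemma site_deriv_continuous: "isCont (\<lambda>(s, r). site_deriv (\<lambda>x. s * u x) y r) z"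
proof -
  have f: "isCont (f y) r" for r using f_continuous by (simp add: continuous_on_eq_continuous_at)
  have 1: "isCont (\<lambda>z. \<bar>g z\<bar> powr (p - 2) * g z) z" if "isCont g z" for g :: "real \<times> real \<Rightarrow> real" and z
    using isCont_o2[OF that isCont_abs_powr_minus2[OF p_gt_1]] .
  show ?thesis
    unfolding site_deriv_def case_prod_beta
    by (intro continuous_intros 1 isCont_o2[OF _ f])
qed

lemma site_energy_G_continuous: "isCont (\<lambda>r. site_energy u y r - G y r) r"
proof -
  have "isCont (G y) r" using G_continuous by (simp add: continuous_on_eq_continuous_at)
  then show ?thesis unfolding site_energy_def using p_gt_1
    by (intro continuous_intros) auto
qed

text \<open>Let \<open>w t\<close> be \<open>u\<close> with its value at \<open>y\<close> moved by \<open>t\<close> against the derivative. As \<open>J (s * u)\<close> is positive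
for \<open>s < 1\<close> and negative for \<open>s > 1\<close>, for small \<open>t\<close> some \<open>s\<close> near \<open>1\<close> brings \<open>w t\<close> back to the Nehari
manifold. There \<open>\<Phi> (s * w t) < \<Phi> (s * u) \<le> \<Phi> u\<close>: the first inequality because the derivative at \<open>y\<close>
keeps its sign nearby, the second because \<open>u\<close> maximises \<open>\<Phi>\<close> on its ray.\<close>

lemma ground_state_critical:
  assumes u: "u \<in> N" and min: "\<Phi> u = ground_level"
  shows "site_deriv u y (u y) = 0"
proof (rule ccontr)
  assume nz: "site_deriv u y (u y) \<noteq> 0"
  have uE: "u \<in> E" using u by (simp add: mem_nehari)
  define \<sigma> where "\<sigma> = sgn (site_deriv u y (u y))"
  have \<sigma>: "\<sigma> * site_deriv u y (u y) > 0" "\<bar>\<sigma>\<bar> = 1" using nz by (auto simp: \<sigma>_def sgn_if)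
  let ?D = "\<lambda>s r. site_deriv (\<lambda>x. s * u x) y r"
  have "isCont (\<lambda>z. \<sigma> * (\<lambda>(s, r). ?D s r) z) (1, u y)"
    by (intro continuous_intros site_deriv_continuous)
  then have "\<forall>\<^sub>F z in nhds (1, u y). \<sigma> * (\<lambda>(s, r). ?D s r) z > 0"
    using \<sigma>(1) by (intro order_tendstoD) (auto simp: isCont_def tendsto_nhds_iff)
  then obtain \<eta>0 where \<eta>0: "\<eta>0 > 0" "\<And>s r. dist (s, r) (1, u y) < \<eta>0 \<Longrightarrow> \<sigma> * ?D s r > 0"
    unfolding eventually_nhds_metric by auto
  \<comment> \<open>For \<open>s\<close> within \<open>\<eta>\<close> of 1 and \<open>r\<close> within \<open>\<eta>0 / 4\<close> of \<open>s * u y\<close>, the pair \<open>(s, r)\<close> stays in the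
    \<open>\<eta>0\<close>-ball around \<open>(1, u y)\<close>.\<close>
  define \<eta> where "\<eta> = min (1 / 2) (\<eta>0 / (4 * (\<bar>u y\<bar> + 1)))"
  have \<eta>: "0 < \<eta>" "\<eta> \<le> 1 / 2" using \<eta>0(1) unfolding \<eta>_def by (simp add: add_nonneg_pos, intro min.cobounded1)
  have \<eta>u: "\<eta> * (\<bar>u y\<bar> + 1) \<le> \<eta>0 / 4"
  proof -
    have "\<eta> * (\<bar>u y\<bar> + 1) \<le> \<eta>0 / (4 * (\<bar>u y\<bar> + 1)) * (\<bar>u y\<bar> + 1)"
      by (intro mult_right_mono) (auto simp: \<eta>_def)
    also have "\<dots> = \<eta>0 / 4" by (simp add: field_simps)
    finally show ?thesis .
  qed
  have Dpos: "\<sigma> * ?D s r > 0" if s: "\<bar>s - 1\<bar> \<le> \<eta>" and r: "\<bar>r - s * u y\<bar> \<le> \<eta>0 / 4" for s r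
  proof (rule \<eta>0(2))
    have "\<bar>s - 1\<bar> * \<bar>u y\<bar> \<le> \<eta> * (\<bar>u y\<bar> + 1)" using s \<eta> by (intro mult_mono) auto
    moreover have "\<bar>s * u y - u y\<bar> = \<bar>s - 1\<bar> * \<bar>u y\<bar>" by (simp add: abs_mult[symmetric] algebra_simps)
    ultimately have "\<bar>r - u y\<bar> \<le> \<eta>0 / 2" using \<eta>u r by linarith
    moreover have "\<eta> * 1 \<le> \<eta> * (\<bar>u y\<bar> + 1)" using \<eta> by (intro mult_left_mono) auto
    then have "\<bar>s - 1\<bar> \<le> \<eta>0 / 4" using s \<eta>u by linarith
    moreover have "dist (s, r) (1, u y) \<le> \<bar>s - 1\<bar> + \<bar>r - u y\<bar>"
      unfolding dist_Pair_Pair dist_real_def using sqrt_sum_squares_le_sum_abs[of "\<bar>s - 1\<bar>" "\<bar>r - u y\<bar>"] by simp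
    ultimately show "dist (s, r) (1, u y) < \<eta>0" using \<eta>0(1) by linarith
  qed
  define w where "w t = u(y := u y - \<sigma> * t)" for t
  have wE: "w t \<in> E" for t unfolding w_def by (rule E_update[OF uE])
  have sw: "(\<lambda>x. s * w t x) = (\<lambda>x. s * u x)(y := s * u y - \<sigma> * s * t)" for s t
    by (auto simp: w_def fun_eq_iff algebra_simps)
  have Jlim: "((\<lambda>t. J (\<lambda>x. s * w t x)) \<longlongrightarrow> J (\<lambda>x. s * u x)) (at_right 0)" for s
  proof -
    let ?g = "\<lambda>r. site_energy (\<lambda>x. s * u x) y r - G y r"
    have "((\<lambda>t. ?g (s * u y - \<sigma> * s * t)) \<longlongrightarrow> ?g (s * u y - \<sigma> * s * 0)) (at_right 0)"
      by (rule isCont_tendsto_compose[OF site_energy_G_continuous]) (intro tendsto_intros)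
    from tendsto_diff[OF tendsto_add[OF tendsto_const this] tendsto_const]
    have "((\<lambda>t. J (\<lambda>x. s * u x) + ?g (s * u y - \<sigma> * s * t) - ?g (s * u y)) \<longlongrightarrow>
       J (\<lambda>x. s * u x) + ?g (s * u y - \<sigma> * s * 0) - ?g (s * u y)) (at_right 0)"
      .
    then show ?thesis unfolding sw J_update[OF E_scale[OF uE]] by simp
  qed
  have "\<forall>\<^sub>F t in at_right 0. 0 < J (\<lambda>x. (1 - \<eta>) * w t x) \<and> J (\<lambda>x. (1 + \<eta>) * w t x) < 0 \<and> 0 < t \<and> t < \<eta>0 / 8"
  proof (intro eventually_conj)
    show "\<forall>\<^sub>F t in at_right 0. 0 < J (\<lambda>x. (1 - \<eta>) * w t x)"
      by (rule order_tendstoD(1)[OF Jlim J_ray_strict(1)[OF u]]) (use \<eta> in auto)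
    show "\<forall>\<^sub>F t in at_right 0. J (\<lambda>x. (1 + \<eta>) * w t x) < 0"
      by (rule order_tendstoD(2)[OF Jlim J_ray_strict(2)[OF u]]) (use \<eta> in auto)
    show "\<forall>\<^sub>F t in at_right 0. t < \<eta>0 / 8"
      by (rule eventually_at_rightI[of 0 "\<eta>0 / 8"]) (use \<eta>0(1) in auto)
  qed (rule eventually_at_right_less)
  then obtain t where t: "0 < J (\<lambda>x. (1 - \<eta>) * w t x)" "J (\<lambda>x. (1 + \<eta>) * w t x) < 0" "0 < t" "t < \<eta>0 / 8"
    using eventually_happens'[OF trivial_limit_at_right_real] by blast
  have w0: "w t \<noteq> (\<lambda>_. 0)" using t(1) J_zero by auto
  have "\<exists>s. 1 - \<eta> \<le> s \<and> s \<le> 1 + \<eta> \<and> J (\<lambda>x. s * w t x) = 0"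
    by (rule IVT2) (use t \<eta> J_ray_continuous[OF wE] in auto)
  then obtain s where s': "1 - \<eta> \<le> s" "s \<le> 1 + \<eta>" "J (\<lambda>x. s * w t x) = 0" by blast
  then have s: "\<bar>s - 1\<bar> \<le> \<eta>" "J (\<lambda>x. s * w t x) = 0" by (simp_all add: abs_le_iff)
  have s0: "0 < s" "s \<le> 2" using s(1) \<eta> by auto
  have "(\<lambda>x. s * w t x) \<in> N" by (rule nehari_scaleI[OF wE w0 s0(1) s(2)])
  then have "ground_level \<le> \<Phi> (\<lambda>x. s * w t x)" by (rule ground_level_le)
  moreover have "\<Phi> (\<lambda>x. s * w t x) < \<Phi> (\<lambda>x. s * u x)"
  proof -
    let ?S = "\<lambda>r. site_energy (\<lambda>x. s * u x) y r / p - F y r"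
    let ?r0 = "s * u y" and ?r1 = "s * u y - \<sigma> * s * t"
    have st: "0 < s * t" "s * t \<le> \<eta>0 / 4"
      using s0 t mult_mono[of s 2 t "\<eta>0 / 8"] by auto
    let ?g = "\<lambda>\<tau>. ?S (s * u y - \<sigma> * \<tau>)"
    have "?g (s * t) < ?g 0"
    proof (rule DERIV_neg_imp_decreasing[of 0 "s * t" ?g])
      fix \<tau> assume \<tau>: "0 \<le> \<tau>" "\<tau> \<le> s * t"
      have "DERIV ?g \<tau> :> ?D s (s * u y - \<sigma> * \<tau>) * (0 - \<sigma> * 1)"
        by (rule DERIV_chain2[OF site_energy_deriv]) (intro derivative_intros DERIV_cmult DERIV_ident)
      moreover have "0 < \<sigma> * ?D s (s * u y - \<sigma> * \<tau>)"
        by (rule Dpos[OF s(1)]) (use \<tau> st \<sigma>(2) in \<open>simp add: abs_mult\<close>)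
      ultimately show "\<exists>y'. DERIV ?g \<tau> :> y' \<and> y' < 0" by (intro exI conjI) (auto simp: mult.commute)
    qed (rule st)
    then have "?S ?r1 < ?S ?r0" by (simp add: mult.assoc)
    then show ?thesis unfolding sw energy_update[OF E_scale[OF uE]] by simp
  qed
  moreover have "\<Phi> (\<lambda>x. s * u x) \<le> \<Phi> u" by (rule energy_ray_le[OF u s0(1)])
  ultimately show False using min by linarith
qed

lemma site_deriv_eq:
  "site_deriv u y (u y) = - p_laplacian p u y + V y * \<bar>u y\<bar> powr (p - 2) * u y - f y (u y)"
proof -
  have "(\<Sum>z | adj y z. \<bar>u y - u z\<bar> powr (p - 2) * (u y - u z))
      = (\<Sum>z | adj y z. - (\<bar>u z - u y\<bar> powr (p - 2) * (u z - u y)))"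
    by (intro sum.cong refl) (simp add: abs_minus_commute[of "u y"] algebra_simps)
  then show ?thesis by (simp add: site_deriv_def p_laplacian_def sum_negf mult.assoc)
qed

lemma ground_state_solution:
  assumes "u \<in> N" "\<Phi> u = ground_level" shows "is_solution p V f u"
  using ground_state_critical[OF assms] assms(1)
  by (simp add: is_solution_def mem_nehari site_deriv_eq)

section \<open>Ground states have a sign\<close>

text \<open>At a zero of \<open>v\<close> the equation says that the sum of \<open>v z powr (p - 1)\<close> over the neighbours \<open>z\<close> vanishes, so
zeros propagate along edges.\<close>

lemma strong_maximum_principle:
  assumes v: "\<And>x. 0 \<le> v x" and crit: "\<And>y. site_deriv v y (v y) = 0" and nz: "v \<noteq> (\<lambda>_. 0)"
  shows "0 < v x"
proof (rule ccontr)
  assume "\<not> 0 < v x"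
  then have x: "v x = 0" using v[of x] by linarith
  have "v z = 0" if y: "v y = 0" and yz: "adj y z" for y z
  proof -
    have "(\<Sum>z | adj y z. v z powr (p - 2) * v z) = 0"
      using crit[of y] v by (simp add: site_deriv_def y f_0 sum_negf)
    then have "v z powr (p - 2) * v z = 0"
      using v yz finite_adj[of y] by (subst (asm) sum_nonneg_eq_0_iff) auto
    then show ?thesis by auto
  qed
  then have "v y = 0" for y using adj_connected[of "\<lambda>y. v y = 0" x y] x by blast
  then show False using nz by auto
qed

text \<open>Let \<open>s * \<bar>u\<bar>\<close> lie on the Nehari manifold. Then \<open>\<Phi> (s * \<bar>u\<bar>) \<le> \<Phi> (s * u) \<le> \<Phi> u\<close>, so equality holds
throughout. Hence \<open>s * \<bar>u\<bar>\<close> is a ground state, to which the maximum principle applies, and passing from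
\<open>u\<close> to \<open>\<bar>u\<bar>\<close> loses no energy.\<close>

lemma ground_state_signed:
  assumes F: "\<And>x t. F x t \<le> F x \<bar>t\<bar>" and u: "u \<in> N" and min: "\<Phi> u = ground_level"
  shows "(\<forall>x. 0 < u x) \<or> (\<forall>x. u x < 0)"
proof -
  have uE: "u \<in> E" and u0: "u \<noteq> (\<lambda>_. 0)" using u by (auto simp: mem_nehari)
  have aE: "(\<lambda>x. \<bar>u x\<bar>) \<in> E" and aQ: "Q (\<lambda>x. \<bar>u x\<bar>) \<le> Q u"
    using E_lipschitz[OF uE, of abs] by auto
  have a0: "(\<lambda>x. \<bar>u x\<bar>) \<noteq> (\<lambda>_. 0)" using u0 by (auto simp: fun_eq_iff)
  obtain s where s: "0 < s" "(\<lambda>x. s * \<bar>u x\<bar>) \<in> N" using nehari_project[OF aE a0] by metis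
  have sumF: "(\<Sum>\<^sub>\<infinity>x. F x (s * u x)) \<le> (\<Sum>\<^sub>\<infinity>x. F x (s * \<bar>u x\<bar>))"
  proof (rule infsum_mono)
    show "F x (s * u x) \<le> F x (s * \<bar>u x\<bar>)" for x using F[of x "s * u x"] s(1) by (simp add: abs_mult)
  qed (intro controlled_summable[OF controlled_F] E_scale uE aE)+
  have le: "\<Phi> (\<lambda>x. s * \<bar>u x\<bar>) \<le> ground_level + s powr p / p * (Q (\<lambda>x. \<bar>u x\<bar>) - Q u)"
  proof -
    have "\<Phi> (\<lambda>x. s * \<bar>u x\<bar>) \<le> \<Phi> (\<lambda>x. s * u x) + s powr p / p * (Q (\<lambda>x. \<bar>u x\<bar>) - Q u)"
      unfolding energy_eq[OF E_scale[OF uE]] energy_eq[OF E_scale[OF aE]] total_energy_scale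
      using sumF s(1) by (simp add: right_diff_distrib diff_divide_distrib)
    then show ?thesis using energy_ray_le[OF u s(1)] min by linarith
  qed
  have Qeq: "Q (\<lambda>x. \<bar>u x\<bar>) = Q u"
  proof (rule ccontr)
    assume "\<not> ?thesis"
    then have "s powr p / p * (Q (\<lambda>x. \<bar>u x\<bar>) - Q u) < 0"
      using aQ s(1) p_gt_1 by (intro mult_pos_neg) auto
    then show False using le ground_level_le[OF s(2)] by linarith
  qed
  have min': "\<Phi> (\<lambda>x. s * \<bar>u x\<bar>) = ground_level"
    using le Qeq ground_level_le[OF s(2)] by simp
  have "0 < s * \<bar>u x\<bar>" for x
  proof (rule strong_maximum_principle[of "\<lambda>x. s * \<bar>u x\<bar>"])
    show "site_deriv (\<lambda>x. s * \<bar>u x\<bar>) y (s * \<bar>u y\<bar>) = 0" for y by (rule ground_state_critical[OF s(2) min'])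
  qed (use s mem_nehari in auto)
  then have nz: "u x \<noteq> 0" for x using s(1) by (metis abs_zero less_irrefl mult_zero_right)
  show ?thesis
  proof (cases "\<exists>x. 0 < u x")
    case True
    then obtain x where x: "0 < u x" by blast
    have "0 < u z" if y: "0 < u y" and yz: "adj y z" for y z
    proof (rule ccontr)
      assume "\<not> 0 < u z"
      then have z: "u z < 0" using nz[of z] by linarith
      have "infsum (bond_energy p V (\<lambda>x. \<bar>u x\<bar>)) UNIV < infsum (bond_energy p V u) UNIV"
      proof (rule infsum_strict_mono_real)
        show "bond_energy p V (\<lambda>x. \<bar>u x\<bar>) e \<le> bond_energy p V u e" for e
          by (rule bond_energy_lipschitz) auto
        have "\<bar>\<bar>u z\<bar> - \<bar>u y\<bar>\<bar> powr p < \<bar>u z - u y\<bar> powr p"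
          using y z p_gt_1 by (intro powr_less_mono2) auto
        then show "bond_energy p V (\<lambda>x. \<bar>u x\<bar>) (y, z) < bond_energy p V u (y, z)"
          using yz adj_irrefl[of y] by (auto simp: bond_energy_def bond_def conductance_def)
      qed (use energy_spaceD aE uE in auto)
      then show False using Qeq by (simp add: total_energy_def)
    qed
    then have "0 < u y" for y using adj_connected[of "\<lambda>y. 0 < u y" x y] x by blast
    then show ?thesis by blast
  next
    case False
    then show ?thesis using nz by (meson linorder_neqE_linordered_idom)
  qed
qed

end

theorem theorem1p1:
  fixes p a q :: real and T :: nat
    and V :: "int ^ 'n::finite \<Rightarrow> real"
    and f :: "int ^ 'n \<Rightarrow> real \<Rightarrow> real"
  assumes N: "2 \<le> CARD('n)"
    and p: "1 < p" "p < real CARD('n)"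
    and S1: "0 < T" "periodic T V" "periodic T f" "0 \<le> (INF x. V x)"
    and S2: "\<And>x. continuous_on UNIV (f x)"
      "0 < a" "crit_exp CARD('n) p < q"
      "\<And>x t. \<bar>f x t\<bar> \<le> a * (1 + \<bar>t\<bar> powr (q - 1))"
    and S3: "uniform_limit UNIV (\<lambda>t x. f x t / \<bar>t\<bar> powr (crit_exp CARD('n) p - 1)) (\<lambda>_. 0) (at 0)"
    and S4: "\<And>x. strict_mono_on ({..<0} \<union> {0<..}) (\<lambda>t. f x t / \<bar>t\<bar> powr (p - 1))"
    and S5: "\<And>M. \<forall>\<^sub>F t in at_infinity. \<forall>x. M \<le> primitive f x t / \<bar>t\<bar> powr p"
  shows "(\<exists>u. is_solution p V f u \<and> is_ground_state p V f u) \<and>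
    ((\<forall>x t. primitive f x t \<le> primitive f x \<bar>t\<bar>) \<longrightarrow>
      (\<forall>u. is_ground_state p V f u \<longrightarrow> (\<forall>x. 0 < u x) \<or> (\<forall>x. u x < 0)))"
proof -
  \<comment> \<open>By periodicity \<open>V\<close> takes finitely many values, so its infimum is a lower bound and not a default value.\<close>
  have V: "0 \<le> V x" for x
  proof -
    let ?B = "{z :: int ^ 'n. \<forall>i. z $ i \<in> {0..<int T}}"
    have "range V \<subseteq> V ` ?B"
    proof
      fix r assume "r \<in> range V"
      then obtain x where x: "r = V x" by blast
      obtain z k where "z \<in> ?B" "x = z + (\<chi> i. int T * k $ i)" using box_representative[OF S1(1), of x] by auto
      then show "r \<in> V ` ?B" using periodic_shift[OF S1(2)] x by blast
    qed
    then have "finite (range V)" using card_lattice_box(1)[of "{0..<int T}"] finite_surj by blast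
    then have "(INF x. V x) \<le> V x" by (intro cINF_lower bdd_below_finite) auto
    then show ?thesis using S1(4) by linarith
  qed
  interpret periodic_problem p "crit_exp CARD('n) p" V f T a q
    by unfold_locales (use p V S1 S2 S3 S4 S5 in auto)
  have gs: "is_ground_state p V f u \<longleftrightarrow> u \<in> nehari p V f \<and> energy p V f u = ground_level" for u
    by (simp add: is_ground_state_def ground_level_def)
  show ?thesis
    using ground_level_attained ground_state_solution ground_state_signed unfolding gs by blast
qed

end
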